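(* Let $1<p,q<\infty$ and $w\in A_p$ on $\mathbb R^n$. There exists $\sigma>1$ such that, if $H$ is a non-negative measurable function on $\mathbb R^n\times\mathbb R^n$ for which there is $C_H>0$ with $$\int_{|y|<r}H(x,y)^\sigma\,dy\le C_H\,r^n\qquad\text{for all }x\in\mathbb R^n,\ r>0,$$ then the vector-valued inequality $$\Bigl\|\Bigl(\sum_j|M_Hf_j|^q\Bigr)^{1/q}\Bigr\|_{L^p_w}\le C\,\Bigl\|\Bigl(\sum_j|f_j|^q\Bigr)^{1/q}\Bigr\|_{L^p_w}$$ holds for any sequence $\{f_j\}$, with a constant $C$ independent of $\{f_j\}$ and depending on $H$ only through $C_H$.
   Context: $M_Hf(x)=\sup_{r>0}\frac1{r^n}\int_{|y|<r}H(x,y)\,|f(x-y)|\,dy$. $L^p_w=L^p(\mathbb R^n,w(x)\,dx)$. $A_p$ is the Muckenhoupt class: positive locally integrable $w$ with $\sup_Q\bigl(\frac1{|Q|}\int_Qw\bigr)^{1/p}\bigl(\frac1{|Q|}\int_Qw^{-p'/p}\bigr)^{1/p'}<\infty$, the supremum over all cubes $Q\subset\mathbb R^n$, $1/p+1/p'=1$. *)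

theory Defs
  imports "HOL-Analysis.Analysis"
begin

(* All integrals, averages, suprema and norms below take values in [0,\<infinity>]
   (type ennreal), so no finiteness is built in and an infinite right-hand side
   is allowed.  "Measurable" means Lebesgue measurable. *)

(* t^a for t in [0,\<infinity>], with \<infinity>^a = \<infinity>.  Only meaningful for a > 0, the only
   range used below. *)
definition epowr :: "ennreal \<Rightarrow> real \<Rightarrow> ennreal"  (infixr \<open>epowr\<close> 80) where
  "t epowr a = (if t = \<infinity> then \<infinity> else ennreal (enn2real t powr a))"

(* Cubes have sides parallel to the coordinate axes. *)
definition cubes :: "(real ^ 'n) set set" where
  "cubes = {cbox a (\<chi> i. a $ i + l) | a l. 0 < l}"

definition average :: "(real ^ 'n) set \<Rightarrow> (real ^ 'n \<Rightarrow> real) \<Rightarrow> ennreal" where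
  "average Q g = (\<integral>\<^sup>+x\<in>Q. ennreal (g x) \<partial>lebesgue) / emeasure lebesgue Q"

definition locally_integrable :: "(real ^ 'n \<Rightarrow> real) \<Rightarrow> bool" where
  "locally_integrable w \<longleftrightarrow> (\<forall>K. compact K \<longrightarrow> set_integrable lebesgue K w)"

definition conj_exponent :: "real \<Rightarrow> real" where
  "conj_exponent p = p / (p - 1)"

lemma conj_exponent: "1 < p \<Longrightarrow> 1 / p + 1 / conj_exponent p = 1"
  by (simp add: conj_exponent_def field_simps)

(* Weights are understood up to null sets, so positivity is required almost
   everywhere.  The first average is then never 0 and, by local integrability,
   never \<infinity>; hence the convention 0 * \<infinity> = 0 of ennreal plays no role in the
   product. *)
definition muckenhoupt :: "real \<Rightarrow> (real ^ 'n \<Rightarrow> real) set" where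
  "muckenhoupt p = {w. w \<in> borel_measurable lebesgue \<and> (AE x in lebesgue. 0 < w x) \<and>
     locally_integrable w \<and>
     (SUP Q\<in>cubes.
        average Q w epowr (1 / p) *
        average Q (\<lambda>x. w x powr (- (conj_exponent p / p))) epowr (1 / conj_exponent p)) < \<infinity>}"

(* M_H, applied to complex-valued functions. *)
definition maximal_op ::
    "(real ^ 'n \<Rightarrow> real ^ 'n \<Rightarrow> real) \<Rightarrow> (real ^ 'n \<Rightarrow> complex) \<Rightarrow> real ^ 'n \<Rightarrow> ennreal" where
  "maximal_op H f x =
     (SUP r\<in>{0<..}. ennreal (1 / r ^ CARD('n)) *
        (\<integral>\<^sup>+y\<in>ball 0 r. ennreal (H x y * norm (f (x - y))) \<partial>lebesgue))"

definition weighted_Lp_norm ::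
    "real \<Rightarrow> (real ^ 'n \<Rightarrow> real) \<Rightarrow> (real ^ 'n \<Rightarrow> ennreal) \<Rightarrow> ennreal" where
  "weighted_Lp_norm p w g =
     (\<integral>\<^sup>+x. g x epowr p \<partial>density lebesgue (\<lambda>x. ennreal (w x))) epowr (1 / p)"

definition lq_norm :: "real \<Rightarrow> (nat \<Rightarrow> ennreal) \<Rightarrow> ennreal" where
  "lq_norm q a = (\<Sum>j. a j epowr q) epowr (1 / q)"

end

theory Submission
  imports Defs
begin

text \<open>
  Hoelder's inequality with exponents \<open>\<sigma>\<close> and \<open>s = \<sigma>'\<close> bounds \<open>M\<^sub>H f\<close> by a multiple of
  \<open>M\<^sub>s f = (M |f|\<^sup>s)\<^sup>1\<^sup>/\<^sup>s\<close>, and by the one-third trick \<open>M\<close> may be replaced by the maximal operators of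
  finitely many dyadic grids. For such an operator, Lerner's pointwise estimate bounds \<open>M\<close> on
  \<open>L\<^sup>q(u)\<close> by a constant depending only on \<open>q\<close> and the \<open>A\<^sub>q\<close> constant of \<open>u\<close>. The Rubio de Francia
  algorithm then majorizes every function by an \<open>A\<^sub>1\<close> weight of comparable norm, for which the reverse
  Hoelder inequality gives \<open>M\<^sub>s g \<le> C g\<close> with \<open>s > 1\<close> depending only on the \<open>A\<^sub>1\<close> constant. Hence \<open>M\<^sub>s\<close>
  is bounded on \<open>L\<^sup>q(u)\<close> for all \<open>u\<close> with \<open>A\<^sub>q\<close> constant below a given bound, which replaces the
  open-endedness of the \<open>A\<^sub>p\<close> classes. Summing over \<open>j\<close> is the vector-valued inequality for \<open>p = q\<close>,
  and extrapolation carries it from \<open>A\<^sub>q\<close> to \<open>A\<^sub>p\<close>.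
\<close>

text \<open>The order of the quantifiers shapes the proof: \<open>\<sigma>\<close> must be fixed
  from p, q and w alone, before H and before the weights u that extrapolation feeds into the L^q(u)
  bound. So every constant is an explicit function of an exponent and an A_p bound, and s is found
  by a chain: A bounds the A_q constants of all those u by \<open>extrapolation_const p q A\<close>,
  this bounds the norm of M on L^q(u), hence the A_1 constants of the Rubio de Francia majorants,
  hence the admissible power s. Nothing is assumed finite, so wherever a quantity is cancelled or
  absorbed, truncation first makes it finite: truncation by constants in the reverse Hoelder
  inequality, by multiples of a positive function of finite norm in extrapolation. Cubes are treated
  abstractly: nestedness, one-step doubling and outer approximation by unions of cubes do the work
  of covering and differentiation theorems, and all shifted grids share the same constants.\<close>

lemma epowr_ennreal: "0 \<le> x \<Longrightarrow> ennreal x epowr a = ennreal (x powr a)"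
  by (simp add: epowr_def)

lemma epowr_zero [simp]: "0 epowr a = 0"
  by (simp add: epowr_def)

lemma epowr_top [simp]: "top epowr a = top"
  by (simp add: epowr_def)

lemma epowr_one_left [simp]: "1 epowr a = 1"
  by (simp add: epowr_def)

lemma epowr_one [simp]: "t epowr 1 = t"
  by (cases t) (auto simp: epowr_ennreal)

lemma epowr_eq_0_iff [simp]: "t epowr a = 0 \<longleftrightarrow> t = 0"
  by (cases t) (auto simp: epowr_ennreal ennreal_eq_0_iff)

lemma epowr_eq_top_iff [simp]: "t epowr a = top \<longleftrightarrow> t = top"
  by (cases t) (auto simp: epowr_ennreal)

lemma epowr_less_top_iff [simp]: "t epowr a < top \<longleftrightarrow> t < top"
  by (metis epowr_eq_top_iff less_top)

lemma epowr_mono: "s \<le> t \<Longrightarrow> 0 < a \<Longrightarrow> s epowr a \<le> t epowr a"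
  by (cases s; cases t) (auto simp: epowr_ennreal top_unique intro!: ennreal_leI powr_mono2)

lemma epowr_mult: "0 < a \<Longrightarrow> (s * t) epowr a = s epowr a * t epowr a"
  by (cases s; cases t)
    (auto simp: epowr_ennreal powr_mult ennreal_mult_top ennreal_top_mult ennreal_eq_0_iff
      simp flip: ennreal_mult)

lemma epowr_epowr: "(t epowr a) epowr b = t epowr (a * b)"
  by (cases t) (auto simp: epowr_ennreal powr_powr)

lemma epowr_add: "t epowr (a + b) = t epowr a * t epowr b"
  by (cases t) (auto simp: epowr_ennreal powr_add simp flip: ennreal_mult)

lemma epowr_le_iff: "0 < a \<Longrightarrow> t epowr a \<le> s \<longleftrightarrow> t \<le> s epowr (1 / a)"
  using epowr_mono[of "t epowr a" s "1 / a"] epowr_mono[of t "s epowr (1 / a)" a]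
  by (auto simp: epowr_epowr)

text \<open>By \<open>epowr_le_iff\<close> the power is one half of a Galois connection, so it
  preserves arbitrary suprema, the empty one included since \<open>0 epowr a = 0\<close>.\<close>

lemma epowr_SUP: "0 < a \<Longrightarrow> (SUP i\<in>I. f i) epowr a = (SUP i\<in>I. f i epowr a)"
proof (rule antisym)
  assume a: "0 < a"
  have "f i \<le> (SUP i\<in>I. f i epowr a) epowr (1 / a)" if "i \<in> I" for i
    using that by (subst epowr_le_iff[OF a, symmetric]) (rule SUP_upper)
  then show "(SUP i\<in>I. f i) epowr a \<le> (SUP i\<in>I. f i epowr a)"
    unfolding epowr_le_iff[OF a] by (rule SUP_least)
  show "(SUP i\<in>I. f i epowr a) \<le> (SUP i\<in>I. f i) epowr a"
    by (intro SUP_least epowr_mono SUP_upper a)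
qed

lemma epowr_measurable [measurable]: "(\<lambda>t. t epowr a) \<in> borel_measurable borel"
  unfolding epowr_def by measurable

section \<open>Inequalities of Young, Hoelder and Jensen with values in [0, \<infinity>]\<close>

lemma young_ennreal:
  assumes "1 < p" "1 / p + 1 / q = 1"
  shows "a * b \<le> ennreal (1 / p) * a epowr p + ennreal (1 / q) * b epowr q"
proof -
  have q: "0 < q"
  proof (rule ccontr)
    assume "\<not> 0 < q"
    then have "1 / q \<le> 0" by simp
    moreover have "1 / p < 1" using assms by simp
    ultimately show False using assms by linarith
  qed
  show ?thesis
  proof (cases "a = top \<or> b = top")
    case True
    then have "a = 0 \<or> b = 0 \<or> a epowr p = top \<or> b epowr q = top" by auto
    then show ?thesis
    proof (elim disjE)
      assume "a epowr p = top" then show ?thesis using assms by (simp add: ennreal_mult_top)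
    next
      assume "b epowr q = top" then show ?thesis using q by (simp add: ennreal_mult_top)
    qed auto
  next
    case False
    then obtain x y where xy: "a = ennreal x" "b = ennreal y" "0 \<le> x" "0 \<le> y"
      by (metis ennreal_cases)
    have q1: "q > 1"
      using assms q by (smt (verit, best) divide_le_eq_1_pos le_divide_eq_1 divide_pos_pos)
    have "x * y \<le> x powr p / p + y powr q / q"
      using Youngs_inequality[of p q x y] xy assms q1 by auto
    then show ?thesis
      using xy assms q by (auto simp: epowr_ennreal simp flip: ennreal_mult ennreal_plus intro!: ennreal_leI)
  qed
qed

text \<open>Normalizing both factors reduces the claim to Young's inequality under the integral.
  This requires both norms in (0, \<infinity>); in the remaining cases either the product vanishes
  almost everywhere or the right-hand side is \<infinity>.\<close>

lemma nn_integral_Hoelder: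
  assumes "1 < p" "1 / p + 1 / q = 1"
    and [measurable]: "f \<in> borel_measurable M" "g \<in> borel_measurable M"
  shows "(\<integral>\<^sup>+x. f x * g x \<partial>M)
    \<le> (\<integral>\<^sup>+x. f x epowr p \<partial>M) epowr (1 / p) * (\<integral>\<^sup>+x. g x epowr q \<partial>M) epowr (1 / q)"
    (is "_ \<le> ?F epowr _ * ?G epowr _")
proof -
  have q: "0 < q"
  proof (rule ccontr)
    assume "\<not> 0 < q"
    then have "1 / q \<le> 0" by simp
    moreover have "1 / p < 1" using assms by simp
    ultimately show False using assms by linarith
  qed
  consider "?F = 0 \<or> ?G = 0" | "?F \<noteq> 0" "?G \<noteq> 0" "?F = top \<or> ?G = top"
    | "?F \<noteq> 0" "?G \<noteq> 0" "?F \<noteq> top" "?G \<noteq> top"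
    by blast
  then show ?thesis
  proof cases
    case 1
    then have "AE x in M. f x * g x = 0"
      by (auto simp: nn_integral_0_iff_AE elim: eventually_mono)
    then have "(\<integral>\<^sup>+x. f x * g x \<partial>M) = (\<integral>\<^sup>+x. 0 \<partial>M)"
      by (rule nn_integral_cong_AE)
    then show ?thesis by simp
  next
    case 2
    then show ?thesis
      by (auto simp: ennreal_mult_top ennreal_top_mult)
  next
    case 3
    define \<alpha> \<beta> where "\<alpha> = ?F epowr (1 / p)" and "\<beta> = ?G epowr (1 / q)"
    have ab: "\<alpha> \<noteq> 0" "\<alpha> \<noteq> top" "\<beta> \<noteq> 0" "\<beta> \<noteq> top"
      using 3 by (auto simp: \<alpha>_def \<beta>_def)
    have ap: "\<alpha> epowr p = ?F" "\<beta> epowr q = ?G"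
      using assms q by (auto simp: \<alpha>_def \<beta>_def epowr_epowr)
    have inv: "(inverse \<alpha>) epowr p * ?F = 1" "(inverse \<beta>) epowr q * ?G = 1"
      using ab assms(1) q
      by (simp_all flip: ap epowr_mult) (simp_all add: ennreal_divide_self less_top mult.commute flip: divide_ennreal_def)
    have "(\<integral>\<^sup>+x. (f x * inverse \<alpha>) * (g x * inverse \<beta>) \<partial>M) \<le>
       (\<integral>\<^sup>+x. ennreal (1 / p) * (f x * inverse \<alpha>) epowr p + ennreal (1 / q) * (g x * inverse \<beta>) epowr q \<partial>M)"
      by (intro nn_integral_mono young_ennreal assms)
    also have "\<dots> = ennreal (1 / p) * ((inverse \<alpha>) epowr p * ?F) + ennreal (1 / q) * ((inverse \<beta>) epowr q * ?G)"
      using assms(1) q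
      by (simp add: nn_integral_add nn_integral_cmult nn_integral_multc epowr_mult mult_ac)
    also have "\<dots> = 1"
      using assms q by (simp add: inv flip: ennreal_plus)
    finally have *: "(\<integral>\<^sup>+x. (f x * g x) * (inverse \<alpha> * inverse \<beta>) \<partial>M) \<le> 1"
      by (simp add: mult_ac)
    then have "(\<integral>\<^sup>+x. f x * g x \<partial>M) * (inverse \<alpha> * inverse \<beta>) \<le> 1"
      by (subst nn_integral_multc[symmetric]) auto
    then have "(\<integral>\<^sup>+x. f x * g x \<partial>M) * (inverse \<alpha> * inverse \<beta>) * (\<alpha> * \<beta>) \<le> 1 * (\<alpha> * \<beta>)"
      by (rule mult_right_mono) simp
    moreover have "inverse \<alpha> * inverse \<beta> * (\<alpha> * \<beta>) = (\<alpha> / \<alpha>) * (\<beta> / \<beta>)"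
      by (simp add: divide_ennreal_def mult_ac)
    moreover have "\<dots> = 1"
      using ab by (simp add: less_top)
    ultimately show ?thesis
      by (simp add: \<alpha>_def \<beta>_def mult.assoc)
  qed
qed

text \<open>Hoelder against the constant 1 for the probability measure with weights
  \<open>c\<close>. It stands in for the triangle inequality of L^p when the Rubio de Francia series
  is estimated.\<close>

lemma Jensen_suminf_epowr:
  fixes c a :: "nat \<Rightarrow> ennreal"
  assumes "1 < p" "(\<Sum>k. c k) = 1"
  shows "(\<Sum>k. c k * a k) epowr p \<le> (\<Sum>k. c k * a k epowr p)"
proof -
  define M where "M = density (count_space UNIV) c"
  define q where "q = p / (p - 1)"
  have pq: "1 / p + 1 / q = 1" using assms by (simp add: q_def field_simps)
  have int: "(\<integral>\<^sup>+k. g k \<partial>M) = (\<Sum>k. c k * g k)" for g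
    by (simp add: M_def nn_integral_density nn_integral_count_space_nat)
  have "(\<integral>\<^sup>+k. a k * 1 \<partial>M) \<le> (\<integral>\<^sup>+k. a k epowr p \<partial>M) epowr (1 / p) * (\<integral>\<^sup>+k. 1 epowr q \<partial>M) epowr (1 / q)"
    by (rule nn_integral_Hoelder[OF assms(1) pq]) (auto simp: M_def)
  then have "(\<Sum>k. c k * a k) \<le> (\<Sum>k. c k * a k epowr p) epowr (1 / p)"
    by (simp add: int assms del: nn_integral_const)
  then show ?thesis
    using assms by (simp add: epowr_le_iff)
qed

text \<open>The integral of \<lambda>^p d\<lambda>/\<lambda> over 0 < \<lambda> < t, with levels
  written as \<lambda> = \<open>exp (- s)\<close>. The levels then run over the whole line with
  Lebesgue measure, and a change of exponent is multiplication by an exponential.\<close>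

lemma nn_integral_exp_indicator:
  assumes "0 < p"
  shows "(\<integral>\<^sup>+s. ennreal (exp (- s * p)) * indicator {s. ennreal (exp (- s)) < t} s \<partial>lborel)
    = ennreal (1 / p) * t epowr p"
proof -
  have fin: "(\<integral>\<^sup>+s. ennreal (exp (- s * p)) * indicator {s. ennreal (exp (- s)) < ennreal x} s \<partial>lborel)
    = ennreal (1 / p) * ennreal x epowr p" if "0 < x" for x
  proof -
    have "(\<integral>\<^sup>+s. ennreal (exp (- s * p)) * indicator {s. ennreal (exp (- s)) < ennreal x} s \<partial>lborel)
      = (\<integral>\<^sup>+s. ennreal (exp (- s * p)) * indicator {- ln x..} s \<partial>lborel)"
    proof (rule nn_integral_cong_AE, rule AE_mp[OF AE_lborel_singleton[of "- ln x"]], rule AE_I2, rule impI)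
      fix s assume "s \<noteq> - ln x"
      moreover have "exp (- s) < x \<longleftrightarrow> - s < ln x"
        using that by (metis exp_less_cancel_iff exp_ln)
      ultimately show "ennreal (exp (- s * p)) * indicator {s. ennreal (exp (- s)) < ennreal x} s
         = ennreal (exp (- s * p)) * indicator {- ln x..} s"
        by (auto simp: indicator_def ennreal_less_iff)
    qed
    also have "\<dots> = ennreal (0 - (- exp (- (- ln x) * p) / p))"
    proof (rule nn_integral_FTC_atLeast)
      show "((\<lambda>s. - exp (- s * p) / p) has_real_derivative exp (- s * p)) (at s)" for s
        using assms by (auto intro!: derivative_eq_intros)
      have "filterlim (\<lambda>s. - p * s) at_bot at_top"
        by (rule filterlim_tendsto_neg_mult_at_bot[OF tendsto_const]) (use assms in \<open>auto intro: filterlim_ident\<close>)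
      then have "((\<lambda>s. exp (- s * p)) \<longlongrightarrow> 0) at_top"
        by (intro filterlim_compose[OF exp_at_bot]) (simp add: mult.commute)
      from tendsto_divide[OF tendsto_minus[OF this] tendsto_const, of p]
      show "((\<lambda>s. - exp (- s * p) / p) \<longlongrightarrow> 0) at_top" using assms by simp
    qed auto
    also have "\<dots> = ennreal (1 / p) * ennreal x epowr p"
      using that assms by (simp add: epowr_ennreal powr_def mult.commute flip: ennreal_mult)
    finally show ?thesis .
  qed
  show ?thesis
  proof (cases t)
    case (real x)
    then show ?thesis
      using fin[of x] by (cases "x = 0") auto
  next
    case top
    have "ennreal (1 / p) * of_nat n epowr p \<le>
       (\<integral>\<^sup>+s. ennreal (exp (- s * p)) * indicator {s. ennreal (exp (- s)) < t} s \<partial>lborel)" for n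
    proof (cases "n = 0")
      case False
      have "ennreal (1 / p) * of_nat n epowr p
         = (\<integral>\<^sup>+s. ennreal (exp (- s * p)) * indicator {s. ennreal (exp (- s)) < of_nat n} s \<partial>lborel)"
        using fin[of "real n"] False by (simp add: ennreal_of_nat_eq_real_of_nat)
      also have "\<dots> \<le> (\<integral>\<^sup>+s. ennreal (exp (- s * p)) * indicator {s. ennreal (exp (- s)) < t} s \<partial>lborel)"
        unfolding top by (intro nn_integral_mono) (auto simp: indicator_def)
      finally show ?thesis .
    qed simp
    then have "(SUP n. ennreal (1 / p) * of_nat n epowr p) \<le>
       (\<integral>\<^sup>+s. ennreal (exp (- s * p)) * indicator {s. ennreal (exp (- s)) < t} s \<partial>lborel)"
      by (rule SUP_least)
    moreover have "(SUP n. ennreal (1 / p) * of_nat n epowr p) = top"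
      using assms
      by (simp add: ennreal_SUP_of_nat_eq_top ennreal_mult_top flip: SUP_mult_left_ennreal epowr_SUP)
    ultimately show ?thesis
      using assms by (simp add: top top_unique ennreal_mult_top)
  qed
qed

section \<open>Maximal functions of laminar families\<close>

definition laminar :: "'a set set \<Rightarrow> bool" where
  "laminar \<G> \<longleftrightarrow> (\<forall>A\<in>\<G>. \<forall>B\<in>\<G>. A \<subseteq> B \<or> B \<subseteq> A \<or> A \<inter> B = {})"

lemma laminar_subset: "laminar \<G> \<Longrightarrow> \<H> \<subseteq> \<G> \<Longrightarrow> laminar \<H>"
  unfolding laminar_def by blast

text \<open>The maximal members of a finite laminar family are pairwise disjoint and have the same
  union, so the inequality can be summed over them. This replaces a covering lemma.\<close>

lemma emeasure_Union_laminar_finite_le: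
  assumes "finite \<G>" "laminar \<G>" "\<G> \<subseteq> sets N" and sets: "sets N' = sets N"
    and le: "\<And>Q. Q \<in> \<G> \<Longrightarrow> emeasure N Q \<le> emeasure N' Q"
  shows "emeasure N (\<Union>\<G>) \<le> emeasure N' (\<Union>\<G>)"
proof -
  define \<H> where "\<H> = {Q\<in>\<G>. \<forall>P\<in>\<G>. Q \<subseteq> P \<longrightarrow> P = Q}"
  have sub: "\<H> \<subseteq> \<G>" and fin: "finite \<H>"
    using assms(1) by (auto simp: \<H>_def)
  have "\<exists>P\<in>\<H>. Q \<subseteq> P" if Q: "Q \<in> \<G>" for Q
  proof -
    obtain P where "P \<in> \<G>" "Q \<subseteq> P" "\<forall>R\<in>\<G>. P \<subseteq> R \<longrightarrow> R = P"
      using finite_has_maximal2[OF assms(1) Q] by auto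
    then show ?thesis unfolding \<H>_def by auto
  qed
  then have U: "\<Union>\<G> = \<Union>\<H>" using sub by blast
  have disj: "disjoint_family_on (\<lambda>Q. Q) \<H>"
    unfolding disjoint_family_on_def
  proof (intro ballI impI)
    fix A B assume AB: "A \<in> \<H>" "B \<in> \<H>" "A \<noteq> B"
    with sub have "A \<subseteq> B \<or> B \<subseteq> A \<or> A \<inter> B = {}"
      using assms(2) unfolding laminar_def by (meson subsetD)
    with AB show "A \<inter> B = {}" unfolding \<H>_def by auto
  qed
  have "emeasure N (\<Union>\<H>) = (\<Sum>Q\<in>\<H>. emeasure N Q)"
    using sum_emeasure[of "\<lambda>Q. Q" \<H> N] disj fin sub assms(3) by auto
  also have "\<dots> \<le> (\<Sum>Q\<in>\<H>. emeasure N' Q)"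
    using sub by (intro sum_mono le) auto
  also have "\<dots> = emeasure N' (\<Union>\<H>)"
    using sum_emeasure[of "\<lambda>Q. Q" \<H> N'] disj fin sub assms(3) sets by auto
  finally show ?thesis by (simp add: U)
qed

text \<open>An infinite family may have no maximal members, as when cubes grow without bound, so the
  union is exhausted by finite subfamilies.\<close>

lemma emeasure_Union_laminar_le:
  assumes "countable \<G>" "laminar \<G>" "\<G> \<subseteq> sets N" and sets: "sets N' = sets N"
    and le: "\<And>Q. Q \<in> \<G> \<Longrightarrow> emeasure N Q \<le> emeasure N' Q"
  shows "emeasure N (\<Union>\<G>) \<le> emeasure N' (\<Union>\<G>)"
proof (cases "\<G> = {}")
  case False
  define A where "A n = \<Union>(from_nat_into \<G> ` {..n})" for n :: nat
  have ran: "from_nat_into \<G> ` {..n} \<subseteq> \<G>" for n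
    using from_nat_into[OF False] by auto
  have UA: "\<Union>\<G> = (\<Union>n. A n)"
  proof -
    have "\<Union>\<G> = \<Union>(range (from_nat_into \<G>))"
      using range_from_nat_into[OF False assms(1)] by simp
    then show ?thesis unfolding A_def by blast
  qed
  have inc: "incseq A"
    unfolding A_def by (intro monoI Union_mono image_mono) auto
  have sets_A: "range A \<subseteq> sets N"
    unfolding A_def using ran assms(3) by (auto intro!: sets.finite_UN)
  have "emeasure N (A n) \<le> emeasure N' (A n)" for n
    unfolding A_def
  proof (rule emeasure_Union_laminar_finite_le[OF _ laminar_subset[OF assms(2) ran] _ sets])
    show "from_nat_into \<G> ` {..n} \<subseteq> sets N" using ran assms(3) by blast
  qed (use ran le in auto)
  then have "(SUP n. emeasure N (A n)) \<le> (SUP n. emeasure N' (A n))"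
    by (intro SUP_mono) auto
  then show ?thesis
    using SUP_emeasure_incseq[OF sets_A inc] SUP_emeasure_incseq[of A N'] sets_A inc sets
    by (simp add: UA)
qed simp

definition mean :: "'a measure \<Rightarrow> 'a set \<Rightarrow> ('a \<Rightarrow> ennreal) \<Rightarrow> ennreal" where
  "mean N Q f = (\<integral>\<^sup>+x\<in>Q. f x \<partial>N) / emeasure N Q"

text \<open>The measure is a parameter because Lerner's estimate uses one grid with three measures.
  The indicator discards the sets that miss x, so a countable family gives a countable supremum of
  measurable functions.\<close>

definition maxfun :: "'a set set \<Rightarrow> 'a measure \<Rightarrow> ('a \<Rightarrow> ennreal) \<Rightarrow> 'a \<Rightarrow> ennreal" where
  "maxfun \<D> N f x = (SUP Q\<in>\<D>. mean N Q f * indicator Q x)"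

lemma mean_mono: "(\<And>x. x \<in> Q \<Longrightarrow> f x \<le> g x) \<Longrightarrow> mean N Q f \<le> mean N Q g"
  unfolding mean_def
  by (intro divide_right_mono_ennreal nn_integral_mono) (auto simp: indicator_def)

lemma mean_mono_AE:
  "(AE x in N. x \<in> Q \<longrightarrow> f x \<le> g x) \<Longrightarrow> mean N Q f \<le> mean N Q g"
  unfolding mean_def
  by (intro divide_right_mono_ennreal nn_integral_mono_AE) (auto simp: indicator_def elim: eventually_mono)

lemma mean_cmult:
  assumes [measurable]: "f \<in> borel_measurable N" "Q \<in> sets N"
  shows "mean N Q (\<lambda>x. c * f x) = c * mean N Q f"
  unfolding mean_def by (simp add: nn_integral_cmult mult.assoc ennreal_times_divide)

lemma mean_add:
  assumes [measurable]: "f \<in> borel_measurable N" "g \<in> borel_measurable N" "Q \<in> sets N"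
  shows "mean N Q (\<lambda>x. f x + g x) = mean N Q f + mean N Q g"
  unfolding mean_def by (simp add: nn_integral_add distrib_right add_divide_distrib_ennreal)

lemma mean_suminf:
  assumes [measurable]: "\<And>k::nat. f k \<in> borel_measurable N" "Q \<in> sets N"
  shows "mean N Q (\<lambda>x. \<Sum>k. f k x) = (\<Sum>k. mean N Q (f k))"
  unfolding mean_def by (simp add: nn_integral_suminf flip: ennreal_suminf_multc)

lemma mean_const_le: "Q \<in> sets N \<Longrightarrow> mean N Q (\<lambda>x. c) \<le> c"
proof -
  assume "Q \<in> sets N"
  then have "mean N Q (\<lambda>x. c) = c * (emeasure N Q / emeasure N Q)"
    by (simp add: mean_def nn_integral_cmult_indicator ennreal_times_divide)
  also have "\<dots> \<le> c * 1"
    by (intro mult_left_mono zero_le)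
      (cases "emeasure N Q = 0 \<or> emeasure N Q = top"; auto simp: ennreal_top_divide less_top)
  finally show ?thesis by simp
qed

lemma mean_mult_emeasure:
  "emeasure N Q \<noteq> 0 \<Longrightarrow> emeasure N Q \<noteq> top \<Longrightarrow> mean N Q f * emeasure N Q = (\<integral>\<^sup>+x\<in>Q. f x \<partial>N)"
  by (simp add: mean_def ennreal_divide_times less_top)

lemma mean_le_maxfun: "Q \<in> \<D> \<Longrightarrow> x \<in> Q \<Longrightarrow> mean N Q f \<le> maxfun \<D> N f x"
  unfolding maxfun_def by (rule SUP_upper2[of Q]) auto

lemma maxfun_least: "(\<And>Q. Q \<in> \<D> \<Longrightarrow> x \<in> Q \<Longrightarrow> mean N Q f \<le> c) \<Longrightarrow> maxfun \<D> N f x \<le> c"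
  unfolding maxfun_def
proof (rule SUP_least)
  fix Q assume *: "\<And>Q. Q \<in> \<D> \<Longrightarrow> x \<in> Q \<Longrightarrow> mean N Q f \<le> c" "Q \<in> \<D>"
  show "mean N Q f * indicator Q x \<le> c" using * by (cases "x \<in> Q") auto
qed

lemma maxfun_less_iff: "c < maxfun \<D> N f x \<longleftrightarrow> (\<exists>Q\<in>\<D>. x \<in> Q \<and> c < mean N Q f)"
  unfolding maxfun_def less_SUP_iff by (auto simp: indicator_def)

lemma maxfun_mono: "(\<And>x. f x \<le> g x) \<Longrightarrow> maxfun \<D> N f x \<le> maxfun \<D> N g x"
  by (intro maxfun_least order.trans[OF mean_mono mean_le_maxfun]) auto

lemma maxfun_mono_family: "\<D> \<subseteq> \<E> \<Longrightarrow> maxfun \<D> N f x \<le> maxfun \<E> N f x"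
  by (intro maxfun_least mean_le_maxfun) auto

lemma maxfun_measurable:
  assumes "countable \<D>" "\<D> \<subseteq> sets N" "sets N' = sets N"
  shows "maxfun \<D> N f \<in> borel_measurable N'"
  unfolding maxfun_def using assms
  by (intro borel_measurable_SUP borel_measurable_times borel_measurable_indicator) auto

lemma maxfun_add_le:
  assumes "f \<in> borel_measurable N" "g \<in> borel_measurable N" "\<D> \<subseteq> sets N"
  shows "maxfun \<D> N (\<lambda>x. f x + g x) x \<le> maxfun \<D> N f x + maxfun \<D> N g x"
  using assms by (intro maxfun_least) (auto simp: mean_add subset_iff intro!: add_mono mean_le_maxfun)

lemma maxfun_suminf_le:
  assumes "\<And>k::nat. f k \<in> borel_measurable N" "\<D> \<subseteq> sets N"
  shows "maxfun \<D> N (\<lambda>x. \<Sum>k. f k x) x \<le> (\<Sum>k. maxfun \<D> N (f k) x)"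
  using assms by (intro maxfun_least) (auto simp: mean_suminf subset_iff intro!: suminf_le mean_le_maxfun)

lemma maxfun_cmult:
  assumes "f \<in> borel_measurable N" "\<D> \<subseteq> sets N"
  shows "maxfun \<D> N (\<lambda>x. c * f x) x = c * maxfun \<D> N f x"
  unfolding maxfun_def using assms
  by (auto simp: SUP_mult_left_ennreal mean_cmult subset_iff mult.assoc intro!: SUP_cong)

lemma maxfun_const_le: "\<D> \<subseteq> sets N \<Longrightarrow> maxfun \<D> N (\<lambda>x. c) x \<le> c"
  by (intro maxfun_least mean_const_le) auto

text \<open>The level set is the union of the members with mean above c, and on each of them the
  measure with density \<open>c\<close> is at most the one with density \<open>f\<close>. The
  laminar comparison gives the constant 1 for every measure, which is the source of the weight-free
  bounds.\<close>

lemma maxfun_weak_type: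
  assumes D: "countable \<D>" "laminar \<D>" "\<D> \<subseteq> sets N"
    and f[measurable]: "f \<in> borel_measurable N"
  shows "c * emeasure N {x\<in>space N. c < maxfun \<D> N f x} \<le> (\<integral>\<^sup>+x. f x \<partial>N)"
proof -
  define \<G> where "\<G> = {Q\<in>\<D>. c < mean N Q f}"
  have G: "\<G> \<subseteq> \<D>" by (auto simp: \<G>_def)
  have U: "{x\<in>space N. c < maxfun \<D> N f x} = \<Union>\<G>"
    unfolding maxfun_less_iff \<G>_def using D(3) sets.sets_into_space by blast
  have "\<Union>\<G> \<in> sets N"
    using G D countable_subset[OF G D(1)] by (intro sets.countable_Union) auto
  have "emeasure (density N (\<lambda>x. c)) (\<Union>\<G>) \<le> emeasure (density N f) (\<Union>\<G>)"
  proof (rule emeasure_Union_laminar_le)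
    show "countable \<G>" "laminar \<G>" using G D countable_subset laminar_subset by metis+
    show "\<G> \<subseteq> sets (density N (\<lambda>x. c))" using G D by auto
    fix Q assume "Q \<in> \<G>"
    then have Q: "Q \<in> sets N" "c < mean N Q f" using G D by (auto simp: \<G>_def)
    have "c * emeasure N Q \<le> (\<integral>\<^sup>+x\<in>Q. f x \<partial>N)"
    proof (cases "emeasure N Q = 0 \<or> emeasure N Q = top")
      case True
      then show ?thesis
      proof
        \<comment> \<open>Division by \<infinity> gives 0, so such a set has mean 0, contradicting
          \<open>c < mean N Q f\<close>.\<close>
        assume "emeasure N Q = top"
        with Q show ?thesis by (simp add: mean_def)
      qed simp
    next
      case False
      then have "c * emeasure N Q \<le> mean N Q f * emeasure N Q"
        using Q by (intro mult_right_mono) auto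
      then show ?thesis using False by (simp add: mean_mult_emeasure)
    qed
    then show "emeasure (density N (\<lambda>x. c)) Q \<le> emeasure (density N f) Q"
      using Q by (simp add: emeasure_density nn_integral_cmult_indicator)
  qed simp
  also have "\<dots> \<le> (\<integral>\<^sup>+x. f x \<partial>N)"
    using \<open>\<Union>\<G> \<in> sets N\<close> by (auto simp: emeasure_density indicator_def intro!: nn_integral_mono)
  finally show ?thesis
    using \<open>\<Union>\<G> \<in> sets N\<close> U by (simp add: emeasure_density nn_integral_cmult_indicator)
qed

text \<open>Fubini for the exponential layer cake. The factor \<open>h\<close> lets one formula
  serve both for measures of level sets (\<open>h\<close> = 1) and for the integrals of f over level
  sets that weak type bounds produce (\<open>h\<close> = f).\<close>

lemma (in sigma_finite_measure) nn_integral_epowr_layer_cake: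
  assumes "0 < p" and [measurable]: "g \<in> borel_measurable M" "h \<in> borel_measurable M"
  shows "(\<integral>\<^sup>+x. h x * (ennreal (1 / p) * g x epowr p) \<partial>M) =
    (\<integral>\<^sup>+s. ennreal (exp (- s * p)) * (\<integral>\<^sup>+x\<in>{x. ennreal (exp (- s)) < g x}. h x \<partial>M) \<partial>lborel)"
proof -
  interpret P: pair_sigma_finite M lborel
    by (simp add: pair_sigma_finite_def sigma_finite_measure_axioms lborel.sigma_finite_measure_axioms)
  have "(\<integral>\<^sup>+x. h x * (ennreal (1 / p) * g x epowr p) \<partial>M) =
    (\<integral>\<^sup>+x. h x * (\<integral>\<^sup>+s. ennreal (exp (- s * p)) * indicator {s. ennreal (exp (- s)) < g x} s \<partial>lborel) \<partial>M)"
    by (simp only: nn_integral_exp_indicator[OF assms(1)])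
  also have "\<dots> = (\<integral>\<^sup>+x. (\<integral>\<^sup>+s. h x * (ennreal (exp (- s * p)) * indicator {s. ennreal (exp (- s)) < g x} s) \<partial>lborel) \<partial>M)"
    by (intro nn_integral_cong nn_integral_cmult[symmetric]) measurable
  also have "\<dots> = (\<integral>\<^sup>+s. (\<integral>\<^sup>+x. h x * (ennreal (exp (- s * p)) * indicator {s. ennreal (exp (- s)) < g x} s) \<partial>M) \<partial>lborel)"
    by (rule P.Fubini'[symmetric]) (unfold indicator_def, measurable)
  also have "\<dots> = (\<integral>\<^sup>+s. ennreal (exp (- s * p)) * (\<integral>\<^sup>+x\<in>{x. ennreal (exp (- s)) < g x}. h x \<partial>M) \<partial>lborel)"
    by (intro nn_integral_cong, subst nn_integral_cmult[symmetric])
      (auto simp: indicator_def mult_ac intro!: nn_integral_cong)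
  finally show ?thesis .
qed

text \<open>Equal to p times 2 times 2^(p-1) / (p-1): the p of the layer cake formula, the 2 from
  using the weak type bound at half the height, and the rest from integrating over the levels below
  2 f. It is independent of the measure.\<close>

definition doob_const :: "real \<Rightarrow> real" where
  "doob_const p = p * 2 powr p / (p - 1)"

lemma doob_const_nonneg: "1 < p \<Longrightarrow> 0 \<le> doob_const p"
  by (simp add: doob_const_def)

text \<open>
  Feeding the truncation \<open>f \<cdot> 1{f > \<lambda>/2}\<close> into the weak type estimate at height \<open>\<lambda>/2\<close> avoids
  absorbing the left-hand side, so no finiteness is needed.
\<close>

lemma (in sigma_finite_measure) maxfun_strong_type:
  assumes D: "countable \<D>" "laminar \<D>" "\<D> \<subseteq> sets M"
    and f[measurable]: "f \<in> borel_measurable M" and p: "1 < p"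
  shows "(\<integral>\<^sup>+x. maxfun \<D> M f x epowr p \<partial>M) \<le> ennreal (doob_const p) * (\<integral>\<^sup>+x. f x epowr p \<partial>M)"
proof -
  have [measurable]: "maxfun \<D> M f \<in> borel_measurable M" for f
    using D by (intro maxfun_measurable) auto
  have weak: "ennreal (exp (- s * p)) * (\<integral>\<^sup>+x\<in>{x. ennreal (exp (- s)) < maxfun \<D> M f x}. 1 \<partial>M)
     \<le> 2 * (ennreal (exp (- s * (p - 1))) * (\<integral>\<^sup>+x\<in>{x. ennreal (exp (- s)) < 2 * f x}. f x \<partial>M))" for s
  proof -
    define l where "l = ennreal (exp (- s) / 2)"
    define g where "g x = f x * indicator {x. ennreal (exp (- s)) < 2 * f x} x" for x
    have [measurable]: "g \<in> borel_measurable M" unfolding g_def by measurable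
    have l2: "ennreal (exp (- s)) = 2 * l" and l: "l < top" "0 < l"
      by (simp_all add: l_def flip: ennreal_numeral ennreal_mult)
    have f_le: "f x \<le> g x + l" for x
      using l ennreal_mult_le_mult_iff[of 2 "f x" l] by (auto simp: g_def indicator_def l2 not_less)
    have le: "maxfun \<D> M f x \<le> maxfun \<D> M g x + l" for x
    proof -
      have "maxfun \<D> M f x \<le> maxfun \<D> M (\<lambda>x. g x + l) x"
        using f_le by (rule maxfun_mono)
      also have "\<dots> \<le> maxfun \<D> M g x + maxfun \<D> M (\<lambda>x. l) x"
        by (intro maxfun_add_le) (use D in auto)
      also have "\<dots> \<le> maxfun \<D> M g x + l"
        by (intro add_left_mono maxfun_const_le D)
      finally show ?thesis .
    qed
    have "l < maxfun \<D> M g x" if "2 * l < maxfun \<D> M f x" for x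
    proof (rule ccontr)
      assume "\<not> l < maxfun \<D> M g x"
      then have "maxfun \<D> M g x + l \<le> 2 * l"
        by (simp add: mult_2 add_right_mono)
      with le[of x] that show False by (meson leD order_trans)
    qed
    then have "emeasure M {x\<in>space M. 2 * l < maxfun \<D> M f x} \<le> emeasure M {x\<in>space M. l < maxfun \<D> M g x}"
      by (intro emeasure_mono) auto
    then have "l * emeasure M {x\<in>space M. 2 * l < maxfun \<D> M f x} \<le> l * emeasure M {x\<in>space M. l < maxfun \<D> M g x}"
      by (rule mult_left_mono) simp
    also have "\<dots> \<le> (\<integral>\<^sup>+x. g x \<partial>M)"
      by (rule maxfun_weak_type[OF D]) measurable
    finally have *: "l * emeasure M {x\<in>space M. 2 * l < maxfun \<D> M f x} \<le> (\<integral>\<^sup>+x. g x \<partial>M)" .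
    have e: "ennreal (exp (- s * p)) = 2 * ennreal (exp (- s * (p - 1))) * l"
      by (simp add: l_def mult_exp_exp algebra_simps flip: ennreal_numeral ennreal_mult)
    have "(\<integral>\<^sup>+x\<in>{x. ennreal (exp (- s)) < maxfun \<D> M f x}. 1 \<partial>M) = emeasure M {x\<in>space M. 2 * l < maxfun \<D> M f x}"
      unfolding l2 by (subst nn_integral_indicator[symmetric], measurable)
        (rule nn_integral_cong, simp add: indicator_def)
    then show ?thesis
      using mult_left_mono[OF * zero_le, of "2 * ennreal (exp (- s * (p - 1)))"]
      unfolding e by (simp only: g_def mult.assoc)
  qed
  have "(\<integral>\<^sup>+x. maxfun \<D> M f x epowr p \<partial>M) = ennreal p * (\<integral>\<^sup>+x. 1 * (ennreal (1 / p) * maxfun \<D> M f x epowr p) \<partial>M)"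
    using p by (subst nn_integral_cmult[symmetric]) (auto simp: mult.assoc[symmetric] simp flip: ennreal_mult)
  also have "\<dots> = ennreal p * (\<integral>\<^sup>+s. ennreal (exp (- s * p)) * (\<integral>\<^sup>+x\<in>{x. ennreal (exp (- s)) < maxfun \<D> M f x}. 1 \<partial>M) \<partial>lborel)"
    using p by (subst nn_integral_epowr_layer_cake) auto
  also have "\<dots> \<le> ennreal p * (\<integral>\<^sup>+s. 2 * (ennreal (exp (- s * (p - 1))) * (\<integral>\<^sup>+x\<in>{x. ennreal (exp (- s)) < 2 * f x}. f x \<partial>M)) \<partial>lborel)"
    by (intro mult_left_mono nn_integral_mono weak) auto
  also have "\<dots> = ennreal p * (2 * (\<integral>\<^sup>+s. ennreal (exp (- s * (p - 1))) * (\<integral>\<^sup>+x\<in>{x. ennreal (exp (- s)) < 2 * f x}. f x \<partial>M) \<partial>lborel))"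
  proof (subst nn_integral_cmult)
    have "(\<lambda>s. \<integral>\<^sup>+x\<in>{x. ennreal (exp (- s)) < 2 * f x}. f x \<partial>M) \<in> borel_measurable lborel"
      unfolding indicator_def by measurable
    then show "(\<lambda>s. ennreal (exp (- s * (p - 1))) * (\<integral>\<^sup>+x\<in>{x. ennreal (exp (- s)) < 2 * f x}. f x \<partial>M)) \<in> borel_measurable lborel"
      by measurable
  qed simp
  also have "\<dots> = ennreal p * (2 * (\<integral>\<^sup>+x. f x * (ennreal (1 / (p - 1)) * (2 * f x) epowr (p - 1)) \<partial>M))"
    using p by (subst nn_integral_epowr_layer_cake) auto
  also have "(\<lambda>x. f x * (ennreal (1 / (p - 1)) * (2 * f x) epowr (p - 1)))
     = (\<lambda>x. ennreal (2 powr (p - 1) / (p - 1)) * f x epowr p)"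
  proof
    fix x
    have "f x epowr p = f x * f x epowr (p - 1)"
      using epowr_add[of "f x" 1 "p - 1"] by simp
    moreover have "2 epowr (p - 1) = ennreal (2 powr (p - 1))"
      using epowr_ennreal[of 2 "p - 1"] by simp
    ultimately show "f x * (ennreal (1 / (p - 1)) * (2 * f x) epowr (p - 1)) = ennreal (2 powr (p - 1) / (p - 1)) * f x epowr p"
      using p ennreal_mult[of "1 / (p - 1)" "2 powr (p - 1)"] by (simp add: epowr_mult mult_ac)
  qed
  also have "ennreal p * (2 * (\<integral>\<^sup>+x. ennreal (2 powr (p - 1) / (p - 1)) * f x epowr p \<partial>M))
     = ennreal p * 2 * ennreal (2 powr (p - 1) / (p - 1)) * (\<integral>\<^sup>+x. f x epowr p \<partial>M)"
    by (simp add: nn_integral_cmult mult.assoc)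
  also have "ennreal p * 2 * ennreal (2 powr (p - 1) / (p - 1)) = ennreal (doob_const p)"
    using p by (simp add: doob_const_def powr_diff divide_simps flip: ennreal_numeral ennreal_mult)
  finally show ?thesis .
qed

section \<open>Dyadic grids and weights\<close>

text \<open>Larger k means smaller cubes. \<open>D_doubling\<close> compares a cube with its child,
  as stopping arguments do. \<open>D_outer\<close> links cubes to arbitrary measurable sets and is
  what differentiation is derived from.\<close>

locale dyadic = sigma_finite_measure M for M :: "'a measure" +
  fixes D :: "int \<Rightarrow> 'a \<Rightarrow> 'a set" and \<kappa> :: real
  assumes space_UNIV: "space M = UNIV"
    and D_sets: "D k x \<in> sets M"
    and D_self: "x \<in> D k x"
    and D_eq: "y \<in> D k x \<Longrightarrow> D k y = D k x"
    and D_Suc: "D (k + 1) x \<subseteq> D k x"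
    and D_pos: "emeasure M (D k x) \<noteq> 0"
    and D_fin: "emeasure M (D k x) \<noteq> top"
    and D_doubling: "emeasure M (D k x) \<le> ennreal \<kappa> * emeasure M (D (k + 1) x)"
    and D_countable: "countable (range (D k))"
    and D_outer: "E \<in> sets M \<Longrightarrow> emeasure M E < top \<Longrightarrow> 0 < \<epsilon> \<Longrightarrow>
      \<exists>\<G>\<subseteq>(\<Union>k. range (D k)). E \<subseteq> \<Union>\<G> \<and> emeasure M (\<Union>\<G>) \<le> emeasure M E + ennreal \<epsilon>"
begin

definition grid :: "'a set set" where
  "grid = (\<Union>k. range (D k))"

lemma D_in_grid: "D k x \<in> grid"
  by (auto simp: grid_def)

lemma gridE:
  assumes "Q \<in> grid" obtains k x where "Q = D k x"
  using assms by (auto simp: grid_def)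

lemma countable_grid: "countable grid"
  unfolding grid_def using D_countable by auto

lemma grid_sets: "grid \<subseteq> sets M"
  using D_sets by (auto simp: grid_def)

lemma grid_sets' [measurable (raw)]: "Q \<in> grid \<Longrightarrow> Q \<in> sets M"
  using grid_sets by auto

lemma D_mono: "k \<le> l \<Longrightarrow> D l x \<subseteq> D k x"
proof (induction l rule: int_ge_induct)
  case (step i)
  then show ?case using D_Suc[of i x] by auto
qed simp

lemma laminar_grid: "laminar grid"
proof -
  have *: "D l y \<subseteq> D k x \<or> D k x \<inter> D l y = {}" if "k \<le> l" for k l x y
  proof (cases "D k x \<inter> D l y = {}")
    case False
    then obtain z where "z \<in> D k x" "z \<in> D l y" by auto
    then show ?thesis using D_mono[OF that, of z] D_eq by metis
  qed simp
  show ?thesis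
    unfolding laminar_def
  proof (intro ballI)
    fix A B assume "A \<in> grid" "B \<in> grid"
    then obtain k x l y where "A = D k x" "B = D l y" by (auto elim!: gridE)
    then show "A \<subseteq> B \<or> B \<subseteq> A \<or> A \<inter> B = {}"
      using *[of k l y x] *[of l k x y] by (cases "k \<le> l") auto
  qed
qed

lemma grid_pos: "Q \<in> grid \<Longrightarrow> emeasure M Q \<noteq> 0"
  using D_pos by (auto simp: grid_def)

lemma grid_fin: "Q \<in> grid \<Longrightarrow> emeasure M Q \<noteq> top"
  using D_fin by (auto simp: grid_def)

abbreviation dmax :: "('a \<Rightarrow> ennreal) \<Rightarrow> 'a \<Rightarrow> ennreal" where
  "dmax \<equiv> maxfun grid M"

lemma dmax_measurable [measurable]: "dmax f \<in> borel_measurable M"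
  by (rule maxfun_measurable[OF countable_grid grid_sets]) simp

definition dualw :: "real \<Rightarrow> ('a \<Rightarrow> real) \<Rightarrow> 'a \<Rightarrow> real" where
  "dualw p u x = u x powr (- 1 / (p - 1))"

text \<open>The p-th power of the Muckenhoupt product, over grid cubes only, with its bound A as a
  parameter on which later constants depend. Positivity is asked at every point because weights are
  raised to negative powers pointwise.\<close>

definition Ap :: "real \<Rightarrow> real \<Rightarrow> ('a \<Rightarrow> real) \<Rightarrow> bool" where
  "Ap p A u \<longleftrightarrow> u \<in> borel_measurable M \<and> (\<forall>x. 0 < u x) \<and>
     (\<forall>Q\<in>grid. mean M Q (\<lambda>x. ennreal (u x)) * mean M Q (\<lambda>x. ennreal (dualw p u x)) epowr (p - 1) \<le> ennreal A)"

lemma dualw_pos: "0 < u x \<Longrightarrow> 0 < dualw p u x"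
  by (simp add: dualw_def)

lemma dualw_measurable [measurable]: "u \<in> borel_measurable M \<Longrightarrow> dualw p u \<in> borel_measurable M"
  unfolding dualw_def by measurable

lemma mean_pos:
  assumes "Q \<in> grid" "\<And>x. 0 < f x" and [measurable]: "f \<in> borel_measurable M"
  shows "0 < mean M Q f"
proof -
  have [measurable]: "Q \<in> sets M" using assms(1) by measurable
  have "(\<integral>\<^sup>+x\<in>Q. f x \<partial>M) \<noteq> 0"
  proof
    assume "(\<integral>\<^sup>+x\<in>Q. f x \<partial>M) = 0"
    then have "AE x in M. f x * indicator Q x = 0"
      using assms(1) by (subst (asm) nn_integral_0_iff_AE) auto
    moreover have "f x \<noteq> 0" for x
      using assms(2)[of x] by simp
    ultimately have "AE x in M. x \<notin> Q"
      by (auto elim!: eventually_mono simp: indicator_def split: if_splits)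
    then have "emeasure M Q = 0"
      using assms(1) by (simp add: AE_iff_measurable[OF grid_sets'] space_UNIV)
    with grid_pos[OF assms(1)] show False by simp
  qed
  then show ?thesis
    using grid_fin[OF assms(1)] by (simp add: mean_def ennreal_zero_less_divide less_top zero_less_iff_neq_zero)
qed

text \<open>Both means are positive, so a finite product forces both to be finite. Local
  integrability of the weight and its dual is thus a consequence of \<open>Ap\<close>.\<close>

lemma Ap_mean_finite:
  assumes "Ap p A u" "Q \<in> grid" "1 < p"
  shows "mean M Q (\<lambda>x. ennreal (u x)) < top" "mean M Q (\<lambda>x. ennreal (dualw p u x)) < top"
proof -
  have [measurable]: "u \<in> borel_measurable M" and u: "\<And>x. 0 < u x"
    and A: "mean M Q (\<lambda>x. ennreal (u x)) * mean M Q (\<lambda>x. ennreal (dualw p u x)) epowr (p - 1) < top"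
    using assms by (auto simp: Ap_def intro: le_less_trans)
  have "0 < mean M Q (\<lambda>x. ennreal (u x))" "0 < mean M Q (\<lambda>x. ennreal (dualw p u x))"
    using assms u by (auto intro!: mean_pos dualw_pos)
  with A show "mean M Q (\<lambda>x. ennreal (u x)) < top" "mean M Q (\<lambda>x. ennreal (dualw p u x)) < top"
    by (auto simp: ennreal_mult_less_top)
qed

text \<open>Raising the product to the power \<open>1 / (p - 1)\<close> exchanges the roles of the
  two means. Extrapolation uses this to run the Rubio de Francia algorithm on the dual side.\<close>

lemma Ap_dualw:
  assumes "Ap p A u" "1 < p" "0 \<le> A"
  shows "Ap (p / (p - 1)) (A powr (1 / (p - 1))) (dualw p u)"
proof -
  have [measurable]: "u \<in> borel_measurable M" and u: "\<And>x. 0 < u x"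
    using assms by (auto simp: Ap_def)
  have p: "p / (p - 1) - 1 = 1 / (p - 1)"
    using assms(2) by (simp add: field_simps)
  have dd: "dualw (p / (p - 1)) (dualw p u) x = u x" for x
  proof -
    have "(- 1 / (p - 1)) * (- 1 / (1 / (p - 1))) = 1" using assms(2) by (simp add: field_simps)
    then show ?thesis using u[of x] by (simp only: dualw_def p powr_powr) simp
  qed
  have "mean M Q (\<lambda>x. ennreal (dualw p u x)) * mean M Q (\<lambda>x. ennreal (u x)) epowr (1 / (p - 1))
      \<le> ennreal (A powr (1 / (p - 1)))" if "Q \<in> grid" for Q
  proof -
    have "(mean M Q (\<lambda>x. ennreal (u x)) * mean M Q (\<lambda>x. ennreal (dualw p u x)) epowr (p - 1)) epowr (1 / (p - 1))
       \<le> ennreal A epowr (1 / (p - 1))"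
      using assms that by (intro epowr_mono) (auto simp: Ap_def)
    then show ?thesis
      using assms by (simp add: epowr_mult epowr_epowr epowr_ennreal mult.commute)
  qed
  then show ?thesis
    using u by (auto simp: Ap_def dd p dualw_pos)
qed

text \<open>Dividing f by u trades its mean for one in the measure u dx, at the price of the mean of
  u, which has to be finite for the cancellation.\<close>

lemma mean_density:
  assumes "Q \<in> grid" and u: "\<And>x. 0 < u x" "mean M Q (\<lambda>x. ennreal (u x)) < top"
    and [measurable]: "u \<in> borel_measurable M" "f \<in> borel_measurable M"
  shows "mean M Q f = mean M Q (\<lambda>x. ennreal (u x)) *
    mean (density M (\<lambda>x. ennreal (u x))) Q (\<lambda>x. f x * ennreal (1 / u x))"
proof -
  have [measurable]: "Q \<in> sets M" using assms(1) by measurable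
  define U where "U = (\<integral>\<^sup>+x\<in>Q. ennreal (u x) \<partial>M)"
  have "0 < mean M Q (\<lambda>x. ennreal (u x))"
    using assms by (intro mean_pos) auto
  then have U: "U \<noteq> 0" "U \<noteq> top"
    using u(2) grid_fin[OF assms(1)] by (auto simp: mean_def U_def[symmetric] ennreal_top_divide)
  have "mean (density M (\<lambda>x. ennreal (u x))) Q (\<lambda>x. f x * ennreal (1 / u x)) =
     (\<integral>\<^sup>+x. ennreal (u x) * (f x * ennreal (1 / u x) * indicator Q x) \<partial>M) / U"
    by (simp add: mean_def U_def emeasure_density nn_integral_density)
  also have "(\<lambda>x. ennreal (u x) * (f x * ennreal (1 / u x) * indicator Q x)) = (\<lambda>x. f x * indicator Q x)"
  proof
    fix x
    have "ennreal (u x) * ennreal (1 / u x) = 1"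
      using u(1)[of x] by (simp flip: ennreal_mult)
    then show "ennreal (u x) * (f x * ennreal (1 / u x) * indicator Q x) = f x * indicator Q x"
      by (metis mult.assoc mult.commute mult.right_neutral)
  qed
  finally have "mean (density M (\<lambda>x. ennreal (u x))) Q (\<lambda>x. f x * ennreal (1 / u x)) = (\<integral>\<^sup>+x\<in>Q. f x \<partial>M) / U" .
  moreover have "U * ((\<integral>\<^sup>+x\<in>Q. f x \<partial>M) / U) = (\<integral>\<^sup>+x\<in>Q. f x \<partial>M)"
    using U by (metis ennreal_times_divide mult.commute ennreal_mult_divide_eq)
  moreover have "U / emeasure M Q * ((\<integral>\<^sup>+x\<in>Q. f x \<partial>M) / U) = U * ((\<integral>\<^sup>+x\<in>Q. f x \<partial>M) / U) / emeasure M Q"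
    by (simp add: divide_ennreal_def mult_ac)
  moreover have "mean M Q (\<lambda>x. ennreal (u x)) = U / emeasure M Q"
    by (simp add: mean_def U_def)
  ultimately show ?thesis
    by (simp only: mean_def[of M Q f])
qed

text \<open>The strong type bounds of M_v on L^p(v) and of M_u on L^p'(u), with p' =
  \<open>p / (p - 1)\<close>, and the power of A left by the pointwise estimate.\<close>

definition lerner_const :: "real \<Rightarrow> real \<Rightarrow> real" where
  "lerner_const p A = A powr (p / (p - 1)) * doob_const (p / (p - 1)) * doob_const p"

lemma lerner_const_nonneg: "1 < p \<Longrightarrow> 0 \<le> lerner_const p A"
  by (simp add: lerner_const_def doob_const_nonneg field_simps)

text \<open>
  Lerner's argument: with \<open>v\<close> the dual weight and \<open>M\<^sub>u\<close>, \<open>M\<^sub>v\<close> the maximal functions of the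
  measures \<open>u dx\<close>, \<open>v dx\<close>, the \<open>A\<^sub>p\<close> condition gives pointwise
  \<open>(M f)\<^sup>p\<^sup>-\<^sup>1 \<le> A M\<^sub>u((M\<^sub>v(f/v))\<^sup>p\<^sup>-\<^sup>1 / u)\<close>, and the strong type bounds of \<open>M\<^sub>u\<close>, \<open>M\<^sub>v\<close> do not
  depend on the weights.
\<close>

theorem dmax_bounded_Ap:
  assumes p: "1 < p" and A: "0 \<le> A" and Ap: "Ap p A u" and f[measurable]: "f \<in> borel_measurable M"
  shows "(\<integral>\<^sup>+x. dmax f x epowr p * ennreal (u x) \<partial>M)
    \<le> ennreal (lerner_const p A) * (\<integral>\<^sup>+x. f x epowr p * ennreal (u x) \<partial>M)"
proof -
  have u_meas[measurable]: "u \<in> borel_measurable M" and u: "\<And>x. 0 < u x"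
    and A_le: "\<And>Q. Q \<in> grid \<Longrightarrow> mean M Q (\<lambda>x. ennreal (u x)) * mean M Q (\<lambda>x. ennreal (dualw p u x)) epowr (p - 1) \<le> ennreal A"
    using Ap by (auto simp: Ap_def)
  define p' where "p' = p / (p - 1)"
  have p': "1 < p'" "(p - 1) * p' = p" using p by (auto simp: p'_def field_simps)
  define v where "v = dualw p u"
  have v_meas[measurable]: "v \<in> borel_measurable M" and v: "\<And>x. 0 < v x"
    using u by (auto simp: v_def dualw_pos)
  define U where "U = density M (\<lambda>x. ennreal (u x))"
  define V where "V = density M (\<lambda>x. ennreal (v x))"
  have setsUV[measurable_cong]: "sets U = sets M" "sets V = sets M"
    by (auto simp: U_def V_def)
  interpret U: sigma_finite_measure U
    unfolding U_def by (subst sigma_finite_iff_density_finite) auto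
  interpret V: sigma_finite_measure V
    unfolding V_def by (subst sigma_finite_iff_density_finite) auto
  note fin = Ap_mean_finite[OF Ap _ p]
  define fv where "fv x = f x * ennreal (1 / v x)" for x
  define H where "H = maxfun grid V fv"
  define h where "h x = H x epowr (p - 1)" for x
  define hu where "hu x = h x * ennreal (1 / u x)" for x
  define G where "G = maxfun grid U hu"
  have [measurable]: "fv \<in> borel_measurable M" "H \<in> borel_measurable M" "G \<in> borel_measurable M"
    unfolding fv_def H_def G_def
    by (auto intro!: maxfun_measurable[OF countable_grid] simp: setsUV grid_sets)
  have [measurable]: "h \<in> borel_measurable M" unfolding h_def by measurable
  have [measurable]: "hu \<in> borel_measurable M" unfolding hu_def by measurable
  have ptw: "dmax f x \<le> (ennreal A * G x) epowr (1 / (p - 1))" for x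
  proof (rule maxfun_least)
    fix Q assume Q: "Q \<in> grid" "x \<in> Q"
    have [measurable]: "Q \<in> sets M" using Q by measurable
    let ?mu = "mean M Q (\<lambda>x. ennreal (u x))" and ?mv = "mean M Q (\<lambda>x. ennreal (v x))"
    have mu: "?mu < top" "0 < ?mu" "?mv < top"
      using fin Q u by (auto simp: v_def intro!: mean_pos)
    have "mean M Q f = ?mv * mean V Q fv"
      unfolding fv_def V_def by (rule mean_density[OF Q(1) v mu(3)]) measurable
    then have "mean M Q f epowr (p - 1) = ?mv epowr (p - 1) * mean V Q fv epowr (p - 1)"
      using p by (simp add: epowr_mult)
    also have "mean V Q fv epowr (p - 1) \<le> mean M Q h"
    proof -
      \<comment> \<open>On Q the constant \<open>mean V Q fv\<close> is at most \<open>H\<close>, so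
        its power is at most the mean of \<open>h\<close>. Here M_v enters.\<close>
      have "mean V Q fv epowr (p - 1) = mean M Q (\<lambda>x. mean V Q fv epowr (p - 1))"
        using grid_pos[OF Q(1)] grid_fin[OF Q(1)]
        by (simp add: mean_def nn_integral_cmult_indicator ennreal_mult_divide_eq)
      also have "\<dots> \<le> mean M Q h"
        unfolding h_def H_def using p by (intro mean_mono epowr_mono mean_le_maxfun Q) auto
      finally show ?thesis .
    qed
    also have "mean M Q h = ?mu * mean U Q hu"
      unfolding hu_def U_def by (rule mean_density[OF Q(1) u mu(1)]) measurable
    also have "mean U Q hu \<le> G x"
      unfolding G_def using Q by (intro mean_le_maxfun)
    also have "?mv epowr (p - 1) * (?mu * G x) = (?mu * ?mv epowr (p - 1)) * G x"
      by (simp add: mult_ac)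
    also have "\<dots> \<le> ennreal A * G x"
      unfolding v_def using A_le[OF Q(1)] by (intro mult_right_mono) auto
    finally show "mean M Q f \<le> (ennreal A * G x) epowr (1 / (p - 1))"
      using p by (simp add: epowr_le_iff mult_left_mono mult_right_mono)
  qed
  have ptw': "dmax f x epowr p \<le> ennreal (A powr p') * G x epowr p'" for x
  proof -
    have "dmax f x epowr p \<le> ((ennreal A * G x) epowr (1 / (p - 1))) epowr p"
      using p ptw by (intro epowr_mono) auto
    also have "\<dots> = ennreal (A powr p') * G x epowr p'"
      using p A by (simp add: epowr_epowr p'_def[symmetric] epowr_mult epowr_ennreal)
        (simp add: p'_def epowr_mult epowr_ennreal powr_powr)
    finally show ?thesis .
  qed
  have "(\<integral>\<^sup>+x. dmax f x epowr p * ennreal (u x) \<partial>M) \<le> (\<integral>\<^sup>+x. ennreal (A powr p') * G x epowr p' * ennreal (u x) \<partial>M)"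
    by (intro nn_integral_mono mult_right_mono ptw') auto
  also have "\<dots> = ennreal (A powr p') * (\<integral>\<^sup>+x. G x epowr p' \<partial>U)"
  proof -
    have "(\<integral>\<^sup>+x. G x epowr p' \<partial>U) = (\<integral>\<^sup>+x. G x epowr p' * ennreal (u x) \<partial>M)"
      unfolding U_def by (subst nn_integral_density) (simp_all add: mult.commute)
    then show ?thesis by (simp add: nn_integral_cmult mult.assoc)
  qed
  also have "(\<integral>\<^sup>+x. G x epowr p' \<partial>U) \<le> ennreal (doob_const p') * (\<integral>\<^sup>+x. hu x epowr p' \<partial>U)"
    unfolding G_def by (intro U.maxfun_strong_type countable_grid laminar_grid p') (auto simp: setsUV grid_sets)
  also have "(\<integral>\<^sup>+x. hu x epowr p' \<partial>U) = (\<integral>\<^sup>+x. H x epowr p \<partial>V)"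
  proof -
    \<comment> \<open>Because u^(1-p') = v, the L^p'(u) integral of \<open>hu\<close> is the L^p(v)
      integral of \<open>H\<close>; the inverse relation v^(1-p) = u brings the weight back at the
      end.\<close>
    have "ennreal (u x) * hu x epowr p' = ennreal (v x) * H x epowr p" for x
    proof -
      have "u x * (1 / u x) powr p' = v x"
      proof -
        have "u x * (1 / u x) powr p' = u x powr 1 * u x powr (- p')"
          using u[of x] by (simp add: powr_minus divide_inverse inverse_powr)
        also have "\<dots> = u x powr (1 - p')" by (simp only: powr_add[symmetric]) simp
        also have "1 - p' = - 1 / (p - 1)" using p by (simp add: p'_def field_simps)
        finally show ?thesis by (simp add: v_def dualw_def)
      qed
      then have "ennreal (u x) * ennreal ((1 / u x) powr p') = ennreal (v x)"
        using u[of x] by (simp flip: ennreal_mult)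
      then show ?thesis
        using p' u[of x] by (simp add: hu_def h_def epowr_mult epowr_epowr epowr_ennreal)
          (metis mult.assoc mult.commute)
    qed
    then show ?thesis by (simp add: U_def V_def nn_integral_density)
  qed
  also have "\<dots> \<le> ennreal (doob_const p) * (\<integral>\<^sup>+x. fv x epowr p \<partial>V)"
    unfolding H_def by (intro V.maxfun_strong_type countable_grid laminar_grid p) (auto simp: setsUV grid_sets)
  also have "(\<integral>\<^sup>+x. fv x epowr p \<partial>V) = (\<integral>\<^sup>+x. f x epowr p * ennreal (u x) \<partial>M)"
  proof -
    have "ennreal (v x) * fv x epowr p = f x epowr p * ennreal (u x)" for x
    proof -
      have "v x * (1 / v x) powr p = v x powr (1 - p)"
        using v[of x] by (simp add: divide_inverse inverse_powr powr_diff)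
      also have "\<dots> = u x powr ((- 1 / (p - 1)) * (1 - p))"
        by (simp add: v_def dualw_def powr_powr)
      also have "(- 1 / (p - 1)) * (1 - p) = 1" using p by (simp add: field_simps)
      finally have "v x * (1 / v x) powr p = u x" using u[of x] by simp
      then have "ennreal (v x) * ennreal ((1 / v x) powr p) = ennreal (u x)"
        using v[of x] by (simp flip: ennreal_mult)
      then show ?thesis
        using p v[of x] by (simp add: fv_def epowr_mult epowr_ennreal)
          (metis mult.assoc mult.commute)
    qed
    then show ?thesis by (simp add: V_def nn_integral_density)
  qed
  finally show ?thesis
    using p p' by (simp add: lerner_const_def p'_def[symmetric] doob_const_nonneg ennreal_mult mult.assoc mult_left_mono)
qed

text \<open>The majorant is the sum of M^k f / (2 B)^k. Applying M shifts the series by one index,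
  which costs the factor 2 B, while the norm of M^k f is at most B^k times that of f, so the norms
  form a geometric series.\<close>

lemma rubio_de_francia:
  assumes p: "1 < p" and B: "0 < B" and sets[measurable_cong]: "sets N = sets M"
    and bdd: "\<And>f. f \<in> borel_measurable M \<Longrightarrow>
      (\<integral>\<^sup>+x. dmax f x epowr p \<partial>N) \<le> ennreal (B powr p) * (\<integral>\<^sup>+x. f x epowr p \<partial>N)"
    and f[measurable]: "f \<in> borel_measurable M"
  obtains g where "g \<in> borel_measurable M" "\<And>x. f x \<le> g x" "\<And>x. dmax g x \<le> ennreal (2 * B) * g x"
    "(\<integral>\<^sup>+x. g x epowr p \<partial>N) \<le> ennreal (2 powr p) * (\<integral>\<^sup>+x. f x epowr p \<partial>N)"
proof -
  define m where "m k = (dmax ^^ k) f" for k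
  have m0: "m 0 = f" and mS: "m (Suc k) = dmax (m k)" for k
    by (simp_all add: m_def)
  have [measurable]: "m k \<in> borel_measurable M" for k
    by (cases k) (auto simp: m0 mS)
  define c where "c k = ennreal ((1 / (2 * B)) ^ k)" for k
  define g where "g x = (\<Sum>k. c k * m k x)" for x
  show ?thesis
  proof
    show "g \<in> borel_measurable M" unfolding g_def by measurable
    show "f x \<le> g x" for x
      using sum_le_suminf[of "\<lambda>k. c k * m k x" "{0}"] by (simp add: g_def c_def m0 summableI)
    show "dmax g x \<le> ennreal (2 * B) * g x" for x
    proof -
      have "dmax g x \<le> (\<Sum>k. dmax (\<lambda>x. c k * m k x) x)"
        unfolding g_def by (intro maxfun_suminf_le grid_sets) measurable
      also have "\<dots> = (\<Sum>k. c k * m (Suc k) x)"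
        by (simp add: maxfun_cmult grid_sets mS)
      also have "\<dots> = (\<Sum>k. ennreal (2 * B) * (c (Suc k) * m (Suc k) x))"
        using B by (intro suminf_cong) (simp add: c_def mult.assoc[symmetric] flip: ennreal_mult)
      also have "\<dots> = ennreal (2 * B) * (\<Sum>k. c (Suc k) * m (Suc k) x)"
        by simp
      also have "(\<Sum>k. c (Suc k) * m (Suc k) x) \<le> g x"
        unfolding g_def by (subst suminf_offset[where i=1]) (auto simp: summableI)
      finally show ?thesis by (simp add: mult_left_mono)
    qed
    have mk: "(\<integral>\<^sup>+x. m k x epowr p \<partial>N) \<le> ennreal ((B powr p) ^ k) * (\<integral>\<^sup>+x. f x epowr p \<partial>N)" for k
    proof (induction k)
      case (Suc k)
      have "(\<integral>\<^sup>+x. m (Suc k) x epowr p \<partial>N) \<le> ennreal (B powr p) * (\<integral>\<^sup>+x. m k x epowr p \<partial>N)"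
        unfolding mS by (rule bdd) measurable
      also have "\<dots> \<le> ennreal (B powr p) * (ennreal ((B powr p) ^ k) * (\<integral>\<^sup>+x. f x epowr p \<partial>N))"
        by (intro mult_left_mono Suc) auto
      finally show ?case by (simp add: ennreal_mult mult.assoc)
    qed (simp add: m0)
    \<comment> \<open>1 / (2 B)^k is split as \<open>d k\<close> times 2 / B^k, where
      \<open>d\<close> has total mass 1, so that Jensen applies. The 2 left over is the origin of
      \<open>2 powr p\<close>.\<close>
    define d where "d k = ennreal ((1 / 2) ^ Suc k)" for k
    have d: "(\<Sum>k. d k) = 1"
      using power_half_series unfolding d_def by (subst suminf_ennreal_eq[where x=1]) auto
    have g_d: "g x = (\<Sum>k. d k * (ennreal (2 * (1 / B) ^ k) * m k x))" for x
      unfolding g_def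
      using B by (intro suminf_cong)
        (simp add: c_def d_def mult.assoc[symmetric] power_divide power_mult_distrib flip: ennreal_mult)
    have "(\<integral>\<^sup>+x. g x epowr p \<partial>N) \<le> (\<integral>\<^sup>+x. (\<Sum>k. d k * (ennreal (2 * (1 / B) ^ k) * m k x) epowr p) \<partial>N)"
      unfolding g_d by (intro nn_integral_mono Jensen_suminf_epowr p d)
    also have "\<dots> = (\<Sum>k. d k * (ennreal ((2 * (1 / B) ^ k) powr p) * (\<integral>\<^sup>+x. m k x epowr p \<partial>N)))"
      using p B by (simp add: nn_integral_suminf nn_integral_cmult epowr_mult epowr_ennreal)
    also have "\<dots> \<le> (\<Sum>k. d k * (ennreal (2 powr p) * (\<integral>\<^sup>+x. f x epowr p \<partial>N)))"
    proof (intro suminf_le summableI mult_left_mono)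
      fix k
      have e: "(2 * (1 / B) ^ k) powr p * (B powr p) ^ k = 2 powr p"
        using B by (simp add: powr_mult powr_divide powr_power mult.commute power_divide flip: powr_realpow)
          (simp add: powr_powr mult.commute)
      have "ennreal ((2 * (1 / B) ^ k) powr p) * (\<integral>\<^sup>+x. m k x epowr p \<partial>N)
         \<le> ennreal ((2 * (1 / B) ^ k) powr p) * (ennreal ((B powr p) ^ k) * (\<integral>\<^sup>+x. f x epowr p \<partial>N))"
        by (intro mult_left_mono mk) auto
      also have "\<dots> = ennreal (2 powr p) * (\<integral>\<^sup>+x. f x epowr p \<partial>N)"
        using e by (simp add: mult.assoc[symmetric] flip: ennreal_mult)
      finally show "ennreal ((2 * (1 / B) ^ k) powr p) * (\<integral>\<^sup>+x. m k x epowr p \<partial>N) \<le> ennreal (2 powr p) * (\<integral>\<^sup>+x. f x epowr p \<partial>N)" .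
    qed auto
    also have "\<dots> = ennreal (2 powr p) * (\<integral>\<^sup>+x. f x epowr p \<partial>N)"
      using d by simp
    finally show "(\<integral>\<^sup>+x. g x epowr p \<partial>N) \<le> ennreal (2 powr p) * (\<integral>\<^sup>+x. f x epowr p \<partial>N)" .
  qed
qed

end

section \<open>Reverse Hoelder inequality and the maximal operator with powers\<close>

context dyadic
begin

text \<open>Localizing to P makes the maximal function vanish off P, so its positive level sets have
  finite measure.\<close>

definition subgrid :: "'a set \<Rightarrow> 'a set set" where
  "subgrid P = {Q\<in>grid. Q \<subseteq> P}"

lemma subgrid_family: "countable (subgrid P)" "laminar (subgrid P)" "subgrid P \<subseteq> sets M" "subgrid P \<subseteq> grid"
proof -
  show *: "subgrid P \<subseteq> grid" by (auto simp: subgrid_def)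
  then show "countable (subgrid P)" "laminar (subgrid P)" "subgrid P \<subseteq> sets M"
    using countable_grid laminar_grid grid_sets by (auto intro: countable_subset laminar_subset)
qed

lemma maxfun_subgrid_measurable [measurable]: "maxfun (subgrid P) M f \<in> borel_measurable M"
  by (rule maxfun_measurable) (auto simp: subgrid_family)

lemma emeasure_grid_cover_le:
  assumes "\<G> \<subseteq> subgrid P" and f[measurable]: "f \<in> borel_measurable M" "g \<in> borel_measurable M"
    and le: "\<And>Q. Q \<in> \<G> \<Longrightarrow> (\<integral>\<^sup>+x\<in>Q. f x \<partial>M) \<le> (\<integral>\<^sup>+x\<in>Q. g x \<partial>M)"
  shows "(\<integral>\<^sup>+x\<in>\<Union>\<G>. f x \<partial>M) \<le> (\<integral>\<^sup>+x\<in>\<Union>\<G>. g x \<partial>M)"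
proof -
  have G: "countable \<G>" "laminar \<G>" "\<G> \<subseteq> sets M"
    using assms(1) subgrid_family[of P] by (auto intro: countable_subset laminar_subset)
  then have "\<Union>\<G> \<in> sets M" by (intro sets.countable_Union) auto
  moreover have "emeasure (density M f) (\<Union>\<G>) \<le> emeasure (density M g) (\<Union>\<G>)"
    using G le by (intro emeasure_Union_laminar_le) (auto simp: emeasure_density subset_iff)
  ultimately show ?thesis by (simp add: emeasure_density)
qed

lemma ennreal_le_half_absorb:
  fixes X Y :: ennreal
  assumes "X \<le> Y + ennreal c * X" "c \<le> 1 / 2" "X < top"
  shows "X \<le> 2 * Y"
proof (cases Y)
  case (real y)
  obtain x where x: "X = ennreal x" "0 \<le> x" using assms(3) by (cases X) auto
  have "ennreal c * X \<le> ennreal (1 / 2) * X"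
    using assms(2) by (intro mult_right_mono ennreal_leI) auto
  then have "X \<le> Y + ennreal (1 / 2) * X"
    using assms(1) by (meson add_left_mono order_trans)
  then have "x \<le> y + 1 / 2 * x"
    using x real by (simp del: ennreal_half flip: ennreal_mult ennreal_plus)
  then have "x \<le> 2 * y" by simp
  then show ?thesis
    using x real by (simp flip: ennreal_numeral ennreal_mult)
qed (simp add: ennreal_mult_top)

text \<open>One half of Lebesgue's differentiation theorem. If the maximal function is at most a and
  f exceeds b > a on a set E, cover E by cubes with little waste. Each cube that meets E has mean at
  most a, so b |E| is at most a |E| up to a small error, and E is null. Rational pairs a, b exhaust
  the exceptional set.\<close>

lemma local_differentiation:
  assumes f[measurable]: "f \<in> borel_measurable M" and P: "P \<in> grid"
  shows "AE x in M. x \<in> P \<longrightarrow> f x \<le> maxfun (subgrid P) M f x"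
proof -
  let ?v = "maxfun (subgrid P) M f"
  have [measurable]: "P \<in> sets M" using P by measurable
  have null: "AE x in M. \<not> (x \<in> P \<and> ?v x \<le> ennreal a \<and> ennreal b < f x)"
    if ab: "ennreal a < ennreal b" for a b
  proof -
    define E where "E = {x\<in>P. ?v x \<le> ennreal a \<and> ennreal b < f x}"
    have [measurable]: "E \<in> sets M"
    proof -
      have "E = P \<inter> {x\<in>space M. ?v x \<le> ennreal a \<and> ennreal b < f x}"
        by (auto simp: E_def space_UNIV)
      also have "\<dots> \<in> sets M"
        by (rule sets.Int[OF \<open>P \<in> sets M\<close>]) measurable
      finally show ?thesis .
    qed
    have finE: "emeasure M E < top"
      using emeasure_mono[of E P M] grid_fin[OF P] by (auto simp: E_def less_top intro: le_less_trans)
    have "ennreal b * emeasure M E \<le> ennreal a * emeasure M E"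
    proof (rule ennreal_le_epsilon)
      fix e :: real assume e: "0 < e"
      \<comment> \<open>Chosen to make the error a \<epsilon> at most e. The maximum is there
        because a may be negative, in which case \<open>ennreal a\<close> is 0.\<close>
      define \<epsilon> where "\<epsilon> = e / (max a 0 + 1)"
      have \<epsilon>: "0 < \<epsilon>" using e by (simp add: \<epsilon>_def field_simps)
      have \<epsilon>': "max a 0 * \<epsilon> \<le> e"
        using e by (simp add: \<epsilon>_def field_simps add_pos_nonneg mult_left_mono)
      obtain \<G> where G: "\<G> \<subseteq> grid" "E \<subseteq> \<Union>\<G>" "emeasure M (\<Union>\<G>) \<le> emeasure M E + ennreal \<epsilon>"
        using D_outer[OF _ finE \<epsilon>] by (auto simp: grid_def)
      \<comment> \<open>By laminarity each \<open>Q \<inter> P\<close> is Q or P, so the cover stays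
        in the subgrid. Members that miss E are dropped because the bound on the mean is read off at
        a point of E.\<close>
      define \<H> where "\<H> = {Q \<inter> P | Q. Q \<in> \<G> \<and> Q \<inter> P \<inter> E \<noteq> {}}"
      have sub: "\<H> \<subseteq> subgrid P"
      proof
        fix R assume "R \<in> \<H>"
        then obtain Q where Q: "R = Q \<inter> P" "Q \<in> grid" "Q \<inter> P \<noteq> {}" using G by (auto simp: \<H>_def)
        then have "Q \<subseteq> P \<or> P \<subseteq> Q" using laminar_grid P by (auto simp: laminar_def)
        then have "R = Q \<or> R = P" using Q by auto
        then show "R \<in> subgrid P" using Q P by (auto simp: subgrid_def)
      qed
      have U: "E \<subseteq> \<Union>\<H>" "\<Union>\<H> \<subseteq> \<Union>\<G>"
      proof -
        show "E \<subseteq> \<Union>\<H>"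
        proof
          fix x assume x: "x \<in> E"
          then obtain Q where Q: "Q \<in> \<G>" "x \<in> Q" using G(2) by auto
          moreover have "x \<in> P" using x by (simp add: E_def)
          ultimately have "Q \<inter> P \<in> \<H>" "x \<in> Q \<inter> P" using x by (auto simp: \<H>_def)
          then show "x \<in> \<Union>\<H>" by blast
        qed
        show "\<Union>\<H> \<subseteq> \<Union>\<G>" by (auto simp: \<H>_def)
      qed
      have Gs: "\<Union>\<G> \<in> sets M"
        using G(1) countable_grid grid_sets by (intro sets.countable_Union) (auto intro: countable_subset)
      have Hs[measurable]: "\<Union>\<H> \<in> sets M"
        using sub subgrid_family[of P] by (intro sets.countable_Union) (auto intro: countable_subset)
      have "(\<integral>\<^sup>+x\<in>\<Union>\<H>. ennreal b * indicator E x \<partial>M) \<le> (\<integral>\<^sup>+x\<in>\<Union>\<H>. ennreal a \<partial>M)"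
      proof (rule emeasure_grid_cover_le[OF sub])
        fix R assume R: "R \<in> \<H>"
        then have R': "R \<in> subgrid P" "R \<in> grid" using sub by (auto simp: subgrid_def)
        then have [measurable]: "R \<in> sets M" by measurable
        obtain z where z: "z \<in> R" "z \<in> E" using R by (auto simp: \<H>_def)
        have "(\<integral>\<^sup>+x\<in>R. ennreal b * indicator E x \<partial>M) \<le> (\<integral>\<^sup>+x\<in>R. f x \<partial>M)"
          by (intro nn_integral_mono) (auto simp: E_def indicator_def)
        also have "\<dots> = mean M R f * emeasure M R"
          using grid_pos[OF R'(2)] grid_fin[OF R'(2)] by (simp add: mean_mult_emeasure)
        also have "mean M R f \<le> ?v z"
          using R' z by (intro mean_le_maxfun)
        also have "?v z \<le> ennreal a"
          using z by (simp add: E_def)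
        also have "ennreal a * emeasure M R = (\<integral>\<^sup>+x\<in>R. ennreal a \<partial>M)"
          by (simp add: nn_integral_cmult_indicator)
        finally show "(\<integral>\<^sup>+x\<in>R. ennreal b * indicator E x \<partial>M) \<le> (\<integral>\<^sup>+x\<in>R. ennreal a \<partial>M)"
          by (simp add: mult_right_mono)
      qed measurable
      moreover have "(\<integral>\<^sup>+x\<in>\<Union>\<H>. ennreal b * indicator E x \<partial>M) = ennreal b * emeasure M E"
      proof -
        have "(\<lambda>x. ennreal b * indicator E x * indicator (\<Union>\<H>) x) = (\<lambda>x. ennreal b * indicator E x)"
          using U(1) by (auto simp: indicator_def fun_eq_iff)
        then show ?thesis by (simp add: nn_integral_cmult_indicator)
      qed
      moreover have "(\<integral>\<^sup>+x\<in>\<Union>\<H>. ennreal a \<partial>M) = ennreal a * emeasure M (\<Union>\<H>)"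
        by (simp add: nn_integral_cmult_indicator)
      ultimately have "ennreal b * emeasure M E \<le> ennreal a * emeasure M (\<Union>\<H>)" by simp
      also have "\<dots> \<le> ennreal a * (emeasure M E + ennreal \<epsilon>)"
        using emeasure_mono[OF U(2) Gs] G(3) by (intro mult_left_mono) auto
      also have "\<dots> = ennreal a * emeasure M E + ennreal a * ennreal \<epsilon>"
        by (simp add: distrib_left)
      also have "ennreal a * ennreal \<epsilon> \<le> ennreal e"
        using \<epsilon>' \<epsilon> ennreal_mult[of "max a 0" \<epsilon>] by (cases "0 \<le> a") (auto simp: max_def ennreal_neg intro: ennreal_leI simp flip: ennreal_mult)
      finally show "ennreal b * emeasure M E \<le> ennreal a * emeasure M E + ennreal e"
        by (simp add: add_left_mono)
    qed
    then have "emeasure M E = 0"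
      using ennreal_mult_strict_right_mono[OF ab, of "emeasure M E"] finE
      by (meson leD not_gr_zero)
    then show ?thesis
      by (subst AE_iff_measurable[where N=E]) (auto simp: E_def space_UNIV)
  qed
  have "AE x in M. \<forall>a b :: rat. ennreal (of_rat a) < ennreal (of_rat b) \<longrightarrow>
      \<not> (x \<in> P \<and> ?v x \<le> ennreal (of_rat a) \<and> ennreal (of_rat b) < f x)"
    unfolding AE_all_countable using null by (auto intro: AE_impI)
  then show ?thesis
  proof eventually_elim
    case (elim x)
    show ?case
    proof (intro impI, rule ccontr)
      assume x: "x \<in> P" "\<not> f x \<le> ?v x"
      then have "?v x < f x" by simp
      then obtain a where a: "?v x < ennreal (real_of_rat a)" "ennreal (real_of_rat a) < f x"
        using ennreal_rat_dense by metis
      then obtain b where "ennreal (real_of_rat a) < ennreal (real_of_rat b)" "ennreal (real_of_rat b) < f x"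
        using ennreal_rat_dense by metis
      with elim a x show False by (meson less_imp_le)
    qed
  qed
qed

section \<open>Stopping cubes and the reverse Hoelder inequality\<close>

lemma kappa_pos: "0 < \<kappa>"
proof (rule ccontr)
  assume "\<not> 0 < \<kappa>"
  then have "emeasure M (D 0 x) = 0" for x
    using D_doubling[of 0 x] by (simp add: ennreal_neg)
  then show False using D_pos by blast
qed

lemma mean_child_le: "mean M (D (k + 1) x) f \<le> ennreal \<kappa> * mean M (D k x) f"
proof -
  let ?c = "emeasure M (D (k + 1) x)" and ?p = "emeasure M (D k x)"
  obtain c where c: "?c = ennreal c" "0 < c"
    using D_pos[of "k + 1" x] D_fin[of "k + 1" x] by (cases ?c) (auto simp: less_le)
  obtain q where q: "?p = ennreal q" "0 < q"
    using D_pos[of k x] D_fin[of k x] by (cases ?p) (auto simp: less_le)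
  have "q \<le> \<kappa> * c"
    using D_doubling[of k x] c q kappa_pos by (simp flip: ennreal_mult)
  then have "inverse c \<le> \<kappa> * inverse q"
    using c q by (simp add: field_simps)
  then have inv: "inverse ?c \<le> ennreal \<kappa> * inverse ?p"
    using c q kappa_pos by (simp add: inverse_ennreal flip: ennreal_mult)
  have "mean M (D (k + 1) x) f \<le> (\<integral>\<^sup>+x\<in>D k x. f x \<partial>M) * inverse ?c"
    unfolding mean_def divide_ennreal_def using D_Suc[of k x]
    by (intro mult_right_mono nn_integral_mono) (auto simp: indicator_def)
  also have "\<dots> \<le> (\<integral>\<^sup>+x\<in>D k x. f x \<partial>M) * (ennreal \<kappa> * inverse ?p)"
    by (intro mult_left_mono inv) auto
  finally show ?thesis by (simp add: mean_def divide_ennreal_def mult_ac)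
qed

text \<open>A reverse weak type bound of Calderon-Zygmund type. On the way down from P to x, the
  first cube with mean above c has a parent with mean at most c, so its own mean is at most \<kappa>
  c. All cubes with mean in this range are collected rather than the maximal ones: they cover the
  level set, and the laminar comparison handles their overlaps.\<close>

lemma stopping_cubes:
  assumes P: "P \<in> grid" and c: "mean M P f \<le> c" and f[measurable]: "f \<in> borel_measurable M"
  shows "(\<integral>\<^sup>+x\<in>{x. c < maxfun (subgrid P) M f x}. f x \<partial>M)
    \<le> ennreal \<kappa> * c * (\<integral>\<^sup>+x\<in>{x. c < maxfun (subgrid P) M f x}. 1 \<partial>M)"
proof -
  define \<G> where "\<G> = {Q\<in>subgrid P. c < mean M Q f \<and> mean M Q f \<le> ennreal \<kappa> * c}"
  have sub: "\<G> \<subseteq> subgrid P" by (auto simp: \<G>_def)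
  obtain k0 y where Py: "P = D k0 y" using P by (elim gridE)
  have stop: "\<exists>m\<le>n. c < mean M (D (k0 + int m) x) f \<and> mean M (D (k0 + int m) x) f \<le> ennreal \<kappa> * c"
    if "x \<in> P" "c < mean M (D (k0 + int n) x) f" for x n
    using that(2)
  proof (induction n)
    case 0
    have "D k0 x = P" using that(1) D_eq Py by auto
    with 0 c show ?case by auto
  next
    case (Suc n)
    show ?case
    proof (cases "c < mean M (D (k0 + int n) x) f")
      case True
      then show ?thesis using Suc.IH le_SucI by blast
    next
      case False
      have "mean M (D (k0 + int (Suc n)) x) f \<le> ennreal \<kappa> * mean M (D (k0 + int n) x) f"
        using mean_child_le[of "k0 + int n" x f] by (simp add: add_ac)
      also have "\<dots> \<le> ennreal \<kappa> * c"
        using False by (intro mult_left_mono) auto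
      finally show ?thesis using Suc.prems by blast
    qed
  qed
  have U: "{x. c < maxfun (subgrid P) M f x} = \<Union>\<G>"
  proof (intro set_eqI iffI)
    fix x assume "x \<in> {x. c < maxfun (subgrid P) M f x}"
    then obtain Q where Q: "Q \<in> subgrid P" "x \<in> Q" "c < mean M Q f"
      by (auto simp: maxfun_less_iff)
    then have x: "x \<in> P" and PD: "P = D k0 x" using D_eq Py by (auto simp: subgrid_def)
    obtain l where l: "Q = D l x"
      using Q by (auto simp: subgrid_def grid_def dest: D_eq)
    have "k0 \<le> l"
    proof (rule ccontr)
      assume "\<not> k0 \<le> l"
      \<comment> \<open>Cubes of different scales may coincide, so a coarser scale than that of P is
        not excluded at once; but then Q is P, whose mean is at most c.\<close>
      then have "Q = P" using D_mono[of l k0 x] Q(1) by (auto simp: PD l subgrid_def)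
      with Q c show False by auto
    qed
    then obtain n where "l = k0 + int n" using zle_iff_zadd by blast
    with stop[OF x, of n] Q l obtain m where m:
      "c < mean M (D (k0 + int m) x) f" "mean M (D (k0 + int m) x) f \<le> ennreal \<kappa> * c" by auto
    moreover have "D (k0 + int m) x \<in> subgrid P"
      using D_mono[of k0 "k0 + int m" x] by (auto simp: subgrid_def D_in_grid PD)
    ultimately show "x \<in> \<Union>\<G>" using D_self by (auto simp: \<G>_def)
  qed (auto simp: \<G>_def maxfun_less_iff)
  have "\<Union>\<G> \<in> sets M"
    using sub subgrid_family[of P] by (intro sets.countable_Union) (auto intro: countable_subset)
  have "(\<integral>\<^sup>+x\<in>\<Union>\<G>. f x \<partial>M) \<le> (\<integral>\<^sup>+x\<in>\<Union>\<G>. ennreal \<kappa> * c \<partial>M)"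
  proof (rule emeasure_grid_cover_le[OF sub f])
    fix Q assume Q: "Q \<in> \<G>"
    then have Q': "Q \<in> grid" by (auto simp: \<G>_def subgrid_def)
    have "(\<integral>\<^sup>+x\<in>Q. f x \<partial>M) = mean M Q f * emeasure M Q"
      using grid_pos[OF Q'] grid_fin[OF Q'] by (simp add: mean_mult_emeasure)
    also have "\<dots> \<le> ennreal \<kappa> * c * emeasure M Q"
      using Q by (intro mult_right_mono) (auto simp: \<G>_def)
    also have "\<dots> = (\<integral>\<^sup>+x\<in>Q. ennreal \<kappa> * c \<partial>M)"
      using grid_sets'[OF Q'] by (simp add: nn_integral_cmult_indicator)
    finally show "(\<integral>\<^sup>+x\<in>Q. f x \<partial>M) \<le> (\<integral>\<^sup>+x\<in>Q. ennreal \<kappa> * c \<partial>M)" .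
  qed simp
  then show ?thesis
    using \<open>\<Union>\<G> \<in> sets M\<close> by (simp add: U nn_integral_cmult_indicator)
qed

text \<open>With v the local maximal function, the integral of f v^\<delta> is estimated by levels:
  trivially below the mean of f over P, by stopping cubes above it. The A_1 condition bounds the
  resulting integral of v^(1+\<delta>) by K times the original one, which is then absorbed.
  Boundedness of f provides the finiteness that absorption requires, and f \<le> v almost everywhere
  on P concludes.\<close>

lemma reverse_Hoelder_bounded:
  assumes f[measurable]: "f \<in> borel_measurable M" and A1: "AE x in M. dmax f x \<le> ennreal K * f x"
    and K: "0 \<le> K" and \<delta>: "0 < \<delta>" "\<kappa> * \<delta> * K \<le> 1 / 2" and P: "P \<in> grid"
    and bd: "\<And>x. f x \<le> ennreal b"
  shows "mean M P (\<lambda>x. f x epowr (1 + \<delta>)) \<le> 2 * mean M P f epowr (1 + \<delta>)"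
proof -
  define v where "v = maxfun (subgrid P) M f"
  define a where "a = mean M P f"
  define F where "F = (\<integral>\<^sup>+x\<in>P. f x \<partial>M)"
  define X where "X = (\<integral>\<^sup>+x. f x * v x epowr \<delta> \<partial>M)"
  have [measurable]: "P \<in> sets M" using P by measurable
  have [measurable]: "v \<in> borel_measurable M" unfolding v_def by measurable
  have v0: "v x = 0" if "x \<notin> P" for x
  proof -
    have "v x \<le> 0" unfolding v_def by (rule maxfun_least) (use that in \<open>auto simp: subgrid_def\<close>)
    then show ?thesis by simp
  qed
  have vb: "v x \<le> ennreal b" for x
    unfolding v_def
    by (rule order.trans[OF maxfun_mono[OF bd] maxfun_const_le[OF subgrid_family(3)]])
  have level: "(\<integral>\<^sup>+x\<in>{x. ennreal (exp (- s)) < v x}. f x \<partial>M)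
     \<le> F * indicator {s. ennreal (exp (- s)) < a} s
       + ennreal \<kappa> * ennreal (exp (- s)) * (\<integral>\<^sup>+x\<in>{x. ennreal (exp (- s)) < v x}. 1 \<partial>M)" for s
  proof (cases "ennreal (exp (- s)) < a")
    case True
    have "(\<integral>\<^sup>+x\<in>{x. ennreal (exp (- s)) < v x}. f x \<partial>M) \<le> F"
      unfolding F_def by (intro nn_integral_mono) (use v0 in \<open>auto simp: indicator_def\<close>)
    then show ?thesis using True by (simp add: add_increasing2)
  next
    case False
    then show ?thesis
      using stopping_cubes[OF P, of f "ennreal (exp (- s))"] by (simp add: v_def a_def)
  qed
  have expd: "ennreal (exp (- s * \<delta>)) * (ennreal \<kappa> * ennreal (exp (- s)) * y)
      = ennreal \<kappa> * (ennreal (exp (- s * (1 + \<delta>))) * y)" for s y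
  proof -
    have "ennreal (exp (- s * \<delta>)) * ennreal (exp (- s)) = ennreal (exp (- s * (1 + \<delta>)))"
      by (simp add: mult_exp_exp algebra_simps flip: ennreal_mult)
    then show ?thesis by (metis mult.assoc mult.left_commute)
  qed
  have meas1: "(\<lambda>s. \<integral>\<^sup>+x\<in>{x. ennreal (exp (- s)) < v x}. 1 \<partial>M) \<in> borel_measurable lborel"
    unfolding indicator_def by measurable
  have "ennreal (1 / \<delta>) * X = (\<integral>\<^sup>+x. f x * (ennreal (1 / \<delta>) * v x epowr \<delta>) \<partial>M)"
    unfolding X_def by (subst nn_integral_cmult[symmetric]) (auto simp: mult_ac)
  also have "\<dots> = (\<integral>\<^sup>+s. ennreal (exp (- s * \<delta>)) * (\<integral>\<^sup>+x\<in>{x. ennreal (exp (- s)) < v x}. f x \<partial>M) \<partial>lborel)"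
    using \<delta>(1) by (intro nn_integral_epowr_layer_cake) measurable
  also have "\<dots> \<le> (\<integral>\<^sup>+s. ennreal (exp (- s * \<delta>)) * (F * indicator {s. ennreal (exp (- s)) < a} s
       + ennreal \<kappa> * ennreal (exp (- s)) * (\<integral>\<^sup>+x\<in>{x. ennreal (exp (- s)) < v x}. 1 \<partial>M)) \<partial>lborel)"
    by (intro nn_integral_mono mult_left_mono level) auto
  also have "\<dots> = (\<integral>\<^sup>+s. F * (ennreal (exp (- s * \<delta>)) * indicator {s. ennreal (exp (- s)) < a} s)
       + ennreal \<kappa> * (ennreal (exp (- s * (1 + \<delta>))) * (\<integral>\<^sup>+x\<in>{x. ennreal (exp (- s)) < v x}. 1 \<partial>M)) \<partial>lborel)"
    unfolding distrib_left expd by (simp add: mult_ac)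
  also have "\<dots> = F * (\<integral>\<^sup>+s. ennreal (exp (- s * \<delta>)) * indicator {s. ennreal (exp (- s)) < a} s \<partial>lborel)
       + ennreal \<kappa> * (\<integral>\<^sup>+s. ennreal (exp (- s * (1 + \<delta>))) * (\<integral>\<^sup>+x\<in>{x. ennreal (exp (- s)) < v x}. 1 \<partial>M) \<partial>lborel)"
    using meas1 by (subst nn_integral_add) (auto simp: nn_integral_cmult)
  also have "\<dots> = F * (ennreal (1 / \<delta>) * a epowr \<delta>)
       + ennreal \<kappa> * (\<integral>\<^sup>+x. 1 * (ennreal (1 / (1 + \<delta>)) * v x epowr (1 + \<delta>)) \<partial>M)"
    unfolding nn_integral_exp_indicator[OF \<delta>(1)]
    using \<delta>(1) by (subst nn_integral_epowr_layer_cake) auto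
  also have "\<dots> = ennreal (1 / \<delta>) * (F * a epowr \<delta>)
       + ennreal \<kappa> * ennreal (1 / (1 + \<delta>)) * (\<integral>\<^sup>+x. v x epowr (1 + \<delta>) \<partial>M)"
    by (simp only: mult_1_left) (simp add: nn_integral_cmult, simp add: mult_ac)
  also have "(\<integral>\<^sup>+x. v x epowr (1 + \<delta>) \<partial>M) \<le> ennreal K * X"
  proof -
    have "(\<integral>\<^sup>+x. v x epowr (1 + \<delta>) \<partial>M) \<le> (\<integral>\<^sup>+x. ennreal K * (f x * v x epowr \<delta>) \<partial>M)"
    proof (intro nn_integral_mono_AE, use A1 in eventually_elim)
      case (elim x)
      \<comment> \<open>Only one factor of v^(1+\<delta>) is exchanged for K f, so that
        \<open>X\<close> itself comes back.\<close>
      have "v x \<le> ennreal K * f x"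
        using maxfun_mono_family[OF subgrid_family(4)] elim unfolding v_def by (rule order_trans)
      then show ?case by (simp add: epowr_add mult_right_mono mult.assoc[symmetric])
    qed
    then show ?thesis by (simp add: X_def nn_integral_cmult)
  qed
  finally have "ennreal (1 / \<delta>) * X \<le> ennreal (1 / \<delta>) * (F * a epowr \<delta>) +
      ennreal \<kappa> * ennreal (1 / (1 + \<delta>)) * (ennreal K * X)"
    by (simp add: add_left_mono mult_left_mono)
  then have "ennreal \<delta> * (ennreal (1 / \<delta>) * X) \<le> ennreal \<delta> * (ennreal (1 / \<delta>) * (F * a epowr \<delta>) +
      ennreal \<kappa> * ennreal (1 / (1 + \<delta>)) * (ennreal K * X))"
    by (rule mult_left_mono) simp
  moreover have "ennreal \<delta> * (ennreal (1 / \<delta>) * y) = y" for y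
    using \<delta>(1) by (simp add: mult.assoc[symmetric] flip: ennreal_mult)
  moreover have "ennreal \<delta> * (ennreal \<kappa> * ennreal (1 / (1 + \<delta>)) * (ennreal K * X))
      = ennreal (\<kappa> * \<delta> * K / (1 + \<delta>)) * X"
  proof -
    have "ennreal \<delta> * ennreal \<kappa> * ennreal (1 / (1 + \<delta>)) * ennreal K = ennreal (\<kappa> * \<delta> * K / (1 + \<delta>))"
      using \<delta>(1) kappa_pos K by (simp add: mult.commute flip: ennreal_mult)
    then show ?thesis by (metis mult.assoc)
  qed
  ultimately have "X \<le> F * a epowr \<delta> + ennreal (\<kappa> * \<delta> * K / (1 + \<delta>)) * X"
    by (simp add: distrib_left)
  moreover have "\<kappa> * \<delta> * K / (1 + \<delta>) \<le> 1 / 2"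
  proof -
    have "\<kappa> * \<delta> * K / (1 + \<delta>) \<le> \<kappa> * \<delta> * K / 1"
      using \<delta>(1) kappa_pos K by (intro divide_left_mono) auto
    also have "\<dots> \<le> 1 / 2" using \<delta>(2) by simp
    finally show ?thesis .
  qed
  moreover have "X < top"
  proof -
    have "X \<le> (\<integral>\<^sup>+x. ennreal b * ennreal b epowr \<delta> * indicator P x \<partial>M)"
      unfolding X_def
    proof (intro nn_integral_mono)
      fix x
      show "f x * v x epowr \<delta> \<le> ennreal b * ennreal b epowr \<delta> * indicator P x"
        using v0[of x] bd[of x] vb[of x] \<delta>(1) by (cases "x \<in> P") (auto intro!: mult_mono epowr_mono)
    qed
    also have "\<dots> < top"
      using grid_fin[OF P] by (simp add: nn_integral_cmult_indicator ennreal_mult_less_top less_top)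
    finally show ?thesis .
  qed
  ultimately have X: "X \<le> 2 * (F * a epowr \<delta>)"
    by (rule ennreal_le_half_absorb)
  have "(\<integral>\<^sup>+x\<in>P. f x epowr (1 + \<delta>) \<partial>M) \<le> X"
    unfolding X_def
  proof (intro nn_integral_mono_AE, use local_differentiation[OF f P] in eventually_elim)
    case (elim x)
    then show ?case
      using \<delta>(1) by (cases "x \<in> P") (auto simp: v_def epowr_add intro!: mult_left_mono epowr_mono)
  qed
  also note X
  finally have "mean M P (\<lambda>x. f x epowr (1 + \<delta>)) \<le> 2 * (F * a epowr \<delta>) / emeasure M P"
    unfolding mean_def by (rule divide_right_mono_ennreal)
  also have "\<dots> = 2 * (a * a epowr \<delta>)"
    by (simp add: a_def F_def mean_def divide_ennreal_def mult_ac)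
  also have "a * a epowr \<delta> = a epowr (1 + \<delta>)"
    by (simp add: epowr_add)
  finally show ?thesis by (simp add: a_def)
qed

text \<open>Truncating f at height n keeps the A_1 constant because \<open>1 \<le> K\<close>: the
  maximal function of min f n is at most both K f and n, hence at most K min f n. The bounds are
  uniform in n and pass to the supremum.\<close>

theorem reverse_Hoelder_A1:
  assumes f[measurable]: "f \<in> borel_measurable M" and A1: "AE x in M. dmax f x \<le> ennreal K * f x"
    and K: "1 \<le> K" and \<delta>: "0 < \<delta>" "\<kappa> * \<delta> * K \<le> 1 / 2" and P: "P \<in> grid"
  shows "mean M P (\<lambda>x. f x epowr (1 + \<delta>)) \<le> 2 * mean M P f epowr (1 + \<delta>)"
proof -
  have [measurable]: "P \<in> sets M" using P by measurable
  define g where "g n x = min (f x) (of_nat n)" for n :: nat and x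
  have [measurable]: "g n \<in> borel_measurable M" for n unfolding g_def by measurable
  have bound: "mean M P (\<lambda>x. g n x epowr (1 + \<delta>)) \<le> 2 * mean M P f epowr (1 + \<delta>)" for n
  proof -
    have "mean M P (\<lambda>x. g n x epowr (1 + \<delta>)) \<le> 2 * mean M P (g n) epowr (1 + \<delta>)"
    proof (rule reverse_Hoelder_bounded[where K=K and b="real n"])
      show "AE x in M. dmax (g n) x \<le> ennreal K * g n x"
        using A1
      proof eventually_elim
        case (elim x)
        have "dmax (g n) x \<le> dmax f x" "dmax (g n) x \<le> dmax (\<lambda>x. of_nat n) x"
          by (intro maxfun_mono; simp add: g_def)+
        then have "dmax (g n) x \<le> ennreal K * f x" "dmax (g n) x \<le> of_nat n"
          using elim maxfun_const_le[OF grid_sets, of "of_nat n" x] by (auto intro: order_trans)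
        moreover have "of_nat n \<le> ennreal K * of_nat n"
          using mult_right_mono[of 1 "ennreal K" "of_nat n"] K by simp
        ultimately show ?case unfolding g_def min_def by auto
      qed
    qed (use K \<delta> P in \<open>auto simp: g_def ennreal_of_nat_eq_real_of_nat\<close>)
    also have "\<dots> \<le> 2 * mean M P f epowr (1 + \<delta>)"
      using \<delta>(1) by (intro mult_left_mono epowr_mono mean_mono) (auto simp: g_def)
    finally show ?thesis .
  qed
  have f_SUP: "f x epowr (1 + \<delta>) * indicator P x = (SUP n. g n x epowr (1 + \<delta>) * indicator P x)" for x
  proof -
    have "f x = (SUP n. g n x)"
      unfolding g_def inf_min[symmetric] inf_SUP[symmetric] by (simp add: ennreal_SUP_of_nat_eq_top)
    then have "f x epowr (1 + \<delta>) = (SUP n. g n x epowr (1 + \<delta>))"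
      using \<delta>(1) by (simp flip: epowr_SUP)
    then show ?thesis by (simp add: SUP_mult_right_ennreal)
  qed
  have "(\<integral>\<^sup>+x\<in>P. f x epowr (1 + \<delta>) \<partial>M) = (SUP n. \<integral>\<^sup>+x\<in>P. g n x epowr (1 + \<delta>) \<partial>M)"
    unfolding f_SUP
  proof (rule nn_integral_monotone_convergence_SUP)
    show "incseq (\<lambda>n x. g n x epowr (1 + \<delta>) * indicator P x)"
      using \<delta>(1) by (intro monoI le_funI mult_right_mono epowr_mono)
        (auto simp: g_def intro: min.coboundedI2)
  qed measurable
  then have "mean M P (\<lambda>x. f x epowr (1 + \<delta>)) = (SUP n. mean M P (\<lambda>x. g n x epowr (1 + \<delta>)))"
    by (simp add: mean_def SUP_divide_ennreal)
  also have "\<dots> \<le> 2 * mean M P f epowr (1 + \<delta>)"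
    by (intro SUP_least bound)
  finally show ?thesis .
qed

text \<open>The \<open>+ 1\<close> makes the norm bound at least 1, so that 2 B is at least 1 as the
  truncation argument asks of an A_1 constant, and division by B is safe.\<close>

definition lerner_norm :: "real \<Rightarrow> real \<Rightarrow> real" where
  "lerner_norm p A = (lerner_const p A + 1) powr (1 / p)"

lemma lerner_norm_ge_1: "1 < p \<Longrightarrow> 1 \<le> lerner_norm p A"
  using lerner_const_nonneg[of p A] unfolding lerner_norm_def by (intro ge_one_powr_ge_zero) auto

lemma dmax_bounded_density:
  assumes "1 < p" "0 \<le> A" "Ap p A u" and [measurable]: "f \<in> borel_measurable M"
  shows "(\<integral>\<^sup>+x. dmax f x epowr p \<partial>density M (\<lambda>x. ennreal (u x)))
    \<le> ennreal (lerner_norm p A powr p) * (\<integral>\<^sup>+x. f x epowr p \<partial>density M (\<lambda>x. ennreal (u x)))"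
proof -
  have [measurable]: "u \<in> borel_measurable M" using assms by (auto simp: Ap_def)
  have "(\<integral>\<^sup>+x. dmax f x epowr p * ennreal (u x) \<partial>M)
    \<le> ennreal (lerner_const p A) * (\<integral>\<^sup>+x. f x epowr p * ennreal (u x) \<partial>M)"
    by (rule dmax_bounded_Ap) (use assms in auto)
  also have "\<dots> \<le> ennreal (lerner_norm p A powr p) * (\<integral>\<^sup>+x. f x epowr p * ennreal (u x) \<partial>M)"
    using assms(1) lerner_const_nonneg[of p A]
    by (intro mult_right_mono ennreal_leI) (auto simp: lerner_norm_def powr_powr)
  finally show ?thesis by (simp add: nn_integral_density mult.commute)
qed

definition power_max :: "real \<Rightarrow> ('a \<Rightarrow> ennreal) \<Rightarrow> 'a \<Rightarrow> ennreal" where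
  "power_max s f x = dmax (\<lambda>x. f x epowr s) x epowr (1 / s)"

lemma power_max_measurable [measurable]: "power_max s f \<in> borel_measurable M"
  unfolding power_max_def by measurable

text \<open>The increment \<delta> = 1 / (4 \<kappa> B) solves \<kappa> \<delta> (2 B) = 1/2, where
  2 B is the A_1 constant of a Rubio de Francia majorant. The weight enters only through A, so one
  power serves a whole class of weights.\<close>

definition self_improvement :: "real \<Rightarrow> real \<Rightarrow> real" where
  "self_improvement p A = 1 + 1 / (4 * \<kappa> * lerner_norm p A)"

text \<open>For the Rubio de Francia majorant g of f, pointwise M_s f \<le> M_s g \<le> 2 M g \<le>
  4 B g, by the reverse Hoelder inequality and the A_1 property. The norm of g contributes the
  remaining factor 2.\<close>

theorem power_max_bounded_Ap:
  assumes p: "1 < p" and A: "0 \<le> A" and Ap: "Ap p A u" and f[measurable]: "f \<in> borel_measurable M"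
  defines "s \<equiv> self_improvement p A"
  shows "(\<integral>\<^sup>+x. power_max s f x epowr p * ennreal (u x) \<partial>M)
    \<le> ennreal ((8 * lerner_norm p A) powr p) * (\<integral>\<^sup>+x. f x epowr p * ennreal (u x) \<partial>M)"
proof -
  define B where "B = lerner_norm p A"
  define \<delta> where "\<delta> = 1 / (4 * \<kappa> * B)"
  have B: "1 \<le> B" using lerner_norm_ge_1[OF p] by (simp add: B_def)
  have s: "s = 1 + \<delta>" by (simp add: s_def self_improvement_def \<delta>_def B_def)
  have \<delta>: "0 < \<delta>" "\<kappa> * \<delta> * (2 * B) \<le> 1 / 2" using B kappa_pos by (auto simp: \<delta>_def)
  have [measurable]: "u \<in> borel_measurable M" using Ap by (auto simp: Ap_def)
  define N where "N = density M (\<lambda>x. ennreal (u x))"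
  have [measurable_cong]: "sets N = sets M" by (simp add: N_def)
  have bdd: "(\<integral>\<^sup>+x. dmax f x epowr p \<partial>N) \<le> ennreal (B powr p) * (\<integral>\<^sup>+x. f x epowr p \<partial>N)"
    if "f \<in> borel_measurable M" for f
    unfolding N_def B_def by (rule dmax_bounded_density[OF p A Ap that])
  obtain g where g[measurable]: "g \<in> borel_measurable M" and g_ge: "\<And>x. f x \<le> g x"
    and g_A1: "\<And>x. dmax g x \<le> ennreal (2 * B) * g x"
    and g_int: "(\<integral>\<^sup>+x. g x epowr p \<partial>N) \<le> ennreal (2 powr p) * (\<integral>\<^sup>+x. f x epowr p \<partial>N)"
    using rubio_de_francia[OF p _ _ bdd f] B by (auto simp: N_def)
  have ptw: "power_max s f x \<le> ennreal (4 * B) * g x" for x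
  proof -
    have s1: "1 < s" using \<delta> by (simp add: s)
    have "dmax (\<lambda>x. f x epowr s) x \<le> (2 * dmax g x) epowr s"
    proof (rule maxfun_least)
      fix Q assume Q: "Q \<in> grid" "x \<in> Q"
      have "mean M Q (\<lambda>x. f x epowr s) \<le> mean M Q (\<lambda>x. g x epowr s)"
        using s1 by (intro mean_mono epowr_mono g_ge) auto
      also have "\<dots> \<le> 2 * mean M Q g epowr s"
        unfolding s by (rule reverse_Hoelder_A1[where K = "2 * B"]) (use g_A1 B \<delta> Q in auto)
      also have "\<dots> \<le> 2 * dmax g x epowr s"
        using s1 Q by (intro mult_left_mono epowr_mono mean_le_maxfun) auto
      also have "\<dots> \<le> 2 epowr s * dmax g x epowr s"
      \<comment> \<open>Since s > 1, the constant 2 may be enlarged to 2^s and moved inside the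
        power.\<close>
      proof (rule mult_right_mono)
        have "2 powr 1 \<le> (2::real) powr s" using s1 by (intro powr_mono) auto
        then show "2 \<le> 2 epowr s" using epowr_ennreal[of 2 s] by simp
      qed simp
      finally show "mean M Q (\<lambda>x. f x epowr s) \<le> (2 * dmax g x) epowr s"
        using s1 by (simp add: epowr_mult)
    qed
    then have "power_max s f x \<le> 2 * dmax g x"
      using s1 by (simp add: power_max_def epowr_le_iff)
    also have "\<dots> \<le> 2 * (ennreal (2 * B) * g x)"
      by (intro mult_left_mono g_A1) auto
    also have "\<dots> = ennreal (4 * B) * g x"
      using B by (simp add: mult.assoc[symmetric] flip: ennreal_numeral ennreal_mult)
    finally show ?thesis .
  qed
  have "(\<integral>\<^sup>+x. power_max s f x epowr p \<partial>N) \<le> (\<integral>\<^sup>+x. ennreal ((4 * B) powr p) * g x epowr p \<partial>N)"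
  proof (rule nn_integral_mono)
    fix x
    have "power_max s f x epowr p \<le> (ennreal (4 * B) * g x) epowr p"
      using p ptw by (intro epowr_mono) auto
    then show "power_max s f x epowr p \<le> ennreal ((4 * B) powr p) * g x epowr p"
      using p B by (simp add: epowr_mult epowr_ennreal)
  qed
  also have "\<dots> = ennreal ((4 * B) powr p) * (\<integral>\<^sup>+x. g x epowr p \<partial>N)"
    by (simp add: nn_integral_cmult)
  also have "\<dots> \<le> ennreal ((4 * B) powr p) * (ennreal (2 powr p) * (\<integral>\<^sup>+x. f x epowr p \<partial>N))"
    by (intro mult_left_mono g_int) auto
  also have "\<dots> = ennreal ((8 * B) powr p) * (\<integral>\<^sup>+x. f x epowr p \<partial>N)"
    using B by (simp add: mult.assoc[symmetric] flip: ennreal_mult powr_mult)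
  finally show ?thesis
    by (simp add: N_def nn_integral_density mult.commute B_def)
qed

end

section \<open>Extrapolation\<close>

lemma max_epowr_le: "0 < p \<Longrightarrow> max a b epowr p \<le> a epowr p + b epowr p"
  by (auto simp: max_def add_increasing add_increasing2)

text \<open>The maximum with such a function is positive everywhere, as extrapolation wants, at an
  arbitrarily small cost in norm. Its multiples also serve as truncation levels.\<close>

lemma (in sigma_finite_measure) ex_small_positive_function:
  assumes "0 < p" "0 < \<eta>"
  obtains \<phi> where "\<phi> \<in> borel_measurable M" "\<And>x. x \<in> space M \<Longrightarrow> 0 < \<phi> x"
    "(\<integral>\<^sup>+x. \<phi> x epowr p \<partial>M) \<le> ennreal \<eta>"
proof -
  obtain h where h[measurable]: "h \<in> borel_measurable M" and fin: "integral\<^sup>N M h \<noteq> \<infinity>"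
    and pos: "\<And>x. x \<in> space M \<Longrightarrow> 0 < h x"
    using Ex_finite_integrable_function by blast
  obtain i where i: "integral\<^sup>N M h = ennreal i" "0 \<le> i"
    using fin by (cases "integral\<^sup>N M h") auto
  define c where "c = \<eta> / (i + 1)"
  have c: "0 < c" "c * i \<le> \<eta>"
    using assms i by (auto simp: c_def field_simps add_pos_nonneg mult_left_mono)
  show ?thesis
  proof (rule that[of "\<lambda>x. (ennreal c * h x) epowr (1 / p)"])
    show "0 < (ennreal c * h x) epowr (1 / p)" if "x \<in> space M" for x
      using pos[OF that] c by (simp add: zero_less_iff_neq_zero)
    show "(\<integral>\<^sup>+x. ((ennreal c * h x) epowr (1 / p)) epowr p \<partial>M) \<le> ennreal \<eta>"
      using assms c i by (simp add: epowr_epowr nn_integral_cmult ennreal_leI flip: ennreal_mult)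
  qed measurable
qed

context dyadic
begin

lemma AE_grid_witness:
  assumes "AE x in M. P x" "Q \<in> grid"
  obtains x where "x \<in> Q" "P x"
proof -
  have "\<exists>x\<in>Q. P x"
  proof (rule ccontr)
    assume "\<not> (\<exists>x\<in>Q. P x)"
    with assms(1) have "AE x in M. x \<notin> Q" by (auto elim: eventually_mono)
    then have "emeasure M Q = 0"
      using assms(2) by (simp add: AE_iff_measurable[OF grid_sets'] space_UNIV)
    with grid_pos[OF assms(2)] show False by simp
  qed
  with that show thesis by blast
qed

text \<open>The A_1 condition read on a single cube. The mean is finite because the inequality holds
  at some point of Q, where h has a real value.\<close>

lemma A1_mean_bounds:
  assumes h: "h \<in> borel_measurable M" "\<And>x. 0 < h x"
    and A1: "AE x in M. dmax (\<lambda>x. ennreal (h x)) x \<le> ennreal c * ennreal (h x)" "0 < c" and Q: "Q \<in> grid"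
  obtains a where "mean M Q (\<lambda>x. ennreal (h x)) = ennreal a" "0 < a" "AE x in M. x \<in> Q \<longrightarrow> a / c \<le> h x"
proof -
  let ?m = "mean M Q (\<lambda>x. ennreal (h x))"
  have le: "AE x in M. x \<in> Q \<longrightarrow> ?m \<le> ennreal (c * h x)"
    using A1(1)
  proof eventually_elim
    case (elim x)
    have "ennreal c * ennreal (h x) = ennreal (c * h x)"
      using A1(2) by (simp add: ennreal_mult')
    then show ?case
      using elim mean_le_maxfun[OF Q, of x M "\<lambda>x. ennreal (h x)"] by (auto intro: order_trans)
  qed
  then obtain z where "z \<in> Q" "?m \<le> ennreal (c * h z)"
    using AE_grid_witness[OF le Q] by blast
  moreover have "0 < ?m"
    using h Q by (intro mean_pos) auto
  ultimately obtain a where a: "?m = ennreal a" "0 < a"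
    by (cases ?m) (auto simp: top_unique)
  have "AE x in M. x \<in> Q \<longrightarrow> a / c \<le> h x"
    using le
  proof eventually_elim
    case (elim x)
    then show ?case
      using a A1(2) h(2)[of x] by (auto simp: field_simps)
  qed
  with a that show thesis by blast
qed

text \<open>The easy half of the Jones factorization theorem. On a cube the lower bounds for h and k
  control their negative powers, which occur in the weight and in its dual respectively. The means
  of h and k then cancel from the product.\<close>

lemma A1_factors_Ap:
  assumes q: "1 < q"
    and h[measurable]: "h \<in> borel_measurable M" and h_pos: "\<And>x. 0 < h x"
    and k[measurable]: "k \<in> borel_measurable M" and k_pos: "\<And>x. 0 < k x"
    and hA1: "AE x in M. dmax (\<lambda>x. ennreal (h x)) x \<le> ennreal c * ennreal (h x)" "0 < c"
    and kA1: "AE x in M. dmax (\<lambda>x. ennreal (k x)) x \<le> ennreal d * ennreal (k x)" "0 < d"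
  shows "Ap q (c powr (q - 1) * d) (\<lambda>x. h x powr (1 - q) * k x)"
  unfolding Ap_def
proof (intro conjI allI ballI)
  show "(\<lambda>x. h x powr (1 - q) * k x) \<in> borel_measurable M" by measurable
  show "0 < h x powr (1 - q) * k x" for x using h_pos[of x] k_pos[of x] by simp
  fix Q assume Q: "Q \<in> grid"
  then have [measurable]: "Q \<in> sets M" by measurable
  define u where "u x = h x powr (1 - q) * k x" for x
  obtain a where a: "mean M Q (\<lambda>x. ennreal (h x)) = ennreal a" "0 < a" "AE x in M. x \<in> Q \<longrightarrow> a / c \<le> h x"
    using A1_mean_bounds[OF h h_pos hA1 Q] .
  obtain b where b: "mean M Q (\<lambda>x. ennreal (k x)) = ennreal b" "0 < b" "AE x in M. x \<in> Q \<longrightarrow> b / d \<le> k x"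
    using A1_mean_bounds[OF k k_pos kA1 Q] .
  have "mean M Q (\<lambda>x. ennreal (u x)) \<le> mean M Q (\<lambda>x. ennreal ((a / c) powr (1 - q)) * ennreal (k x))"
  proof (rule mean_mono_AE, use a(3) in eventually_elim)
    case (elim x)
    have "h x powr (1 - q) \<le> (a / c) powr (1 - q)" if "a / c \<le> h x"
      using that a(2) hA1(2) q by (intro powr_mono2') auto
    with elim show ?case
      using k_pos[of x] by (auto simp: u_def ennreal_mult'[symmetric] intro!: ennreal_leI mult_right_mono)
  qed
  also have "\<dots> = ennreal ((a / c) powr (1 - q) * b)"
    by (subst mean_cmult) (auto simp: b ennreal_mult')
  finally have u_le: "mean M Q (\<lambda>x. ennreal (u x)) \<le> ennreal ((a / c) powr (1 - q) * b)" .
  have dual: "dualw q u x = h x * k x powr (- 1 / (q - 1))" for x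
  proof -
    have "(1 - q) * (- 1 / (q - 1)) = 1" using q by (simp add: field_simps)
    then show ?thesis
      using h_pos[of x] k_pos[of x] by (simp only: dualw_def u_def powr_mult powr_powr) simp
  qed
  have "mean M Q (\<lambda>x. ennreal (dualw q u x)) \<le> mean M Q (\<lambda>x. ennreal ((b / d) powr (- 1 / (q - 1))) * ennreal (h x))"
  proof (rule mean_mono_AE, use b(3) in eventually_elim)
    case (elim x)
    have "k x powr (- 1 / (q - 1)) \<le> (b / d) powr (- 1 / (q - 1))" if "b / d \<le> k x"
      using that b(2) kA1(2) q by (intro powr_mono2') auto
    with elim show ?case
      using h_pos[of x] by (auto simp: dual ennreal_mult'[symmetric] mult.commute intro!: ennreal_leI mult_right_mono)
  qed
  also have "\<dots> = ennreal ((b / d) powr (- 1 / (q - 1)) * a)"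
    by (subst mean_cmult) (auto simp: a ennreal_mult')
  finally have "mean M Q (\<lambda>x. ennreal (dualw q u x)) epowr (q - 1) \<le> ennreal ((b / d) powr (- 1 / (q - 1)) * a) epowr (q - 1)"
    using q by (intro epowr_mono) auto
  also have "\<dots> = ennreal (((b / d) powr (- 1 / (q - 1)) * a) powr (q - 1))"
    using a by (intro epowr_ennreal) simp
  also have "((b / d) powr (- 1 / (q - 1)) * a) powr (q - 1) = d / b * a powr (q - 1)"
  proof -
    have "(- 1 / (q - 1)) * (q - 1) = - 1" using q by simp
    then show ?thesis
      using a b kA1(2) by (simp only: powr_mult powr_powr) (simp add: powr_minus_divide)
  qed
  finally have dual_le: "mean M Q (\<lambda>x. ennreal (dualw q u x)) epowr (q - 1) \<le> ennreal (d / b * a powr (q - 1))" .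
  have "mean M Q (\<lambda>x. ennreal (u x)) * mean M Q (\<lambda>x. ennreal (dualw q u x)) epowr (q - 1)
    \<le> ennreal ((a / c) powr (1 - q) * b) * ennreal (d / b * a powr (q - 1))"
    by (intro mult_mono u_le dual_le) auto
  also have "\<dots> = ennreal (((a / c) powr (1 - q) * b) * (d / b * a powr (q - 1)))"
    by (rule ennreal_mult'[symmetric]) (use b in simp)
  also have "((a / c) powr (1 - q) * b) * (d / b * a powr (q - 1)) = c powr (q - 1) * d"
  proof -
    have "(a / c) powr (1 - q) * a powr (q - 1) = c powr (q - 1)"
      using a hA1(2) by (simp add: powr_divide powr_diff field_simps)
    then show ?thesis using b by (simp add: field_simps)
  qed
  finally show "mean M Q (\<lambda>x. ennreal (h x powr (1 - q) * k x)) *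
      mean M Q (\<lambda>x. ennreal (dualw q (\<lambda>x. h x powr (1 - q) * k x) x)) epowr (q - 1)
      \<le> ennreal (c powr (q - 1) * d)"
    by (simp add: u_def[abs_def])
qed

text \<open>A Rubio de Francia majorant with real values, as a weight must have. Its weighted norm
  is finite, so it is infinite only on a null set; redefining it there is why the bounds hold almost
  everywhere.\<close>

lemma A1_majorant:
  assumes p: "1 < p" and A: "0 \<le> A" and Ap: "Ap p A w"
    and f[measurable]: "f \<in> borel_measurable M" and f_pos: "\<And>x. 0 < f x"
    and fin: "(\<integral>\<^sup>+x. f x epowr p * ennreal (w x) \<partial>M) < top"
  obtains h where "h \<in> borel_measurable M" "\<And>x. 0 < h x" "AE x in M. f x \<le> ennreal (h x)"
    "AE x in M. dmax (\<lambda>x. ennreal (h x)) x \<le> ennreal (2 * lerner_norm p A) * ennreal (h x)"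
    "(\<integral>\<^sup>+x. ennreal (h x) epowr p * ennreal (w x) \<partial>M)
      \<le> ennreal (2 powr p) * (\<integral>\<^sup>+x. f x epowr p * ennreal (w x) \<partial>M)"
proof -
  define N where "N = density M (\<lambda>x. ennreal (w x))"
  have [measurable_cong]: "sets N = sets M" by (simp add: N_def)
  have w[measurable]: "w \<in> borel_measurable M" "\<And>x. 0 < w x" using Ap by (auto simp: Ap_def)
  have N_int: "(\<integral>\<^sup>+x. g x \<partial>N) = (\<integral>\<^sup>+x. g x * ennreal (w x) \<partial>M)" if "g \<in> borel_measurable M" for g
    using that by (simp add: N_def nn_integral_density mult.commute)
  have bdd: "(\<integral>\<^sup>+x. dmax f x epowr p \<partial>N) \<le> ennreal (lerner_norm p A powr p) * (\<integral>\<^sup>+x. f x epowr p \<partial>N)"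
    if "f \<in> borel_measurable M" for f
    unfolding N_def by (rule dmax_bounded_density[OF p A Ap that])
  have "0 < lerner_norm p A" using lerner_norm_ge_1[OF p, of A] by simp
  then obtain g where g[measurable]: "g \<in> borel_measurable M" and g_ge: "\<And>x. f x \<le> g x"
    and g_A1: "\<And>x. dmax g x \<le> ennreal (2 * lerner_norm p A) * g x"
    and g_int: "(\<integral>\<^sup>+x. g x epowr p \<partial>N) \<le> ennreal (2 powr p) * (\<integral>\<^sup>+x. f x epowr p \<partial>N)"
    using rubio_de_francia[OF p _ _ bdd f] by (auto simp: N_def)
  have "(\<integral>\<^sup>+x. g x epowr p * ennreal (w x) \<partial>M) < top"
    using g_int fin by (simp add: N_int) (meson ennreal_less_top ennreal_mult_less_top le_less_trans)
  then have "AE x in M. g x epowr p * ennreal (w x) \<noteq> top"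
    by (intro nn_integral_noteq_infinite[unfolded infinity_ennreal_def]) auto
  then have g_fin: "AE x in M. g x < top"
  proof eventually_elim
    case (elim x)
    then show ?case using w(2)[of x] by (cases "g x = top") (auto simp: ennreal_top_mult less_top)
  qed
  define h where "h x = (if g x < top then enn2real (g x) else 1)" for x
  have gh: "AE x in M. g x = ennreal (h x)"
    using g_fin by eventually_elim (simp add: h_def)
  have "dmax (\<lambda>x. ennreal (h x)) x \<le> dmax g x" for x
  proof (rule maxfun_least)
    fix Q assume Q: "Q \<in> grid" "x \<in> Q"
    have "mean M Q (\<lambda>x. ennreal (h x)) \<le> mean M Q g"
      by (rule mean_mono_AE) (use gh in eventually_elim, simp)
    also have "\<dots> \<le> dmax g x" using Q by (rule mean_le_maxfun)
    finally show "mean M Q (\<lambda>x. ennreal (h x)) \<le> dmax g x" .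
  qed
  show thesis
  proof
    show "h \<in> borel_measurable M" unfolding h_def by measurable
    show "0 < h x" for x
      using less_le_trans[OF f_pos g_ge, of x] by (auto simp: h_def enn2real_positive_iff)
    show "AE x in M. f x \<le> ennreal (h x)"
      using gh g_ge by (auto elim!: eventually_mono) metis
    show "AE x in M. dmax (\<lambda>x. ennreal (h x)) x \<le> ennreal (2 * lerner_norm p A) * ennreal (h x)"
      using gh
    proof eventually_elim
      case (elim x)
      have "dmax (\<lambda>x. ennreal (h x)) x \<le> dmax g x" by fact
      also have "\<dots> \<le> ennreal (2 * lerner_norm p A) * g x" by (rule g_A1)
      finally show ?case by (simp only: elim)
    qed
    have "(\<integral>\<^sup>+x. ennreal (h x) epowr p * ennreal (w x) \<partial>M) = (\<integral>\<^sup>+x. g x epowr p * ennreal (w x) \<partial>M)"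
      by (rule nn_integral_cong_AE) (use gh in eventually_elim, simp)
    then show "(\<integral>\<^sup>+x. ennreal (h x) epowr p * ennreal (w x) \<partial>M)
      \<le> ennreal (2 powr p) * (\<integral>\<^sup>+x. f x epowr p * ennreal (w x) \<partial>M)"
      using g_int by (simp add: N_int)
  qed
qed

text \<open>The constant of \<open>A1_factors_Ap\<close> for two majorants, one in L^p(w) and one in
  the dual space with conjugate exponent and dual weight. It is known before any particular weight u
  is built.\<close>

definition extrapolation_const :: "real \<Rightarrow> real \<Rightarrow> real \<Rightarrow> real" where
  "extrapolation_const p q A =
     (2 * lerner_norm p A) powr (q - 1) * (2 * lerner_norm (p / (p - 1)) (A powr (1 / (p - 1))))"

text \<open>Let h and l be A_1 majorants of g in L^p(w) and of k in the dual space; each costs a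
  factor 2. The weight u = h^(1-q) l satisfies l = u^(1/q) (h l)^(1/q') and h^q u = h l. Hoelder
  with q, q' and the hypothesis on u therefore reduce everything to the integral of h l, which
  Hoelder with p, p' bounds. The cases p < q and p > q are treated alike.\<close>

lemma extrapolation_pairing:
  assumes p: "1 < p" and q: "1 < q" and A: "0 \<le> A" and Ap: "Ap p A w"
    and F[measurable]: "F \<in> borel_measurable M" and G[measurable]: "G \<in> borel_measurable M"
    and C: "0 < C"
    and hyp: "\<And>u. Ap q (extrapolation_const p q A) u \<Longrightarrow>
      (\<integral>\<^sup>+x. F x epowr q * ennreal (u x) \<partial>M) \<le> ennreal C * (\<integral>\<^sup>+x. G x epowr q * ennreal (u x) \<partial>M)"
    and g[measurable]: "g \<in> borel_measurable M" "\<And>x. 0 < g x" "\<And>x. G x \<le> g x"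
    and g_fin: "(\<integral>\<^sup>+x. g x epowr p * ennreal (w x) \<partial>M) < top"
    and k[measurable]: "k \<in> borel_measurable M" "\<And>x. 0 < k x"
    and k_fin: "(\<integral>\<^sup>+x. k x epowr (p / (p - 1)) * ennreal (dualw p w x) \<partial>M) < top"
  shows "(\<integral>\<^sup>+x. F x * k x \<partial>M) \<le> ennreal (4 * C powr (1 / q)) *
    ((\<integral>\<^sup>+x. g x epowr p * ennreal (w x) \<partial>M) epowr (1 / p) *
     (\<integral>\<^sup>+x. k x epowr (p / (p - 1)) * ennreal (dualw p w x) \<partial>M) epowr (1 - 1 / p))"
proof -
  define p' q' where "p' = p / (p - 1)" and "q' = q / (q - 1)"
  have p': "1 < p'" "1 / p + 1 / p' = 1" "1 / p' = 1 - 1 / p" using p by (auto simp: p'_def field_simps)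
  have q': "1 < q'" "1 / q + 1 / q' = 1" using q by (auto simp: q'_def field_simps)
  have w[measurable]: "w \<in> borel_measurable M" "\<And>x. 0 < w x" using Ap by (auto simp: Ap_def)
  obtain h where h[measurable]: "h \<in> borel_measurable M" "\<And>x. 0 < h x"
    and gh: "AE x in M. g x \<le> ennreal (h x)"
    and hA1: "AE x in M. dmax (\<lambda>x. ennreal (h x)) x \<le> ennreal (2 * lerner_norm p A) * ennreal (h x)"
    and h_int: "(\<integral>\<^sup>+x. ennreal (h x) epowr p * ennreal (w x) \<partial>M)
      \<le> ennreal (2 powr p) * (\<integral>\<^sup>+x. g x epowr p * ennreal (w x) \<partial>M)"
    using A1_majorant[OF p A Ap g(1,2) g_fin] by blast
  define A' where "A' = A powr (1 / (p - 1))"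
  have Ap': "Ap p' A' (dualw p w)" using Ap_dualw[OF Ap p A] by (simp add: p'_def A'_def)
  have A': "0 \<le> A'" by (simp add: A'_def)
  obtain l where l[measurable]: "l \<in> borel_measurable M" "\<And>x. 0 < l x"
    and kl: "AE x in M. k x \<le> ennreal (l x)"
    and lA1: "AE x in M. dmax (\<lambda>x. ennreal (l x)) x \<le> ennreal (2 * lerner_norm p' A') * ennreal (l x)"
    and l_int: "(\<integral>\<^sup>+x. ennreal (l x) epowr p' * ennreal (dualw p w x) \<partial>M)
      \<le> ennreal (2 powr p') * (\<integral>\<^sup>+x. k x epowr p' * ennreal (dualw p w x) \<partial>M)"
    using A1_majorant[OF p'(1) A' Ap' k(1,2)] k_fin by (auto simp: p'_def)
  define u where "u x = h x powr (1 - q) * l x" for x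
  have Apu: "Ap q (extrapolation_const p q A) u"
    unfolding extrapolation_const_def u_def p'_def[symmetric] A'_def[symmetric]
    using lerner_norm_ge_1[OF p, of A] lerner_norm_ge_1[OF p'(1), of A']
    by (intro A1_factors_Ap q h l hA1 lA1) auto
  define I where "I = (\<integral>\<^sup>+x. ennreal (h x) * ennreal (l x) \<partial>M)"
  have u_pos: "0 < u x" for x using h(2)[of x] l(2)[of x] by (simp add: u_def)
  have "(\<integral>\<^sup>+x. F x * k x \<partial>M) \<le> (\<integral>\<^sup>+x. (F x * ennreal (u x powr (1 / q))) * ennreal ((h x * l x) powr (1 / q')) \<partial>M)"
  proof (intro nn_integral_mono_AE, use kl in eventually_elim)
    case (elim x)
    have "u x powr (1 / q) * (h x * l x) powr (1 / q') = l x"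
    proof -
      have "u x powr (1 / q) * (h x * l x) powr (1 / q')
        = h x powr ((1 - q) * (1 / q) + 1 / q') * l x powr (1 / q + 1 / q')"
        using h(2)[of x] l(2)[of x] by (simp only: u_def powr_mult powr_powr powr_add mult_ac)
      also have "(1 - q) * (1 / q) + 1 / q' = 0" using q by (simp add: q'_def field_simps)
      finally show ?thesis using h(2)[of x] l(2)[of x] q'(2) by simp
    qed
    then have "F x * ennreal (l x) = (F x * ennreal (u x powr (1 / q))) * ennreal ((h x * l x) powr (1 / q'))"
      by (simp add: mult.assoc flip: ennreal_mult)
    then show ?case using elim mult_left_mono[OF elim, of "F x"] by simp
  qed
  also have "\<dots> \<le> (\<integral>\<^sup>+x. (F x * ennreal (u x powr (1 / q))) epowr q \<partial>M) epowr (1 / q) *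
      (\<integral>\<^sup>+x. ennreal ((h x * l x) powr (1 / q')) epowr q' \<partial>M) epowr (1 / q')"
    by (rule nn_integral_Hoelder[OF q q'(2)]) (unfold u_def, measurable)
  also have "(\<lambda>x. (F x * ennreal (u x powr (1 / q))) epowr q) = (\<lambda>x. F x epowr q * ennreal (u x))"
    using q u_pos by (simp add: epowr_mult epowr_ennreal powr_powr less_imp_le)
  also have "(\<lambda>x. ennreal ((h x * l x) powr (1 / q')) epowr q') = (\<lambda>x. ennreal (h x) * ennreal (l x))"
    using q' h(2) l(2) by (simp add: epowr_ennreal powr_powr ennreal_mult less_imp_le abs_mult)
  also have "(\<integral>\<^sup>+x. F x epowr q * ennreal (u x) \<partial>M) \<le> ennreal C * I"
  proof -
    have "(\<integral>\<^sup>+x. F x epowr q * ennreal (u x) \<partial>M) \<le> ennreal C * (\<integral>\<^sup>+x. G x epowr q * ennreal (u x) \<partial>M)"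
      by (rule hyp[OF Apu])
    also have "(\<integral>\<^sup>+x. G x epowr q * ennreal (u x) \<partial>M) \<le> I"
      unfolding I_def
    proof (intro nn_integral_mono_AE, use gh in eventually_elim)
      case (elim x)
      have "G x epowr q * ennreal (u x) \<le> ennreal (h x) epowr q * ennreal (u x)"
        using elim g(3)[of x] q by (intro mult_right_mono epowr_mono) auto
      also have "\<dots> = ennreal (h x) * ennreal (l x)"
        using h(2)[of x] l(2)[of x] by (simp add: epowr_ennreal u_def powr_diff flip: ennreal_mult)
      finally show ?case .
    qed
    finally show ?thesis by (simp add: mult_left_mono)
  qed
  also have "(\<integral>\<^sup>+x. ennreal (h x) * ennreal (l x) \<partial>M) = I" by (simp add: I_def)
  finally have "(\<integral>\<^sup>+x. F x * k x \<partial>M) \<le> (ennreal C * I) epowr (1 / q) * I epowr (1 / q')"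
    using q by (simp add: I_def mult_right_mono epowr_mono)
  also have "\<dots> = ennreal (C powr (1 / q)) * (I epowr (1 / q) * I epowr (1 / q'))"
    using q C by (simp add: epowr_mult epowr_ennreal mult.assoc)
  \<comment> \<open>The exponents add up to 1, and the identity also holds for \<open>I\<close> =
    \<infinity>.\<close>
  also have "I epowr (1 / q) * I epowr (1 / q') = I"
    by (simp add: q'(2) flip: epowr_add)
  also have "I \<le> 4 * ((\<integral>\<^sup>+x. g x epowr p * ennreal (w x) \<partial>M) epowr (1 / p) *
     (\<integral>\<^sup>+x. k x epowr p' * ennreal (dualw p w x) \<partial>M) epowr (1 / p'))"
  proof -
    have "I = (\<integral>\<^sup>+x. (ennreal (h x) * ennreal (w x powr (1 / p))) * (ennreal (l x) * ennreal (w x powr (- 1 / p))) \<partial>M)"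
      unfolding I_def
    proof (rule nn_integral_cong)
      fix x
      have "w x powr (1 / p) * w x powr (- 1 / p) = 1"
        using w(2)[of x] by (simp flip: powr_add)
      then have "ennreal (w x powr (1 / p)) * ennreal (w x powr (- 1 / p)) = 1"
        by (simp flip: ennreal_mult)
      then show "ennreal (h x) * ennreal (l x) = (ennreal (h x) * ennreal (w x powr (1 / p))) * (ennreal (l x) * ennreal (w x powr (- 1 / p)))"
        by (metis mult.assoc mult.commute mult.right_neutral)
    qed
    also have "\<dots> \<le> (\<integral>\<^sup>+x. (ennreal (h x) * ennreal (w x powr (1 / p))) epowr p \<partial>M) epowr (1 / p) *
       (\<integral>\<^sup>+x. (ennreal (l x) * ennreal (w x powr (- 1 / p))) epowr p' \<partial>M) epowr (1 / p')"
      by (rule nn_integral_Hoelder[OF p p'(2)]) measurable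
    also have "(\<lambda>x. (ennreal (h x) * ennreal (w x powr (1 / p))) epowr p) = (\<lambda>x. ennreal (h x) epowr p * ennreal (w x))"
      using p w(2) by (simp add: epowr_mult epowr_ennreal powr_powr less_imp_le)
    also have "(\<lambda>x. (ennreal (l x) * ennreal (w x powr (- 1 / p))) epowr p') = (\<lambda>x. ennreal (l x) epowr p' * ennreal (dualw p w x))"
    proof
      fix x
      have "(- 1 / p) * p' = - 1 / (p - 1)" using p by (simp add: p'_def)
      then have "(w x powr (- 1 / p)) powr p' = dualw p w x" by (simp only: dualw_def powr_powr)
      then show "(ennreal (l x) * ennreal (w x powr (- 1 / p))) epowr p' = ennreal (l x) epowr p' * ennreal (dualw p w x)"
        using p' by (simp add: epowr_mult epowr_ennreal)
    qed
    also have "(\<integral>\<^sup>+x. ennreal (h x) epowr p * ennreal (w x) \<partial>M) epowr (1 / p) *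
       (\<integral>\<^sup>+x. ennreal (l x) epowr p' * ennreal (dualw p w x) \<partial>M) epowr (1 / p')
      \<le> (ennreal (2 powr p) * (\<integral>\<^sup>+x. g x epowr p * ennreal (w x) \<partial>M)) epowr (1 / p) *
       (ennreal (2 powr p') * (\<integral>\<^sup>+x. k x epowr p' * ennreal (dualw p w x) \<partial>M)) epowr (1 / p')"
      using p p' by (intro mult_mono epowr_mono h_int l_int) auto
    also have "\<dots> = (2 * (\<integral>\<^sup>+x. g x epowr p * ennreal (w x) \<partial>M) epowr (1 / p)) *
       (2 * (\<integral>\<^sup>+x. k x epowr p' * ennreal (dualw p w x) \<partial>M) epowr (1 / p'))"
      using p p'(1) by (simp add: epowr_mult epowr_ennreal powr_powr)
    also have "\<dots> = (2 * 2) * ((\<integral>\<^sup>+x. g x epowr p * ennreal (w x) \<partial>M) epowr (1 / p) *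
       (\<integral>\<^sup>+x. k x epowr p' * ennreal (dualw p w x) \<partial>M) epowr (1 / p'))"
      by (simp only: mult_ac)
    finally show ?thesis by simp
  qed
  finally have "(\<integral>\<^sup>+x. F x * k x \<partial>M) \<le> ennreal (C powr (1 / q)) * (4 * ((\<integral>\<^sup>+x. g x epowr p * ennreal (w x) \<partial>M) epowr (1 / p) *
     (\<integral>\<^sup>+x. k x epowr p' * ennreal (dualw p w x) \<partial>M) epowr (1 / p')))"
    by (simp add: mult_left_mono)
  also have "ennreal (C powr (1 / q)) * (4 * y) = ennreal (4 * C powr (1 / q)) * y" for y
    by (simp add: ennreal_mult' mult_ac)
  finally show ?thesis by (simp only: p'(3) flip: p'_def)
qed

text \<open>Division by X^(1-1/p), legitimate for finite X. The factor 2^(1-1/p) is rounded up to 2,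
  whence \<open>2 * c\<close>.\<close>

lemma cancel_epowr:
  assumes p: "1 < p" and c: "0 < c" and X: "X < top" and Z: "0 < Z" "Z < top"
    and le: "X \<le> ennreal c * (Z epowr (1 / p) * (2 * X) epowr (1 - 1 / p))"
  shows "X \<le> ennreal ((2 * c) powr p) * Z"
proof -
  obtain x where x: "X = ennreal x" "0 \<le> x" using X by (cases X) auto
  obtain z where z: "Z = ennreal z" "0 < z" using Z by (cases Z) auto
  have "x \<le> (2 * c) powr p * z"
  proof (cases "x = 0")
    case False
    then have x0: "0 < x" using x by simp
    have "2 * X = ennreal (2 * x)" using x by (simp add: ennreal_mult')
    then have "(2 * X) epowr (1 - 1 / p) = ennreal ((2 * x) powr (1 - 1 / p))"
      using x by (simp only:, intro epowr_ennreal) simp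
    moreover have "Z epowr (1 / p) = ennreal (z powr (1 / p))" using z by (simp add: epowr_ennreal)
    ultimately have "ennreal x \<le> ennreal (c * (z powr (1 / p) * (2 * x) powr (1 - 1 / p)))"
      using le x c by (simp only: ennreal_mult' less_imp_le powr_ge_zero)
    then have "x \<le> c * (z powr (1 / p) * (2 * x) powr (1 - 1 / p))"
      using c x0 z by simp
    also have "\<dots> \<le> c * (z powr (1 / p) * (2 * x powr (1 - 1 / p)))"
    proof -
      have "2 powr (1 - 1 / p) \<le> (2::real) powr 1" using p by (intro powr_mono) auto
      then show ?thesis using c x0 by (auto simp: powr_mult intro!: mult_left_mono mult_right_mono)
    qed
    also have "\<dots> = 2 * c * z powr (1 / p) * x powr (1 - 1 / p)" by simp
    also have "x powr (1 - 1 / p) = x / x powr (1 / p)" using x0 by (simp add: powr_diff)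
    finally have "x powr (1 / p) \<le> 2 * c * z powr (1 / p)" using x0 by (simp add: field_simps)
    then have "(x powr (1 / p)) powr p \<le> (2 * c * z powr (1 / p)) powr p"
      using p by (intro powr_mono2) auto
    then show ?thesis using p c x0 z by (simp add: powr_powr powr_mult)
  qed (use z in simp)
  then show ?thesis using x z by (simp add: ennreal_mult'[symmetric] ennreal_leI)
qed

text \<open>Duality with an explicit test function. For a truncation f of F with finite norm, k =
  f^(p-1) w pairs with F to at least the integral of f^p w, and its dual norm is a power of that
  integral. Up to perturbations for positivity, the pairing bound is then an inequality that
  \<open>cancel_epowr\<close> solves.\<close>

theorem extrapolation:
  assumes p: "1 < p" and q: "1 < q" and A: "0 \<le> A" and Ap: "Ap p A w"
    and F[measurable]: "F \<in> borel_measurable M" and G[measurable]: "G \<in> borel_measurable M"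
    and C: "0 < C"
    and hyp: "\<And>u. Ap q (extrapolation_const p q A) u \<Longrightarrow>
      (\<integral>\<^sup>+x. F x epowr q * ennreal (u x) \<partial>M) \<le> ennreal C * (\<integral>\<^sup>+x. G x epowr q * ennreal (u x) \<partial>M)"
  shows "(\<integral>\<^sup>+x. F x epowr p * ennreal (w x) \<partial>M)
    \<le> ennreal ((8 * C powr (1 / q)) powr p) * (\<integral>\<^sup>+x. G x epowr p * ennreal (w x) \<partial>M)"
proof -
  define p' where "p' = p / (p - 1)"
  have p': "(p - 1) * p' = p" using p by (simp add: p'_def)
  have w[measurable]: "w \<in> borel_measurable M" "\<And>x. 0 < w x" using Ap by (auto simp: Ap_def)
  define N where "N = density M (\<lambda>x. ennreal (w x))"
  have N[measurable_cong]: "sets N = sets M" "space N = UNIV" by (simp_all add: N_def space_UNIV)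
  interpret N: sigma_finite_measure N
    unfolding N_def by (subst sigma_finite_iff_density_finite) auto
  have N_int: "(\<integral>\<^sup>+x. g x \<partial>N) = (\<integral>\<^sup>+x. g x * ennreal (w x) \<partial>M)" if "g \<in> borel_measurable M" for g
    using that by (simp add: N_def nn_integral_density mult.commute)
  define Y where "Y = (\<integral>\<^sup>+x. G x epowr p \<partial>N)"
  define c where "c = 4 * C powr (1 / q)"
  have c: "0 < c" using C by (simp add: c_def)
  have trunc: "(\<integral>\<^sup>+x. f x epowr p \<partial>N) \<le> ennreal ((2 * c) powr p) * Y"
    if f[measurable]: "f \<in> borel_measurable M" and f_le: "\<And>x. f x \<le> F x"
      and f_fin: "(\<integral>\<^sup>+x. f x epowr p \<partial>N) < top" for f
  proof -
    define X where "X = (\<integral>\<^sup>+x. f x epowr p \<partial>N)"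
    obtain x where x: "X = ennreal x" "0 \<le> x" using f_fin by (cases X) (auto simp: X_def)
    show ?thesis
    proof (cases "x = 0 \<or> Y = top")
      case True
      then show ?thesis using x c by (auto simp: X_def ennreal_mult_top)
    next
      case False
      then have x0: "0 < x" and Y: "Y < top" using x by (auto simp: less_top)
      \<comment> \<open>Keeps \<open>k\<close> positive. Its norm is limited so that the dual
        integral of \<open>k\<close> is at most \<open>2 * X\<close>, the form expected by
        \<open>cancel_epowr\<close>.\<close>
      obtain \<psi> where \<psi>[measurable]: "\<psi> \<in> borel_measurable N" "\<And>x. 0 < \<psi> x"
        and \<psi>_int: "(\<integral>\<^sup>+x. \<psi> x epowr p \<partial>N) \<le> ennreal x"
        using N.ex_small_positive_function[of p x] p x0 N by auto
      define k where "k x = max (f x) (\<psi> x) epowr (p - 1) * ennreal (w x)" for x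
      have [measurable]: "k \<in> borel_measurable M" unfolding k_def by measurable
      have k_pos: "0 < k x" for x
      proof -
        have "0 < max (f x) (\<psi> x)" using \<psi>(2)[of x] by (simp add: less_max_iff_disj)
        then show ?thesis using w(2)[of x] by (simp add: k_def zero_less_iff_neq_zero)
      qed
      have k_int: "(\<integral>\<^sup>+x. k x epowr p' * ennreal (dualw p w x) \<partial>M) \<le> 2 * X"
      proof -
        have "k x epowr p' * ennreal (dualw p w x) = max (f x) (\<psi> x) epowr p * ennreal (w x)" for x
        proof -
          have "p' + - 1 / (p - 1) = 1" using p by (simp add: p'_def diff_divide_distrib[symmetric])
          then have "w x powr p' * dualw p w x = w x"
            using w(2)[of x] by (simp only: dualw_def powr_add[symmetric]) simp
          then have "ennreal (w x powr p') * ennreal (dualw p w x) = ennreal (w x)"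
            by (subst ennreal_mult'[symmetric]) auto
          moreover have "0 < p'" using p by (simp add: p'_def)
          ultimately show ?thesis
            using w(2)[of x] by (simp add: k_def epowr_mult epowr_epowr p' epowr_ennreal mult.assoc)
        qed
        then have "(\<integral>\<^sup>+x. k x epowr p' * ennreal (dualw p w x) \<partial>M) = (\<integral>\<^sup>+x. max (f x) (\<psi> x) epowr p \<partial>N)"
          by (simp add: N_int)
        also have "\<dots> \<le> (\<integral>\<^sup>+x. f x epowr p + \<psi> x epowr p \<partial>N)"
          using p by (intro nn_integral_mono max_epowr_le) auto
        also have "\<dots> = X + (\<integral>\<^sup>+x. \<psi> x epowr p \<partial>N)"
          unfolding X_def by (rule nn_integral_add) measurable
        also have "\<dots> \<le> X + X" using \<psi>_int x by (intro add_left_mono) simp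
        finally show ?thesis by (simp add: mult_2)
      qed
      have X_le: "X \<le> (\<integral>\<^sup>+x. F x * k x \<partial>M)"
      proof -
        have "X = (\<integral>\<^sup>+x. f x epowr p * ennreal (w x) \<partial>M)"
          unfolding X_def by (rule N_int) measurable
        also have "\<dots> \<le> (\<integral>\<^sup>+x. F x * k x \<partial>M)"
        proof (rule nn_integral_mono)
        fix x
        have "f x epowr p = f x * f x epowr (p - 1)"
          using epowr_add[of "f x" 1 "p - 1"] by simp
        also have "\<dots> \<le> F x * max (f x) (\<psi> x) epowr (p - 1)"
          using p by (intro mult_mono f_le epowr_mono) auto
        finally show "f x epowr p * ennreal (w x) \<le> F x * k x"
          by (simp add: k_def mult.assoc[symmetric] mult_right_mono)
        qed
        finally show ?thesis .
      qed
      show ?thesis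
        unfolding X_def[symmetric]
      proof (rule ennreal_le_epsilon)
        fix e :: real assume e: "0 < e"
        \<comment> \<open>Perturbing \<open>G\<close> costs \<eta> in the integral, which the final
          constant turns into exactly e.\<close>
        define \<eta> where "\<eta> = e / (2 * c) powr p"
        have \<eta>: "0 < \<eta>" "(2 * c) powr p * \<eta> = e" using e c by (auto simp: \<eta>_def)
        obtain \<phi> where \<phi>[measurable]: "\<phi> \<in> borel_measurable N" "\<And>x. 0 < \<phi> x"
          and \<phi>_int: "(\<integral>\<^sup>+x. \<phi> x epowr p \<partial>N) \<le> ennreal \<eta>"
          using N.ex_small_positive_function[of p \<eta>] p \<eta>(1) N by auto
        define g where "g x = max (G x) (\<phi> x)" for x
        have [measurable]: "g \<in> borel_measurable M" unfolding g_def by measurable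
        have g_int: "(\<integral>\<^sup>+x. g x epowr p * ennreal (w x) \<partial>M) \<le> Y + ennreal \<eta>"
        proof -
          have "(\<integral>\<^sup>+x. g x epowr p * ennreal (w x) \<partial>M) = (\<integral>\<^sup>+x. g x epowr p \<partial>N)"
            by (simp add: N_int)
          also have "\<dots> \<le> (\<integral>\<^sup>+x. G x epowr p + \<phi> x epowr p \<partial>N)"
            unfolding g_def using p by (intro nn_integral_mono max_epowr_le) auto
          also have "\<dots> = Y + (\<integral>\<^sup>+x. \<phi> x epowr p \<partial>N)"
            unfolding Y_def by (rule nn_integral_add) measurable
          also have "\<dots> \<le> Y + ennreal \<eta>" by (intro add_left_mono \<phi>_int)
          finally show ?thesis .
        qed
        have "(\<integral>\<^sup>+x. F x * k x \<partial>M) \<le> ennreal c *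
          ((\<integral>\<^sup>+x. g x epowr p * ennreal (w x) \<partial>M) epowr (1 / p) *
           (\<integral>\<^sup>+x. k x epowr (p / (p - 1)) * ennreal (dualw p w x) \<partial>M) epowr (1 - 1 / p))"
          unfolding c_def
        proof (rule extrapolation_pairing[OF p q A Ap F G C hyp])
          show "0 < g x" "G x \<le> g x" for x using \<phi>(2)[of x] by (auto simp: g_def less_max_iff_disj)
          show "(\<integral>\<^sup>+x. g x epowr p * ennreal (w x) \<partial>M) < top"
            using g_int Y by (auto intro: le_less_trans)
          show "(\<integral>\<^sup>+x. k x epowr (p / (p - 1)) * ennreal (dualw p w x) \<partial>M) < top"
            using k_int x by (auto simp: p'_def ennreal_mult_less_top intro: le_less_trans)
        qed (use k_pos in auto)
        also have "\<dots> \<le> ennreal c * ((Y + ennreal \<eta>) epowr (1 / p) * (2 * X) epowr (1 - 1 / p))"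
          using p g_int k_int by (intro mult_left_mono mult_mono epowr_mono) (auto simp: p'_def)
        finally have "X \<le> ennreal c * ((Y + ennreal \<eta>) epowr (1 / p) * (2 * X) epowr (1 - 1 / p))"
          using X_le by simp
        then have "X \<le> ennreal ((2 * c) powr p) * (Y + ennreal \<eta>)"
          using p c x Y \<eta> by (intro cancel_epowr) (auto simp: add_nonneg_pos)
        also have "\<dots> = ennreal ((2 * c) powr p) * Y + ennreal e"
          using \<eta> by (simp add: distrib_left flip: ennreal_mult')
        finally show "X \<le> ennreal ((2 * c) powr p) * Y + ennreal e" .
      qed
    qed
  qed
  obtain \<phi> where \<phi>[measurable]: "\<phi> \<in> borel_measurable N" "\<And>x. 0 < \<phi> x"
    and \<phi>_int: "(\<integral>\<^sup>+x. \<phi> x epowr p \<partial>N) \<le> ennreal 1"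
    using N.ex_small_positive_function[of p 1] p N by auto
  \<comment> \<open>These truncations have finite norm because \<phi> has, and increase to
    \<open>F\<close> because \<phi> is positive.\<close>
  define f where "f n x = min (F x) (of_nat n * \<phi> x)" for n :: nat and x
  have [measurable]: "f n \<in> borel_measurable M" for n unfolding f_def by measurable
  have "(\<integral>\<^sup>+x. f n x epowr p \<partial>N) \<le> ennreal ((2 * c) powr p) * Y" for n
  proof (rule trunc)
    have "(\<integral>\<^sup>+x. f n x epowr p \<partial>N) \<le> (\<integral>\<^sup>+x. of_nat n epowr p * \<phi> x epowr p \<partial>N)"
      using p by (intro nn_integral_mono) (auto simp: f_def simp flip: epowr_mult intro!: epowr_mono)
    also have "\<dots> = of_nat n epowr p * (\<integral>\<^sup>+x. \<phi> x epowr p \<partial>N)"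
      by (rule nn_integral_cmult) measurable
    also have "\<dots> < top"
      using \<phi>_int by (auto simp: ennreal_mult_less_top of_nat_less_top intro: le_less_trans)
    finally show "(\<integral>\<^sup>+x. f n x epowr p \<partial>N) < top" .
  qed (auto simp: f_def)
  then have "(SUP n. \<integral>\<^sup>+x. f n x epowr p \<partial>N) \<le> ennreal ((2 * c) powr p) * Y"
    by (rule SUP_least)
  moreover have "(\<integral>\<^sup>+x. F x epowr p \<partial>N) = (SUP n. \<integral>\<^sup>+x. f n x epowr p \<partial>N)"
  proof -
    have "F x epowr p = (SUP n. f n x epowr p)" for x
    proof -
      have "(SUP n. of_nat n * \<phi> x) = top"
        using \<phi>(2)[of x] by (simp add: ennreal_SUP_of_nat_eq_top ennreal_top_mult flip: SUP_mult_right_ennreal)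
      then have "F x = (SUP n. f n x)"
        unfolding f_def inf_min[symmetric] inf_SUP[symmetric] by (simp only: inf_top_right)
      then show ?thesis using p by (simp flip: epowr_SUP)
    qed
    then show ?thesis
    proof (simp only:, intro nn_integral_monotone_convergence_SUP)
      show "incseq (\<lambda>n x. f n x epowr p)"
        using p by (intro monoI le_funI epowr_mono) (auto simp: f_def intro!: min.coboundedI2 mult_right_mono)
    qed measurable
  qed
  ultimately show ?thesis
    by (simp add: N_int Y_def c_def)
qed

text \<open>For p = q the sum over j and the integral commute, so the scalar bound suffices once a
  single s works for every u that extrapolation may produce; hence the argument of
  \<open>self_improvement\<close>. The 64 is 8 from extrapolation times 8 from the scalar
  bound.\<close>

theorem power_max_vector_valued:
  assumes p: "1 < p" and q: "1 < q" and A: "0 \<le> A" and Ap: "Ap p A w"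
    and f[measurable]: "\<And>j::nat. f j \<in> borel_measurable M"
  defines "s \<equiv> self_improvement q (extrapolation_const p q A)"
  shows "(\<integral>\<^sup>+x. lq_norm q (\<lambda>j. power_max s (f j) x) epowr p * ennreal (w x) \<partial>M)
    \<le> ennreal ((64 * lerner_norm q (extrapolation_const p q A)) powr p) *
      (\<integral>\<^sup>+x. lq_norm q (\<lambda>j. f j x) epowr p * ennreal (w x) \<partial>M)"
proof -
  define B where "B = lerner_norm q (extrapolation_const p q A)"
  have B: "1 \<le> B" unfolding B_def by (rule lerner_norm_ge_1[OF q])
  have E: "0 \<le> extrapolation_const p q A"
    using lerner_norm_ge_1[of "p / (p - 1)" "A powr (1 / (p - 1))"] p
    by (simp add: extrapolation_const_def)
  have lq: "lq_norm q a epowr q = (\<Sum>j. a j epowr q)" for a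
    using q by (simp add: lq_norm_def epowr_epowr)
  have [measurable]: "(\<lambda>x. lq_norm q (\<lambda>j. g j x)) \<in> borel_measurable M"
    if [measurable]: "\<And>j. g j \<in> borel_measurable M" for g
    unfolding lq_norm_def by measurable
  have "(\<integral>\<^sup>+x. lq_norm q (\<lambda>j. power_max s (f j) x) epowr p * ennreal (w x) \<partial>M)
    \<le> ennreal ((8 * ((8 * B) powr q) powr (1 / q)) powr p) *
      (\<integral>\<^sup>+x. lq_norm q (\<lambda>j. f j x) epowr p * ennreal (w x) \<partial>M)"
  proof (rule extrapolation[OF p q A Ap])
    fix u assume u: "Ap q (extrapolation_const p q A) u"
    then have [measurable]: "u \<in> borel_measurable M" by (simp add: Ap_def)
    have "(\<integral>\<^sup>+x. lq_norm q (\<lambda>j. power_max s (f j) x) epowr q * ennreal (u x) \<partial>M)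
      = (\<Sum>j. \<integral>\<^sup>+x. power_max s (f j) x epowr q * ennreal (u x) \<partial>M)"
      by (simp add: lq nn_integral_suminf flip: ennreal_suminf_multc)
    also have "\<dots> \<le> (\<Sum>j. ennreal ((8 * B) powr q) * (\<integral>\<^sup>+x. f j x epowr q * ennreal (u x) \<partial>M))"
      unfolding s_def B_def by (intro suminf_le summableI power_max_bounded_Ap q E u f)
    also have "\<dots> = ennreal ((8 * B) powr q) * (\<integral>\<^sup>+x. lq_norm q (\<lambda>j. f j x) epowr q * ennreal (u x) \<partial>M)"
      by (simp add: lq nn_integral_suminf flip: ennreal_suminf_multc)
    finally show "(\<integral>\<^sup>+x. lq_norm q (\<lambda>j. power_max s (f j) x) epowr q * ennreal (u x) \<partial>M)
      \<le> ennreal ((8 * B) powr q) * (\<integral>\<^sup>+x. lq_norm q (\<lambda>j. f j x) epowr q * ennreal (u x) \<partial>M)" .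
  qed (use B in auto)
  also have "8 * ((8 * B) powr q) powr (1 / q) = 64 * B"
    using B q by (simp add: powr_powr)
  finally show ?thesis by (simp add: B_def)
qed

end

section \<open>Lebesgue measure and cubes\<close>

lemma sigma_finite_lebesgue: "sigma_finite_measure (lebesgue :: 'a::euclidean_space measure)"
proof
  obtain A :: "'a set set" where A: "countable A" "A \<subseteq> sets lborel" "\<Union>A = space lborel" "\<forall>a\<in>A. emeasure lborel a \<noteq> \<infinity>"
    using lborel.sigma_finite_countable by blast
  then show "\<exists>A::'a set set. countable A \<and> A \<subseteq> sets lebesgue \<and> \<Union>A = space lebesgue \<and> (\<forall>a\<in>A. emeasure lebesgue a \<noteq> \<infinity>)"
    by (intro exI[of _ A]) (auto simp: subset_iff)
qed

lemma emeasure_lborel_cube: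
  fixes a b :: "real ^ 'n"
  assumes "0 < l" "\<And>i. b $ i = a $ i + l"
  shows "emeasure lborel (box a b) = ennreal (l ^ CARD('n))" "emeasure lborel (cbox a b) = ennreal (l ^ CARD('n))"
proof -
  have *: "(b - a) \<bullet> j = l" if j: "j \<in> Basis" for j
  proof -
    from j obtain i where "j = axis i 1" by (auto simp: Basis_vec_def)
    then show ?thesis using assms(2)[of i] by (simp add: inner_axis)
  qed
  then have le: "a \<bullet> j \<le> b \<bullet> j" if "j \<in> Basis" for j
  proof -
    have "b \<bullet> j - a \<bullet> j = l" using *[OF that] by (simp add: inner_diff_left)
    with assms(1) show ?thesis by linarith
  qed
  have "(\<Prod>j\<in>Basis. (b - a) \<bullet> j) = l ^ CARD('n)"
    by (simp add: *)
  then show "emeasure lborel (box a b) = ennreal (l ^ CARD('n))" "emeasure lborel (cbox a b) = ennreal (l ^ CARD('n))"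
    using le by simp_all
qed

section \<open>Shifted dyadic grids\<close>

text \<open>
  The sign of the shift alternates with the scale: doubling a shift by \<open>1/3\<close> gives a shift by
  \<open>- 1/3\<close> modulo the integers, so consecutive scales are nested.
\<close>

definition shift :: "('n \<Rightarrow> bool) \<Rightarrow> int \<Rightarrow> 'n \<Rightarrow> real" where
  "shift t k i = (if even k then 1 else - 1) * (if t i then 1 / 3 else 0)"

definition cube_index :: "('n \<Rightarrow> bool) \<Rightarrow> int \<Rightarrow> real ^ 'n \<Rightarrow> 'n \<Rightarrow> int" where
  "cube_index t k x i = \<lfloor>2 powi k * x $ i - shift t k i\<rfloor>"

text \<open>As fibres of the index map, the cubes of one scale partition space and are countably
  many by construction.\<close>

definition dcube :: "('n \<Rightarrow> bool) \<Rightarrow> int \<Rightarrow> real ^ 'n \<Rightarrow> (real ^ 'n) set" where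
  "dcube t k x = {y. cube_index t k y = cube_index t k x}"

definition cube_corner :: "('n::finite \<Rightarrow> bool) \<Rightarrow> int \<Rightarrow> real ^ 'n \<Rightarrow> real ^ 'n" where
  "cube_corner t k x = (\<chi> i. (of_int (cube_index t k x i) + shift t k i) / 2 powi k)"

lemma mem_dcube_iff:
  "y \<in> dcube t k x \<longleftrightarrow>
    (\<forall>i. cube_corner t k x $ i \<le> y $ i \<and> y $ i < cube_corner t k x $ i + 1 / 2 powi k)"
proof -
  have "cube_index t k y i = cube_index t k x i \<longleftrightarrow>
    cube_corner t k x $ i \<le> y $ i \<and> y $ i < cube_corner t k x $ i + 1 / 2 powi k" for i
  proof -
    have p: "(0::real) < 2 powi k" by (simp add: zero_less_power_int)
    have "cube_index t k y i = cube_index t k x i \<longleftrightarrow>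
      of_int (cube_index t k x i) \<le> 2 powi k * y $ i - shift t k i \<and>
      2 powi k * y $ i - shift t k i < of_int (cube_index t k x i) + 1"
      unfolding cube_index_def[of t k y] by (rule floor_eq_iff)
    also have "\<dots> \<longleftrightarrow> cube_corner t k x $ i \<le> y $ i \<and> y $ i < cube_corner t k x $ i + 1 / 2 powi k"
      using p by (simp add: cube_corner_def field_simps)
    finally show ?thesis .
  qed
  then show ?thesis by (auto simp: dcube_def fun_eq_iff)
qed

text \<open>The Muckenhoupt condition speaks of closed cubes, the grids of half-open ones. Both have
  the same measure, so the condition carries over.\<close>

definition closed_cube :: "('n::finite \<Rightarrow> bool) \<Rightarrow> int \<Rightarrow> real ^ 'n \<Rightarrow> (real ^ 'n) set" where
  "closed_cube t k x = cbox (cube_corner t k x) (\<chi> i. cube_corner t k x $ i + 1 / 2 powi k)"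

lemma closed_cube_in_cubes: "closed_cube t k x \<in> cubes"
  unfolding closed_cube_def cubes_def by (auto intro!: exI simp: zero_less_power_int)

lemma dcube_subset_closed_cube: "dcube t k x \<subseteq> closed_cube t k x"
  by (auto simp: closed_cube_def mem_dcube_iff mem_box_cart less_imp_le)

lemma dcube_borel: "dcube t k x \<in> sets borel"
proof -
  have "dcube t k x = (\<Inter>i. {y. cube_corner t k x $ i \<le> y $ i} \<inter> {y. y $ i < cube_corner t k x $ i + 1 / 2 powi k})"
    by (auto simp: mem_dcube_iff)
  also have "\<dots> \<in> sets borel"
    by (intro sets.countable_INT'' sets.Int borel_closed borel_open closed_Collect_le open_Collect_less
        continuous_intros) auto
  finally show ?thesis .
qed

lemma dcube_lebesgue: "dcube t k x \<in> sets lebesgue"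
  using dcube_borel[of t k x] by (intro sets_completionI_sets) simp

lemma emeasure_dcube:
  fixes x :: "real ^ 'n"
  shows "emeasure lebesgue (dcube t k x) = ennreal ((1 / 2 powi k) ^ CARD('n))"
    "emeasure lebesgue (closed_cube t k x) = ennreal ((1 / 2 powi k) ^ CARD('n))"
proof -
  let ?a = "cube_corner t k x" and ?b = "\<chi> i. cube_corner t k x $ i + 1 / 2 powi k"
  note em = emeasure_lborel_cube[of "1 / 2 powi k" ?b ?a]
  have box: "box ?a ?b \<subseteq> dcube t k x"
    by (auto simp: mem_dcube_iff mem_box_cart less_imp_le)
  have "emeasure lborel (box ?a ?b) \<le> emeasure lborel (dcube t k x)"
    by (rule emeasure_mono[OF box]) (simp add: dcube_borel)
  moreover have "emeasure lborel (dcube t k x) \<le> emeasure lborel (cbox ?a ?b)"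
    by (rule emeasure_mono[OF dcube_subset_closed_cube[unfolded closed_cube_def]]) simp
  ultimately have "emeasure lborel (dcube t k x) = ennreal ((1 / 2 powi k) ^ CARD('n))"
    using em by (simp add: zero_less_power_int)
  then show "emeasure lebesgue (dcube t k x) = ennreal ((1 / 2 powi k) ^ CARD('n))"
    using dcube_borel[of t k x] dcube_lebesgue[of t k x] by simp
  show "emeasure lebesgue (closed_cube t k x) = ennreal ((1 / 2 powi k) ^ CARD('n))"
    using em(2) by (simp add: closed_cube_def zero_less_power_int)
qed

text \<open>The index at scale k is a function of the index at scale k + 1: halving and taking
  floors is integer division once the two shifts differ by an integer.\<close>

lemma dcube_Suc: "dcube t (k + 1) x \<subseteq> dcube t k x"
proof -
  have idx: "cube_index t k y i = (cube_index t (k + 1) y i - (if t i then if even k then 1 else - 1 else 0)) div 2" for y i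
  proof -
    \<comment> \<open>This is \<open>2 * shift t k i - shift t (k + 1) i\<close>, an integer because
      the sign alternates.\<close>
    define m :: int where "m = (if t i then if even k then 1 else - 1 else 0)"
    define z where "z = 2 powi (k + 1) * y $ i - shift t (k + 1) i"
    have e: "(2::real) powi (k + 1) = 2 * 2 powi k" by (simp add: power_int_add_1)
    have "2 powi k * y $ i - shift t k i = (z - of_int m) / 2"
      unfolding z_def e by (auto simp: m_def shift_def field_simps)
    then have "cube_index t k y i = \<lfloor>(z - of_int m) / of_int 2\<rfloor>"
      unfolding cube_index_def by (simp only: of_int_numeral)
    also have "\<dots> = \<lfloor>z - of_int m\<rfloor> div 2"
      by (rule floor_divide_real_eq_div) simp
    finally show ?thesis by (simp add: cube_index_def z_def m_def)
  qed
  show ?thesis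
    by (auto simp: dcube_def fun_eq_iff idx)
qed

lemma dcube_small:
  fixes x :: "real ^ 'n"
  assumes "0 < e" obtains k where "dcube t k x \<subseteq> ball x e"
proof -
  obtain m :: nat where m: "real CARD('n) * (1 / 2) ^ m < e"
  proof -
    obtain m where "(1 / 2) ^ m < e / real CARD('n)"
      using real_arch_pow_inv[of "e / real CARD('n)" "1 / 2"] assms by auto
    then show thesis using that[of m] by (simp add: field_simps)
  qed
  have "dcube t (int m) x \<subseteq> ball x e"
  proof
    fix y assume y: "y \<in> dcube t (int m) x"
    have "x \<in> dcube t (int m) x" by (simp add: dcube_def)
    then have "\<bar>(x - y) $ i\<bar> \<le> (1 / 2) ^ m" for i
      using y unfolding mem_dcube_iff
      by (auto simp: power_one_over dest!: spec[of _ i])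
    then have "(\<Sum>i\<in>UNIV. \<bar>(x - y) $ i\<bar>) \<le> (\<Sum>i\<in>(UNIV::'n set). (1 / 2) ^ m)"
      by (intro sum_mono) auto
    then have "norm (x - y) \<le> real CARD('n) * (1 / 2) ^ m"
      using norm_le_l1_cart[of "x - y"] by simp
    then show "y \<in> ball x e" using m by (simp add: dist_norm)
  qed
  then show thesis by (rule that)
qed

theorem dyadic_dcube: "dyadic (lebesgue :: (real ^ 'n) measure) (dcube t) (2 ^ CARD('n))"
proof -
  interpret sigma_finite_measure "lebesgue :: (real ^ 'n) measure" by (rule sigma_finite_lebesgue)
  have p: "(0::real) < 1 / 2 powi k" for k by (simp add: zero_less_power_int)
  show ?thesis
  proof
    fix k and x y :: "real ^ 'n"
    show "space lebesgue = (UNIV :: (real ^ 'n) set)" by simp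
    show "dcube t k x \<in> sets lebesgue" by (rule dcube_lebesgue)
    show "x \<in> dcube t k x" by (simp add: dcube_def)
    show "dcube t k y = dcube t k x" if "y \<in> dcube t k x" using that by (auto simp: dcube_def)
    show "dcube t (k + 1) x \<subseteq> dcube t k x" by (rule dcube_Suc)
    show "emeasure lebesgue (dcube t k x) \<noteq> 0" "emeasure lebesgue (dcube t k x) \<noteq> top"
      using p[of k] by (auto simp: emeasure_dcube)
    have "(1 / 2 powi k :: real) ^ CARD('n) = 2 ^ CARD('n) * (1 / 2 powi (k + 1)) ^ CARD('n)"
      by (simp add: power_int_add_1 flip: power_mult_distrib)
    then show "emeasure lebesgue (dcube t k x) \<le> ennreal (2 ^ CARD('n)) * emeasure lebesgue (dcube t (k + 1) x)"
      by (simp add: emeasure_dcube ennreal_mult')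
    have "range (dcube t k) \<subseteq> range (\<lambda>m. {y :: real ^ 'n. cube_index t k y = m})"
      by (auto simp: dcube_def)
    then show "countable (range (dcube t k :: real ^ 'n \<Rightarrow> _))"
      by (rule countable_subset) simp
  next
    fix E :: "(real ^ 'n) set" and e :: real
    assume E: "E \<in> sets lebesgue" and e: "0 < e"
    obtain T where T: "open T" "E \<subseteq> T" "T - E \<in> lmeasurable" "emeasure lebesgue (T - E) < ennreal e"
      using sets_lebesgue_outer_open[OF E e] .
    \<comment> \<open>An open set is the union of the grid cubes inside it, so outer regularity by
      open sets becomes outer regularity by cubes.\<close>
    define \<G> where "\<G> = {Q\<in>(\<Union>k. range (dcube t k)). Q \<subseteq> T}"
    have "\<Union>\<G> = T"
    proof (rule antisym)
      show "T \<subseteq> \<Union>\<G>"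
      proof
        fix x assume "x \<in> T"
        then obtain r where "0 < r" "ball x r \<subseteq> T" using T(1) by (auto simp: open_contains_ball)
        then obtain k where "dcube t k x \<subseteq> T" using dcube_small[of r t x] by (metis order_trans)
        then have "dcube t k x \<in> \<G>" by (auto simp: \<G>_def)
        then show "x \<in> \<Union>\<G>" by (auto simp: dcube_def)
      qed
    qed (auto simp: \<G>_def)
    moreover have "emeasure lebesgue T \<le> emeasure lebesgue E + ennreal e"
    proof -
      have "emeasure lebesgue T = emeasure lebesgue E + emeasure lebesgue (T - E)"
        using plus_emeasure[OF E fmeasurableD[OF T(3)]] T(2) by (simp add: Un_absorb1)
      then show ?thesis using T(4) by (simp add: add_left_mono)
    qed
    ultimately show "\<exists>\<G>\<subseteq>(\<Union>k. range (dcube t k)). E \<subseteq> \<Union>\<G> \<and> emeasure lebesgue (\<Union>\<G>) \<le> emeasure lebesgue E + ennreal e"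
      using T(2) by (intro exI[of _ \<G>] conjI) (simp_all add: \<G>_def subset_iff)
  qed
qed

text \<open>The unshifted floor jumps at the integers, the shifted one at points at least 1/3 away
  from them. An open window of radius 1/6 therefore misses one of the two sets of jumps.\<close>

lemma one_third_trick:
  fixes z s :: real
  assumes s: "s = 1 \<or> s = - 1"
  obtains b where "\<And>u. \<bar>u - z\<bar> < 1 / 6 \<Longrightarrow>
    \<lfloor>u - s * (if b then 1 / 3 else 0)\<rfloor> = \<lfloor>z - s * (if b then 1 / 3 else 0)\<rfloor>"
proof (cases "\<exists>m::int. \<bar>z - of_int m\<bar> < 1 / 6")
  case True
  then obtain m :: int where m: "\<bar>z - of_int m\<bar> < 1 / 6" by auto
  have "\<lfloor>u - s * (1 / 3)\<rfloor> = m - (if s = 1 then 1 else 0)" if "\<bar>u - z\<bar> < 1 / 6" for u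
    unfolding floor_eq_iff using m s that by (auto simp: abs_if split: if_splits)
  from this this[of z] show ?thesis by (intro that[of True]) auto
next
  case False
  have eq: "\<lfloor>u\<rfloor> = \<lfloor>z\<rfloor>" if u: "\<bar>u - z\<bar> < 1 / 6" for u
  proof -
    have "\<not> \<bar>z - of_int \<lfloor>z\<rfloor>\<bar> < 1 / 6" "\<not> \<bar>z - of_int (\<lfloor>z\<rfloor> + 1)\<bar> < 1 / 6" using False by blast+
    then have "1 / 6 \<le> z - of_int \<lfloor>z\<rfloor>" "1 / 6 \<le> of_int \<lfloor>z\<rfloor> + 1 - z"
      using floor_correct[of z] by (simp_all add: abs_if)
    moreover have "u - z < 1 / 6" "z - u < 1 / 6" using u unfolding abs_less_iff by linarith+
    ultimately have "of_int \<lfloor>z\<rfloor> \<le> u" "u < of_int \<lfloor>z\<rfloor> + 1" by linarith+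
    then show ?thesis by (simp only: floor_eq_iff)
  qed
  show ?thesis
  proof (rule that[of False])
    fix u :: real assume "\<bar>u - z\<bar> < 1 / 6"
    with eq[OF this] show "\<lfloor>u - s * (if False then 1 / 3 else 0)\<rfloor> = \<lfloor>z - s * (if False then 1 / 3 else 0)\<rfloor>"
      by simp
  qed
qed

text \<open>The scale is the largest k with 2^k r \<le> 1/6, and maximality gives the bound 12 r on
  the side. The shift is chosen separately in each coordinate, hence 2^n grids.\<close>

lemma ball_subset_dcube:
  fixes x :: "real ^ 'n"
  assumes r: "0 < r"
  obtains t k where "ball x r \<subseteq> dcube t k x" "1 / 2 powi k \<le> 12 * r"
proof -
  define k where "k = \<lfloor>log 2 (1 / (6 * r))\<rfloor>"
  have pk: "2 powi k = 2 powr real_of_int k" by (simp add: powr_real_of_int')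
  have "2 powr real_of_int k \<le> 2 powr log 2 (1 / (6 * r))"
    unfolding k_def by (intro powr_mono) auto
  then have lo: "2 powi k * r \<le> 1 / 6"
    using r by (simp add: pk field_simps)
  have "2 powr log 2 (1 / (6 * r)) \<le> 2 powr (real_of_int k + 1)"
    unfolding k_def by (intro powr_mono) linarith+
  then have "1 / (6 * r) \<le> 2 * 2 powi k"
    using r by (simp add: pk powr_add)
  then have hi: "1 / 2 powi k \<le> 12 * r"
    using r by (simp add: field_simps zero_less_power_int)
  have "\<forall>i. \<exists>b. \<forall>u. \<bar>u - 2 powi k * x $ i\<bar> < 1 / 6 \<longrightarrow>
    \<lfloor>u - (if even k then 1 else - 1) * (if b then 1 / 3 else 0)\<rfloor> =
    \<lfloor>2 powi k * x $ i - (if even k then 1 else - 1) * (if b then 1 / 3 else 0)\<rfloor>"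
    using one_third_trick[of "if even k then 1 else - 1"] by metis
  then obtain t where t: "\<And>i u. \<bar>u - 2 powi k * x $ i\<bar> < 1 / 6 \<Longrightarrow>
    \<lfloor>u - shift t k i\<rfloor> = \<lfloor>2 powi k * x $ i - shift t k i\<rfloor>"
    unfolding shift_def by metis
  have "ball x r \<subseteq> dcube t k x"
  proof
    fix y assume y: "y \<in> ball x r"
    have "\<bar>2 powi k * y $ i - 2 powi k * x $ i\<bar> < 1 / 6" for i
    proof -
      have "\<bar>y $ i - x $ i\<bar> < r"
        using y component_le_norm_cart[of "y - x" i] by (simp add: dist_norm norm_minus_commute)
      then have "2 powi k * \<bar>y $ i - x $ i\<bar> < 2 powi k * r"
        by (intro mult_strict_left_mono) (auto simp: zero_less_power_int)
      also note lo
      also have "2 powi k * \<bar>y $ i - x $ i\<bar> = \<bar>2 powi k * y $ i - 2 powi k * x $ i\<bar>"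
        by (simp add: abs_mult flip: right_diff_distrib)
      finally show ?thesis .
    qed
    then have "cube_index t k y i = cube_index t k x i" for i
      unfolding cube_index_def by (rule t)
    then show "y \<in> dcube t k x" by (simp add: dcube_def fun_eq_iff)
  qed
  then show thesis using hi that by blast
qed

section \<open>Reflections and sections of Lebesgue measurable functions\<close>

lemma lebesgue_reflect:
  fixes x :: "'a::euclidean_space"
  shows "(\<lambda>y. x - y) \<in> lebesgue \<rightarrow>\<^sub>M lebesgue" "distr lebesgue lebesgue (\<lambda>y. x - y) = lebesgue"
proof -
  have T: "(\<lambda>y. x + (\<Sum>j\<in>Basis. (- 1 * (y \<bullet> j)) *\<^sub>R j)) = (\<lambda>y. x - y)"
    by (simp add: sum_negf euclidean_representation)
  show "(\<lambda>y. x - y) \<in> lebesgue \<rightarrow>\<^sub>M lebesgue"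
    using lebesgue_affine_measurable[of "\<lambda>_. - 1" x] unfolding T by simp
  show "distr lebesgue lebesgue (\<lambda>y. x - y) = lebesgue"
    using lebesgue_affine_euclidean[of "\<lambda>_. - 1" x] unfolding T by (simp add: density_1)
qed

text \<open>Measurability for the completed product measure gives measurable sections only for
  almost every x, by comparison with a Borel function. The domination of \<open>maximal_op\<close>
  is therefore an almost everywhere statement in the main proof.\<close>

lemma AE_section_measurable:
  fixes H :: "'a::euclidean_space \<Rightarrow> 'b::euclidean_space \<Rightarrow> real"
  assumes "(\<lambda>(x, y). H x y) \<in> borel_measurable lebesgue"
  shows "AE x in lebesgue. H x \<in> borel_measurable lebesgue"
proof -
  obtain h where h: "h \<in> borel_measurable lborel" "AE z in lborel. (\<lambda>(x, y). H x y) z = h z"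
    using completion_ex_borel_measurable_real[OF assms] by blast
  have "AE z in lborel \<Otimes>\<^sub>M lborel. (\<lambda>(x, y). H x y) z = h z"
    unfolding lborel_prod by (rule h(2))
  then have "AE x in lborel. AE y in lborel. H x y = h (x, y)"
    using lborel_pair.AE_pair by fastforce
  then have "AE x in lborel. H x \<in> borel_measurable lebesgue"
  proof eventually_elim
    case (elim x)
    have "h \<in> borel_measurable (borel \<Otimes>\<^sub>M borel)" using h(1) by (simp add: borel_prod)
    then have "(\<lambda>y. h (x, y)) \<in> borel_measurable borel" by measurable
    then have "(\<lambda>y. h (x, y)) \<in> borel_measurable lebesgue"
      by (simp add: measurable_completion)
    moreover have "AE y in lebesgue. h (x, y) = H x y"
      using AE_completion[OF elim] by eventually_elim simp
    ultimately show ?case by (rule borel_measurable_AE)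
  qed
  then show ?thesis by (rule AE_completion)
qed

section \<open>The vector-valued inequality\<close>

text \<open>The bound is the p-th power of the Muckenhoupt constant, common to all shifts. Replacing
  w by 1 where it is not positive changes it on a null set and gives the positivity in
  \<open>Ap\<close>.\<close>

lemma Ap_muckenhoupt:
  fixes w :: "real ^ 'n \<Rightarrow> real"
  assumes p: "1 < p" and w: "w \<in> muckenhoupt p"
  obtains A where "0 \<le> A" "\<And>t. dyadic.Ap lebesgue (dcube t) p A (\<lambda>x. if 0 < w x then w x else 1)"
proof -
  have w_meas[measurable]: "w \<in> borel_measurable lebesgue" and w_pos: "AE x in lebesgue. 0 < w x"
    using w by (auto simp: muckenhoupt_def)
  define S where "S = (SUP Q\<in>cubes. average Q w epowr (1 / p) *
        average Q (\<lambda>x. w x powr (- (conj_exponent p / p))) epowr (1 / conj_exponent p))"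
  have "S < top" using w by (simp add: muckenhoupt_def S_def)
  then obtain a where a: "S = ennreal a" "0 \<le> a" by (cases S) auto
  have conj: "conj_exponent p / p = 1 / (p - 1)" "1 / conj_exponent p * p = p - 1"
    using p by (auto simp: conj_exponent_def)
  have mean_le: "mean lebesgue (dcube t k x) g \<le> average (closed_cube t k x) h"
    if "AE x in lebesgue. g x = ennreal (h x)" for t k x g h
    unfolding mean_def average_def emeasure_dcube
    using that dcube_subset_closed_cube[of t k x]
    by (intro divide_right_mono_ennreal nn_integral_mono_AE) (auto simp: indicator_def elim!: eventually_mono)
  show thesis
  proof (rule that[of "a powr p"])
    fix t :: "'n \<Rightarrow> bool"
    interpret dyadic "lebesgue :: (real ^ 'n) measure" "dcube t" "2 ^ CARD('n)" by (rule dyadic_dcube)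
    show "Ap p (a powr p) (\<lambda>x. if 0 < w x then w x else 1)"
      unfolding Ap_def
    proof (intro conjI allI ballI)
      show "(\<lambda>x. if 0 < w x then w x else 1) \<in> borel_measurable lebesgue" by measurable
      fix Q assume "Q \<in> grid"
      then obtain k x where Q: "Q = dcube t k x" by (elim gridE)
      define R where "R = closed_cube t k x"
      have 1: "mean lebesgue Q (\<lambda>x. ennreal (if 0 < w x then w x else 1)) \<le> average R w"
        unfolding Q R_def by (rule mean_le) (use w_pos in eventually_elim, simp)
      have 2: "mean lebesgue Q (\<lambda>x. ennreal (dualw p (\<lambda>x. if 0 < w x then w x else 1) x))
          \<le> average R (\<lambda>x. w x powr (- (conj_exponent p / p)))"
        unfolding Q R_def
        by (rule mean_le) (use w_pos in eventually_elim, simp only: dualw_def conj, simp)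
      have "mean lebesgue Q (\<lambda>x. ennreal (if 0 < w x then w x else 1)) *
          mean lebesgue Q (\<lambda>x. ennreal (dualw p (\<lambda>x. if 0 < w x then w x else 1) x)) epowr (p - 1)
        \<le> average R w * average R (\<lambda>x. w x powr (- (conj_exponent p / p))) epowr (p - 1)"
        using p by (intro mult_mono 1 2 epowr_mono) auto
      also have "\<dots> = (average R w epowr (1 / p) *
          average R (\<lambda>x. w x powr (- (conj_exponent p / p))) epowr (1 / conj_exponent p)) epowr p"
        using p by (simp only: epowr_mult epowr_epowr conj) (simp add: epowr_mult epowr_epowr conj)
      also have "\<dots> \<le> S epowr p"
        unfolding S_def R_def using p by (intro epowr_mono SUP_upper closed_cube_in_cubes) auto
      finally show "mean lebesgue Q (\<lambda>x. ennreal (if 0 < w x then w x else 1)) *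
          mean lebesgue Q (\<lambda>x. ennreal (dualw p (\<lambda>x. if 0 < w x then w x else 1) x)) epowr (p - 1)
        \<le> ennreal (a powr p)"
        using a by (simp add: epowr_ennreal)
    qed auto
  qed simp
qed

text \<open>Hoelder on the ball separates H from f. The ball lies in a grid cube of measure at most
  (12 r)^n, so M_s controls the second factor, and r^(n/\<sigma>) r^(n/s) = r^n cancels the
  normalization.\<close>

lemma maximal_op_le:
  fixes H :: "real ^ 'n \<Rightarrow> real ^ 'n \<Rightarrow> real" and f :: "real ^ 'n \<Rightarrow> complex"
  assumes s: "1 < s" and \<sigma>: "1 < \<sigma>" "1 / \<sigma> + 1 / s = 1" and C: "0 < C"
    and H[measurable]: "H x \<in> borel_measurable lebesgue" and H0: "\<And>y. 0 \<le> H x y"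
    and H_int: "\<And>r. 0 < r \<Longrightarrow> (\<integral>\<^sup>+y\<in>ball 0 r. ennreal (H x y powr \<sigma>) \<partial>lebesgue) \<le> ennreal (C * r ^ CARD('n))"
    and f[measurable]: "f \<in> borel_measurable lebesgue" and a: "0 < a"
  shows "maximal_op H f x epowr a \<le> ennreal ((C powr (1 / \<sigma>) * (12 ^ CARD('n)) powr (1 / s)) powr a) *
    (\<Sum>t\<in>UNIV. dyadic.power_max lebesgue (dcube t) s (\<lambda>x. ennreal (norm (f x))) x epowr a)"
proof -
  let ?pm = "\<lambda>t. dyadic.power_max lebesgue (dcube t) s (\<lambda>x. ennreal (norm (f x))) x"
  define c where "c = C powr (1 / \<sigma>) * (12 ^ CARD('n)) powr (1 / s)"
  have c: "0 < c" using C by (simp add: c_def)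
  have ball: "\<exists>t. ennreal (1 / r ^ CARD('n)) * (\<integral>\<^sup>+y\<in>ball 0 r. ennreal (H x y * norm (f (x - y))) \<partial>lebesgue)
      \<le> ennreal c * ?pm t" if r: "0 < r" for r
  proof -
    obtain t k where tk: "ball x r \<subseteq> dcube t k x" "1 / 2 powi k \<le> 12 * r"
      using ball_subset_dcube[OF r] .
    interpret dyadic "lebesgue :: (real ^ 'n) measure" "dcube t" "2 ^ CARD('n)" by (rule dyadic_dcube)
    let ?Q = "dcube t k x"
    define n where "n = CARD('n)"
    note [measurable] = lebesgue_reflect(1)[of x]
    have [measurable]: "ball 0 r \<in> sets lebesgue" "ball x r \<in> sets lebesgue" for x :: "real ^ 'n" by auto
    have [measurable]: "(\<lambda>y. f (x - y)) \<in> borel_measurable lebesgue"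
      using measurable_compose[OF lebesgue_reflect(1) f] .
    have "(\<integral>\<^sup>+y\<in>ball 0 r. ennreal (H x y * norm (f (x - y))) \<partial>lebesgue)
      = (\<integral>\<^sup>+y. (ennreal (H x y) * indicator (ball 0 r) y) * (ennreal (norm (f (x - y))) * indicator (ball 0 r) y) \<partial>lebesgue)"
      using H0 by (intro nn_integral_cong) (auto simp: indicator_def ennreal_mult)
    also have "\<dots> \<le> (\<integral>\<^sup>+y. (ennreal (H x y) * indicator (ball 0 r) y) epowr \<sigma> \<partial>lebesgue) epowr (1 / \<sigma>) *
        (\<integral>\<^sup>+y. (ennreal (norm (f (x - y))) * indicator (ball 0 r) y) epowr s \<partial>lebesgue) epowr (1 / s)"
      by (rule nn_integral_Hoelder[OF \<sigma>]) measurable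
    also have "(\<integral>\<^sup>+y. (ennreal (H x y) * indicator (ball 0 r) y) epowr \<sigma> \<partial>lebesgue)
       = (\<integral>\<^sup>+y\<in>ball 0 r. ennreal (H x y powr \<sigma>) \<partial>lebesgue)"
      using H0 by (intro nn_integral_cong) (auto simp: indicator_def epowr_ennreal)
    also have "(\<integral>\<^sup>+y. (ennreal (norm (f (x - y))) * indicator (ball 0 r) y) epowr s \<partial>lebesgue)
       = (\<integral>\<^sup>+z\<in>ball x r. ennreal (norm (f z)) epowr s \<partial>lebesgue)"
    proof -
      have "(\<integral>\<^sup>+z\<in>ball x r. ennreal (norm (f z)) epowr s \<partial>lebesgue)
        = (\<integral>\<^sup>+z\<in>ball x r. ennreal (norm (f z)) epowr s \<partial>(distr lebesgue lebesgue (\<lambda>y. x - y)))"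
        by (simp only: lebesgue_reflect(2))
      also have "\<dots> = (\<integral>\<^sup>+y. ennreal (norm (f (x - y))) epowr s * indicator (ball x r) (x - y) \<partial>lebesgue)"
        by (rule nn_integral_distr) measurable
      also have "\<dots> = (\<integral>\<^sup>+y. (ennreal (norm (f (x - y))) * indicator (ball 0 r) y) epowr s \<partial>lebesgue)"
        by (intro nn_integral_cong) (auto simp: indicator_def dist_norm)
      finally show ?thesis by simp
    qed
    also have "(\<integral>\<^sup>+z\<in>ball x r. ennreal (norm (f z)) epowr s \<partial>lebesgue)
      \<le> (\<integral>\<^sup>+z\<in>?Q. ennreal (norm (f z)) epowr s \<partial>lebesgue)"
      using tk(1) by (intro nn_integral_mono) (auto simp: indicator_def)
    also have "\<dots> = mean lebesgue ?Q (\<lambda>z. ennreal (norm (f z)) epowr s) * emeasure lebesgue ?Q"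
      by (simp add: mean_mult_emeasure D_pos D_fin)
    also have "\<dots> \<le> dmax (\<lambda>z. ennreal (norm (f z)) epowr s) x * ennreal ((12 * r) ^ n)"
    proof (intro mult_mono mean_le_maxfun D_in_grid D_self)
      show "emeasure lebesgue ?Q \<le> ennreal ((12 * r) ^ n)"
        unfolding emeasure_dcube n_def using tk(2)
        by (intro ennreal_leI power_mono) (auto simp: zero_le_power_int)
    qed auto
    finally have "(\<integral>\<^sup>+y\<in>ball 0 r. ennreal (H x y * norm (f (x - y))) \<partial>lebesgue)
      \<le> (\<integral>\<^sup>+y\<in>ball 0 r. ennreal (H x y powr \<sigma>) \<partial>lebesgue) epowr (1 / \<sigma>) *
        (dmax (\<lambda>z. ennreal (norm (f z)) epowr s) x * ennreal ((12 * r) ^ n)) epowr (1 / s)"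
      using s by (simp add: mult_left_mono epowr_mono)
    also have "\<dots> \<le> ennreal (C * r ^ n) epowr (1 / \<sigma>) *
        (dmax (\<lambda>z. ennreal (norm (f z)) epowr s) x * ennreal ((12 * r) ^ n)) epowr (1 / s)"
      using \<sigma> H_int[OF r] unfolding n_def by (intro mult_right_mono epowr_mono) auto
    also have "\<dots> = (ennreal ((C * r ^ n) powr (1 / \<sigma>)) * ennreal (((12 * r) ^ n) powr (1 / s))) * ?pm t"
      using s C r by (simp add: epowr_mult epowr_ennreal power_max_def mult_ac)
    also have "ennreal ((C * r ^ n) powr (1 / \<sigma>)) * ennreal (((12 * r) ^ n) powr (1 / s)) = ennreal (c * r ^ n)"
    proof -
      have "(r ^ n) powr (1 / \<sigma>) * (r ^ n) powr (1 / s) = r ^ n"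
        using r \<sigma>(2) by (simp flip: powr_add)
      then have "(C * r ^ n) powr (1 / \<sigma>) * ((12 * r) ^ n) powr (1 / s) = c * r ^ n"
        using C r by (simp add: c_def powr_mult power_mult_distrib n_def)
      then show ?thesis by (simp flip: ennreal_mult)
    qed
    finally have "ennreal (1 / r ^ n) * (\<integral>\<^sup>+y\<in>ball 0 r. ennreal (H x y * norm (f (x - y))) \<partial>lebesgue)
      \<le> ennreal (1 / r ^ n) * (ennreal (c * r ^ n) * ?pm t)"
      by (rule mult_left_mono) simp
    also have "\<dots> = ennreal c * ?pm t"
      using r c by (simp add: mult.assoc[symmetric] flip: ennreal_mult)
    finally show ?thesis by (auto simp: n_def)
  qed
  \<comment> \<open>The grid varies with r, so the supremum is bounded by a sum over all shifts. The
    sum is of a-th powers because the l^q norm will take a = q.\<close>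
  have "maximal_op H f x \<le> (ennreal (c powr a) * (\<Sum>t\<in>UNIV. ?pm t epowr a)) epowr (1 / a)"
    unfolding maximal_op_def
  proof (rule SUP_least)
    fix r :: real assume "r \<in> {0<..}"
    then obtain t where t: "ennreal (1 / r ^ CARD('n)) * (\<integral>\<^sup>+y\<in>ball 0 r. ennreal (H x y * norm (f (x - y))) \<partial>lebesgue)
      \<le> ennreal c * ?pm t" using ball by auto
    have "(ennreal c * ?pm t) epowr a = ennreal (c powr a) * ?pm t epowr a"
      using a c by (simp add: epowr_mult epowr_ennreal)
    also have "\<dots> \<le> ennreal (c powr a) * (\<Sum>t\<in>UNIV. ?pm t epowr a)"
      by (intro mult_left_mono member_le_sum) auto
    finally have "ennreal c * ?pm t \<le> (ennreal (c powr a) * (\<Sum>t\<in>UNIV. ?pm t epowr a)) epowr (1 / a)"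
      using a by (simp add: epowr_le_iff)
    with t show "ennreal (1 / r ^ CARD('n)) * (\<integral>\<^sup>+y\<in>ball 0 r. ennreal (H x y * norm (f (x - y))) \<partial>lebesgue)
      \<le> (ennreal (c powr a) * (\<Sum>t\<in>UNIV. ?pm t epowr a)) epowr (1 / a)"
      by (rule order_trans)
  qed
  then show ?thesis
    using a by (simp add: epowr_le_iff c_def)
qed

text \<open>Comparison with the largest term works for every r > 0; the application has r = p/q,
  which may lie on either side of 1.\<close>

lemma sum_epowr_le:
  fixes a :: "'i \<Rightarrow> ennreal"
  assumes "finite T" "0 < r"
  shows "(\<Sum>t\<in>T. a t) epowr r \<le> ennreal (real (card T) powr r) * (\<Sum>t\<in>T. a t epowr r)"
proof (cases "T = {}")
  case False
  define m where "m = Max (a ` T)"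
  have "m \<in> a ` T" unfolding m_def using assms False by (intro Max_in) auto
  then obtain t where t: "t \<in> T" "m = a t" by auto
  have "(\<Sum>t\<in>T. a t) \<le> (\<Sum>t\<in>T. m)"
    using assms by (intro sum_mono) (simp add: m_def)
  also have "\<dots> = ennreal (real (card T)) * m"
    by (simp add: ennreal_of_nat_eq_real_of_nat)
  finally have "(\<Sum>t\<in>T. a t) epowr r \<le> (ennreal (real (card T)) * m) epowr r"
    using assms by (intro epowr_mono)
  also have "\<dots> = ennreal (real (card T) powr r) * a t epowr r"
    using assms t by (simp add: epowr_mult epowr_ennreal)
  also have "\<dots> \<le> ennreal (real (card T) powr r) * (\<Sum>t\<in>T. a t epowr r)"
    using assms t by (intro mult_left_mono member_le_sum) auto
  finally show ?thesis .
qed simp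

theorem theorem2p8:
  fixes p q :: real and w :: "real ^ 'n \<Rightarrow> real"
  assumes "1 < p" and "1 < q" and "w \<in> muckenhoupt p"
  shows "\<exists>\<sigma>>1. \<forall>C\<^sub>H>0. \<exists>C>0. \<forall>H :: real ^ 'n \<Rightarrow> real ^ 'n \<Rightarrow> real.
    (\<lambda>(x, y). H x y) \<in> borel_measurable lebesgue \<longrightarrow>
    (\<forall>x y. 0 \<le> H x y) \<longrightarrow>
    (\<forall>x. \<forall>r>0. (\<integral>\<^sup>+y\<in>ball 0 r. ennreal (H x y powr \<sigma>) \<partial>lebesgue) \<le> ennreal (C\<^sub>H * r ^ CARD('n))) \<longrightarrow>
    (\<forall>f :: nat \<Rightarrow> real ^ 'n \<Rightarrow> complex.
      (\<forall>j. f j \<in> borel_measurable lebesgue) \<longrightarrow>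
      weighted_Lp_norm p w (\<lambda>x. lq_norm q (\<lambda>j. maximal_op H (f j) x))
        \<le> ennreal C * weighted_Lp_norm p w (\<lambda>x. lq_norm q (\<lambda>j. ennreal (norm (f j x)))))"
proof -
  note p = assms(1) and q = assms(2)
  \<comment> \<open>Agrees with w up to a null set, so it defines the same measure, but it is
    positive everywhere.\<close>
  define v where "v x = (if 0 < w x then w x else 1)" for x
  have w_meas[measurable]: "w \<in> borel_measurable lebesgue" and w_pos: "AE x in lebesgue. 0 < w x"
    using assms(3) by (auto simp: muckenhoupt_def)
  have v_meas[measurable]: "v \<in> borel_measurable lebesgue" unfolding v_def by measurable
  have dens: "density lebesgue (\<lambda>x. ennreal (w x)) = density lebesgue (\<lambda>x. ennreal (v x))"
    by (rule density_cong) (use w_pos in \<open>auto simp: v_def elim: eventually_mono\<close>)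
  obtain A where A: "0 \<le> A" and Ap: "\<And>t. dyadic.Ap lebesgue (dcube t) p A v"
    using Ap_muckenhoupt[OF p assms(3)] unfolding v_def[abs_def] by blast
  \<comment> \<open>E and B come from p, q and A alone, and \<kappa> = 2^n is common to all shifts,
    so one s serves every grid.\<close>
  define E where "E = dyadic.extrapolation_const p q A"
  define B where "B = dyadic.lerner_norm q E"
  define s where "s = dyadic.self_improvement (2 ^ CARD('n)) q E"
  interpret G0: dyadic "lebesgue :: (real ^ 'n) measure" "dcube (\<lambda>_. False)" "2 ^ CARD('n)"
    by (rule dyadic_dcube)
  have B: "1 \<le> B" unfolding B_def by (rule G0.lerner_norm_ge_1[OF q])
  have s: "1 < s" using B by (simp add: s_def G0.self_improvement_def B_def)
  define \<sigma> where "\<sigma> = s / (s - 1)"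
  have \<sigma>: "1 < \<sigma>" "1 / \<sigma> + 1 / s = 1" using s by (auto simp: \<sigma>_def field_simps)
  define pm where "pm t g = dyadic.power_max lebesgue (dcube t) s g" for t :: "'n \<Rightarrow> bool" and g
  define L where "L g t x = lq_norm q (\<lambda>j. pm t (g j) x)" for g :: "nat \<Rightarrow> real ^ 'n \<Rightarrow> ennreal" and t x
  have pm_meas[measurable]: "pm t g \<in> borel_measurable lebesgue" for t g
  proof -
    interpret dyadic "lebesgue :: (real ^ 'n) measure" "dcube t" "2 ^ CARD('n)" by (rule dyadic_dcube)
    show ?thesis unfolding pm_def by (rule power_max_measurable)
  qed
  have L_meas[measurable]: "L g t \<in> borel_measurable lebesgue" for g t
    unfolding L_def lq_norm_def by measurable
  have L_int: "(\<integral>\<^sup>+x. L g t x epowr p * ennreal (v x) \<partial>lebesgue) \<le> ennreal ((64 * B) powr p) *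
      (\<integral>\<^sup>+x. lq_norm q (\<lambda>j. g j x) epowr p * ennreal (v x) \<partial>lebesgue)"
    if "\<And>j. g j \<in> borel_measurable lebesgue" for g t
  proof -
    interpret dyadic "lebesgue :: (real ^ 'n) measure" "dcube t" "2 ^ CARD('n)" by (rule dyadic_dcube)
    show ?thesis
      unfolding L_def pm_def s_def B_def E_def by (rule power_max_vector_valued[OF p q A Ap that])
  qed
  have lq: "lq_norm q a epowr q = (\<Sum>j. a j epowr q)" for a
    using q by (simp add: lq_norm_def epowr_epowr)
  show ?thesis
  proof (rule exI[of _ \<sigma>], intro conjI \<sigma>(1) allI impI)
    fix C\<^sub>H :: real assume C\<^sub>H: "0 < C\<^sub>H"
    define c where "c = C\<^sub>H powr (1 / \<sigma>) * (12 ^ CARD('n)) powr (1 / s)"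
    have c: "0 < c" using C\<^sub>H by (simp add: c_def)
    define N where "N = real (card (UNIV :: ('n \<Rightarrow> bool) set))"
    have N: "0 < N" by (simp add: N_def card_gt_0_iff)
    \<comment> \<open>In order: the pointwise domination, the power p/q of a sum over the N grids,
      the N resulting integrals, and the vector-valued bound on each grid.\<close>
    define K where "K = c powr p * N powr (p / q) * N * (64 * B) powr p"
    have K: "0 < K" using c N B by (simp add: K_def)
    show "\<exists>C>0. \<forall>H :: real ^ 'n \<Rightarrow> real ^ 'n \<Rightarrow> real.
      (\<lambda>(x, y). H x y) \<in> borel_measurable lebesgue \<longrightarrow>
      (\<forall>x y. 0 \<le> H x y) \<longrightarrow>
      (\<forall>x. \<forall>r>0. (\<integral>\<^sup>+y\<in>ball 0 r. ennreal (H x y powr \<sigma>) \<partial>lebesgue) \<le> ennreal (C\<^sub>H * r ^ CARD('n))) \<longrightarrow>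
      (\<forall>f :: nat \<Rightarrow> real ^ 'n \<Rightarrow> complex.
        (\<forall>j. f j \<in> borel_measurable lebesgue) \<longrightarrow>
        weighted_Lp_norm p w (\<lambda>x. lq_norm q (\<lambda>j. maximal_op H (f j) x))
          \<le> ennreal C * weighted_Lp_norm p w (\<lambda>x. lq_norm q (\<lambda>j. ennreal (norm (f j x)))))"
    proof (rule exI[of _ "K powr (1 / p)"], intro conjI allI impI)
      show "0 < K powr (1 / p)" using K by simp
      fix H :: "real ^ 'n \<Rightarrow> real ^ 'n \<Rightarrow> real" and f :: "nat \<Rightarrow> real ^ 'n \<Rightarrow> complex"
      assume H: "(\<lambda>(x, y). H x y) \<in> borel_measurable lebesgue" and H0: "\<forall>x y. 0 \<le> H x y"
        and H_int: "\<forall>x. \<forall>r>0. (\<integral>\<^sup>+y\<in>ball 0 r. ennreal (H x y powr \<sigma>) \<partial>lebesgue) \<le> ennreal (C\<^sub>H * r ^ CARD('n))"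
        and f: "\<forall>j. f j \<in> borel_measurable lebesgue"
      then have [measurable]: "f j \<in> borel_measurable lebesgue" for j by simp
      define g where "g j x = ennreal (norm (f j x))" for j x
      have g_meas[measurable]: "g j \<in> borel_measurable lebesgue" for j unfolding g_def by measurable
      have ptw: "AE x in lebesgue. lq_norm q (\<lambda>j. maximal_op H (f j) x) epowr p
        \<le> ennreal (c powr p * N powr (p / q)) * (\<Sum>t\<in>UNIV. L g t x epowr p)"
        using AE_section_measurable[OF H]
      proof eventually_elim
        case (elim x)
        have "lq_norm q (\<lambda>j. maximal_op H (f j) x) epowr q
          \<le> (\<Sum>j. ennreal (c powr q) * (\<Sum>t\<in>UNIV. pm t (g j) x epowr q))"
          unfolding lq
        proof (intro suminf_le summableI)
          show "maximal_op H (f j) x epowr q \<le> ennreal (c powr q) * (\<Sum>t\<in>UNIV. pm t (g j) x epowr q)" for j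
            unfolding c_def pm_def g_def[abs_def]
            using s \<sigma> C\<^sub>H elim H0 H_int q by (intro maximal_op_le) auto
        qed
        also have "\<dots> = ennreal (c powr q) * (\<Sum>t\<in>UNIV. \<Sum>j. pm t (g j) x epowr q)"
          by (simp add: suminf_sum summableI)
        also have "\<dots> = ennreal (c powr q) * (\<Sum>t\<in>UNIV. L g t x epowr q)"
          by (simp add: L_def lq)
        \<comment> \<open>The sums over j and over the grids were exchanged at the level of q-th
          powers; the power p/q now produces the integrand of the L^p norm.\<close>
        finally have "(lq_norm q (\<lambda>j. maximal_op H (f j) x) epowr q) epowr (p / q)
          \<le> (ennreal (c powr q) * (\<Sum>t\<in>UNIV. L g t x epowr q)) epowr (p / q)"
          using p q by (intro epowr_mono) auto
        also have "\<dots> = ennreal (c powr p) * (\<Sum>t\<in>UNIV. L g t x epowr q) epowr (p / q)"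
          using p q by (simp add: epowr_mult epowr_ennreal powr_powr)
        also have "\<dots> \<le> ennreal (c powr p) * (ennreal (N powr (p / q)) * (\<Sum>t\<in>UNIV. (L g t x epowr q) epowr (p / q)))"
          unfolding N_def using p q by (intro mult_left_mono sum_epowr_le) auto
        finally show ?case
          using p q by (simp add: epowr_epowr ennreal_mult mult.assoc)
      qed
      have "(\<integral>\<^sup>+x. lq_norm q (\<lambda>j. maximal_op H (f j) x) epowr p \<partial>density lebesgue (\<lambda>x. ennreal (w x)))
        \<le> (\<integral>\<^sup>+x. ennreal (c powr p * N powr (p / q)) * (\<Sum>t\<in>UNIV. L g t x epowr p) \<partial>density lebesgue (\<lambda>x. ennreal (v x)))"
        unfolding dens by (intro nn_integral_mono_AE) (use ptw in \<open>auto simp: AE_density elim: eventually_mono\<close>)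
      also have "\<dots> = ennreal (c powr p * N powr (p / q)) * (\<Sum>t\<in>UNIV. \<integral>\<^sup>+x. L g t x epowr p * ennreal (v x) \<partial>lebesgue)"
        by (simp add: nn_integral_cmult nn_integral_sum) (simp add: nn_integral_density mult.commute)
      also have "\<dots> \<le> ennreal (c powr p * N powr (p / q)) * (\<Sum>t\<in>(UNIV :: ('n \<Rightarrow> bool) set). ennreal ((64 * B) powr p) *
          (\<integral>\<^sup>+x. lq_norm q (\<lambda>j. g j x) epowr p * ennreal (v x) \<partial>lebesgue))"
        by (intro mult_left_mono sum_mono L_int) auto
      also have "\<dots> = (ennreal (c powr p * N powr (p / q)) * (ennreal N * ennreal ((64 * B) powr p))) *
          (\<integral>\<^sup>+x. lq_norm q (\<lambda>j. g j x) epowr p * ennreal (v x) \<partial>lebesgue)"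
        by (simp add: N_def ennreal_of_nat_eq_real_of_nat mult.assoc)
      also have "ennreal (c powr p * N powr (p / q)) * (ennreal N * ennreal ((64 * B) powr p)) = ennreal K"
        using N by (simp add: K_def mult.assoc flip: ennreal_mult)
      also have "(\<integral>\<^sup>+x. lq_norm q (\<lambda>j. g j x) epowr p * ennreal (v x) \<partial>lebesgue)
        = (\<integral>\<^sup>+x. lq_norm q (\<lambda>j. g j x) epowr p \<partial>density lebesgue (\<lambda>x. ennreal (w x)))"
        unfolding dens lq_norm_def by (subst nn_integral_density) (auto simp: mult.commute)
      finally have "weighted_Lp_norm p w (\<lambda>x. lq_norm q (\<lambda>j. maximal_op H (f j) x))
        \<le> (ennreal K * (\<integral>\<^sup>+x. lq_norm q (\<lambda>j. g j x) epowr p \<partial>density lebesgue (\<lambda>x. ennreal (w x)))) epowr (1 / p)"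
        unfolding weighted_Lp_norm_def using p by (intro epowr_mono) auto
      also have "\<dots> = ennreal (K powr (1 / p)) * weighted_Lp_norm p w (\<lambda>x. lq_norm q (\<lambda>j. g j x))"
        using p K by (simp add: weighted_Lp_norm_def epowr_mult epowr_ennreal)
      finally show "weighted_Lp_norm p w (\<lambda>x. lq_norm q (\<lambda>j. maximal_op H (f j) x))
        \<le> ennreal (K powr (1 / p)) * weighted_Lp_norm p w (\<lambda>x. lq_norm q (\<lambda>j. ennreal (norm (f j x))))"
        by (simp add: g_def)
    qed
  qed
qed

end
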